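(* Let $N \in \mathbb{N}$ with $N\ge 1$, let $k \in \mathbb{N}$ with $k \ge 1$, let $\ell \in \{0, \dotsc, k - 1\}$, let $1 < p < q < \infty$ and let $\lambda\in\mathbb{R}$ satisfy $-\ell \le \lambda \le \frac{k p - \ell q}{q - p}$. Then there exists a constant $C$ (depending only on $N,k,\ell,p,q,\lambda$) such that for every $\rho > 0$ and every $u \in W^{k, p} (\mathbb{R}^N) \cap \mathcal{L}^{1, \lambda}_{\ell, \rho} (\mathbb{R}^N)$, one has $D^\ell u \in L^q (\mathbb{R}^N)$ and \[ \int_{\mathbb{R}^N} \rho^{\ell q} |D^\ell u|^q \le C \bigl(\rho^{-\lambda} |u|_{\mathcal{L}^{1, \lambda}_{\ell, \rho} (\mathbb{R}^N)}\bigr)^{q - p} \int_{\mathbb{R}^N} \bigl(\rho^{k p} |D^k u|^p + \rho^{\ell p}|D^\ell u|^p\bigr). \]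
   Context: $W^{k,p}(\mathbb{R}^N)$ is the usual Sobolev space of functions in $L^p(\mathbb{R}^N)$ whose weak derivatives up to order $k$ are in $L^p(\mathbb{R}^N)$, and $D^j u$ denotes the (tensor-valued) weak derivative of order $j$, with $D^0u=u$. $B_r(x)$ is the ball of radius $r$ centred at $x$ and $⨍_{B_r(x)} f = \frac{1}{|B_r(x)|}\int_{B_r(x)} f$ denotes the average. $\mathcal{P}_{\ell-1}(\mathbb{R}^N)$ is the space of polynomials on $\mathbb{R}^N$ of degree at most $\ell-1$, with the convention $\mathcal{P}_{-1}(\mathbb{R}^N)=\{0\}$. For $\rho>0$ and $\lambda\in\mathbb{R}$, the localized Campanato semi-norm is \[ |u|_{\mathcal{L}^{1,\lambda}_{\ell,\rho}(\mathbb{R}^N)} = \sup_{x\in\mathbb{R}^N,\; r\in(0,\rho)} r^\lambda \inf_{P\in\mathcal{P}_{\ell-1}(\mathbb{R}^N)} \frac{1}{|B_r(x)|}\int_{B_r(x)} |u-P|, \] and $\mathcal{L}^{1,\lambda}_{\ell,\rho}(\mathbb{R}^N)$ is the set of locally integrable functions $u$ for which this quantity is finite. *)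

theory Defs
  imports "HOL-Analysis.Analysis"
begin

section \<open>Test functions\<close>

text \<open>A list of coordinates \<open>[i\<^sub>1, \<dots>, i\<^sub>j]\<close> stands for the iterated partial derivative
  \<open>\<partial>\<^bsub>i\<^sub>1\<^esub> \<dots> \<partial>\<^bsub>i\<^sub>j\<^esub>\<close>.\<close>

fun iterated_partial :: "'n list \<Rightarrow> (real ^ 'n \<Rightarrow> real) \<Rightarrow> real ^ 'n::finite \<Rightarrow> real" where
  "iterated_partial [] f x = f x"
| "iterated_partial (i # is) f x = frechet_derivative (iterated_partial is f) (at x) (axis i 1)"

text \<open>Differentiability of all iterated partial derivatives at every point is smoothness.\<close>

definition test_function :: "(real ^ 'n::finite \<Rightarrow> real) \<Rightarrow> bool" where
  "test_function \<phi> \<longleftrightarrow>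
     (\<forall>is. iterated_partial is \<phi> differentiable_on UNIV) \<and>
     compact (closure (support_on UNIV \<phi>))"

section \<open>Weak derivatives\<close>

definition locally_integrable :: "(real ^ 'n::finite \<Rightarrow> real) \<Rightarrow> bool" where
  "locally_integrable f \<longleftrightarrow> (\<forall>K. compact K \<longrightarrow> set_integrable lebesgue K f)"

definition has_weak_partial ::
  "(real ^ 'n::finite \<Rightarrow> real) \<Rightarrow> 'n list \<Rightarrow> (real ^ 'n \<Rightarrow> real) \<Rightarrow> bool" where
  "has_weak_partial u is v \<longleftrightarrow>
     locally_integrable u \<and> locally_integrable v \<and>
     (\<forall>\<phi>. test_function \<phi> \<longrightarrow>
        (LINT x|lebesgue. u x * iterated_partial is \<phi> x) =
        (- 1) ^ length is * (LINT x|lebesgue. v x * \<phi> x))"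

text \<open>A weak partial derivative is unique up to null sets; a representative is chosen. It is
  meaningful only if some weak partial derivative exists.\<close>

definition weak_partial :: "'n list \<Rightarrow> (real ^ 'n \<Rightarrow> real) \<Rightarrow> real ^ 'n::finite \<Rightarrow> real" where
  "weak_partial is u = (if is = [] then u else (SOME v. has_weak_partial u is v))"

text \<open>A tensor of order \<open>j\<close> is given by its components, which are indexed by the lists of
  coordinates of length \<open>j\<close>; its norm is the Euclidean norm of the components.\<close>

definition weak_deriv ::
  "nat \<Rightarrow> (real ^ 'n \<Rightarrow> real) \<Rightarrow> real ^ 'n::finite \<Rightarrow> 'n list \<Rightarrow> real" where
  "weak_deriv j u x = (\<lambda>is. if length is = j then weak_partial is u x else 0)"

definition tensor_norm :: "nat \<Rightarrow> ('n::finite list \<Rightarrow> real) \<Rightarrow> real" where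
  "tensor_norm j T = L2_set T {is. length is = j}"

section \<open>Lebesgue and Sobolev spaces\<close>

definition Lp_space :: "real \<Rightarrow> (real ^ 'n::finite \<Rightarrow> real) set" where
  "Lp_space p = {f. f \<in> borel_measurable lebesgue \<and> integrable lebesgue (\<lambda>x. \<bar>f x\<bar> powr p)}"

definition Lp_tensor_space ::
  "nat \<Rightarrow> real \<Rightarrow> (real ^ 'n::finite \<Rightarrow> 'n list \<Rightarrow> real) set" where
  "Lp_tensor_space j p =
     {F. (\<forall>is. length is = j \<longrightarrow> (\<lambda>x. F x is) \<in> borel_measurable lebesgue) \<and>
         integrable lebesgue (\<lambda>x. tensor_norm j (F x) powr p)}"

definition sobolev_space :: "nat \<Rightarrow> real \<Rightarrow> (real ^ 'n::finite \<Rightarrow> real) set" where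
  "sobolev_space k p =
     {u. u \<in> Lp_space p \<and>
         (\<forall>is. length is \<le> k \<longrightarrow> (\<exists>v \<in> Lp_space p. has_weak_partial u is v))}"

section \<open>Campanato spaces\<close>

text \<open>Polynomials of degree at most \<open>d\<close>, where \<open>\<alpha>\<close> ranges over multi-indices. The degree bound is
  an integer, so that \<open>d = - 1\<close> leaves only the empty sum.\<close>

definition poly_space :: "int \<Rightarrow> (real ^ 'n::finite \<Rightarrow> real) set" where
  "poly_space d =
     {P. \<exists>c. P = (\<lambda>x. \<Sum>\<alpha> | int (\<Sum>i\<in>UNIV. \<alpha> i) \<le> d. c \<alpha> * (\<Prod>i\<in>UNIV. (x $ i) ^ \<alpha> i))}"

definition mean_deviation ::
  "(real ^ 'n::finite \<Rightarrow> real) \<Rightarrow> (real ^ 'n \<Rightarrow> real) \<Rightarrow> real ^ 'n \<Rightarrow> real \<Rightarrow> ennreal" where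
  "mean_deviation u P x r =
     (\<integral>\<^sup>+y\<in>ball x r. ennreal \<bar>u y - P y\<bar> \<partial>lebesgue) / emeasure lebesgue (ball x r)"

definition campanato_seminorm ::
  "real \<Rightarrow> nat \<Rightarrow> real \<Rightarrow> (real ^ 'n::finite \<Rightarrow> real) \<Rightarrow> ennreal" where
  "campanato_seminorm lam l \<rho> u =
     (SUP (x, r) \<in> UNIV \<times> {0<..<\<rho>}.
        ennreal (r powr lam) * (INF P \<in> poly_space (int l - 1). mean_deviation u P x r))"

definition campanato_space :: "real \<Rightarrow> nat \<Rightarrow> real \<Rightarrow> (real ^ 'n::finite \<Rightarrow> real) set" where
  "campanato_space lam l \<rho> = {u. locally_integrable u \<and> campanato_seminorm lam l \<rho> u < \<infinity>}"

end

(*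
Fix a product bump g supported in [0,1]^N, put phi_s(y) = s^-N g((y - x) / s), and let v be a component
of D^l u. Moving l derivatives onto the kernel annihilates polynomials of degree < l, so h(s), the
integral of v against phi_s, is at most C s^(-l - lambda) times the Campanato seminorm A. On the other hand
the m-th derivative of h in s, m = k - l, is a sum of averages of D^k u, because d/ds phi_s is the
divergence of -(z phi)_s; hence it is at most C M(x), where M is a local maximal function of |D^k u|.
An m-th order finite difference in s reaches down to s -> 0, where h(s) tends to a positive multiple of v(x)
at Lebesgue points:
  |D^l u(x)| <= C (delta^(-l - lambda) A + delta^m M(x))   for all delta < kappa rho.
Optimizing delta bounds |D^l u|^q pointwise, and the L^p maximal inequality finishes the proof.
*)

theory Submission
  imports Defs
begin

text \<open>The Campanato bound for h(s) blows up as s -> 0, so it says nothing about the limit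
  v(x). The finite difference therefore samples h only at scales at least delta, where s^(-l -
  lambda) is controlled because -l <= lambda. The averages of D^k u, by contrast, are bounded by
  M(x) down to s = 0, since multiplying a bump by coordinates does not enlarge its support.

  The balance delta^(k + lambda) = A / M makes both terms equal to delta^m M. As m q = (k +
  lambda)(q - p) + e with e = k p - l q - lambda (q - p), one gets delta^(m q) M^q = A^(q - p)
  delta^e M^p: this is the origin of the exponent q - p. The upper bound on lambda says e >= 0,
  which permits delta^e <= rho^e.

  The value kappa = 1 / ((N + 1)(k - l)) arises because the kernel of scale s lives in a ball of
  radius (N + 1) s and the largest scale used is just above (k - l) delta; that ball must have
  radius below rho.

  Membership of D^l u in L^q is part of the conclusion, so the final integration takes place in the
  extended nonnegative reals.\<close>

section \<open>Maximal functions\<close>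

text \<open>Uncentred averages, so that superlevel sets are unions of balls, hence open and
  measurable. The cutoff \<open>R\<close> matches the radius range of the Campanato seminorm and
  bounds the radii in the Vitali lemma.\<close>

definition maximal_function :: "real \<Rightarrow> ('a::euclidean_space \<Rightarrow> ennreal) \<Rightarrow> 'a \<Rightarrow> ennreal" where
  "maximal_function R f x =
     (SUP (a, r) \<in> {(a, r). 0 < r \<and> r < R \<and> x \<in> ball a r}.
        (\<integral>\<^sup>+y\<in>ball a r. f y \<partial>lborel) / emeasure lborel (ball a r))"

lemma less_maximal_function_iff:
  "t < maximal_function R f x \<longleftrightarrow>
     (\<exists>a r. 0 < r \<and> r < R \<and> x \<in> ball a r \<and>
        t < (\<integral>\<^sup>+y\<in>ball a r. f y \<partial>lborel) / emeasure lborel (ball a r))"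
  unfolding maximal_function_def less_SUP_iff by auto

lemma superlevel_maximal_function:
  "{x. t < maximal_function R f x} =
     (\<Union>(a, r) \<in> {(a, r). 0 < r \<and> r < R \<and>
        t < (\<integral>\<^sup>+y\<in>ball a r. f y \<partial>lborel) / emeasure lborel (ball a r)}. ball a r)"
  unfolding less_maximal_function_iff by fastforce

lemma open_superlevel_maximal_function: "open {x. t < maximal_function R f x}"
  unfolding superlevel_maximal_function by (intro open_UN) auto

lemma borel_measurable_maximal_function [measurable]:
  "maximal_function R f \<in> borel_measurable borel"
  by (rule borel_measurableI_greater)
     (simp add: borel_open open_superlevel_maximal_function)

lemma emeasure_ball_pos_finite:
  fixes a :: "'a::euclidean_space"
  assumes "0 < r"
  shows "0 < emeasure lborel (ball a r)" "emeasure lborel (ball a r) < \<infinity>"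
  using assms by (simp_all add: emeasure_ball)

lemma ennreal_less_divide_imp:
  fixes a b t :: ennreal
  assumes "t < a / b" "0 < b" "b < \<infinity>"
  shows "t * b \<le> a"
proof -
  have "t * b \<le> (a / b) * b"
    using assms by (intro mult_right_mono) auto
  also have "\<dots> = a"
    using assms by (metis ennreal_divide_times ennreal_times_divide mult_divide_eq_ennreal
      infinity_ennreal_def mult.commute order_less_irrefl)
  finally show ?thesis .
qed

text \<open>Vitali's lemma selects countably many disjoint balls of average above \<open>t\<close>
  whose fivefold dilates cover the superlevel set. Dilation costs the factor 5^N; disjointness lets
  the integrals over the balls be summed.\<close>

lemma maximal_function_weak_type:
  fixes f :: "'a::euclidean_space \<Rightarrow> ennreal"
  assumes [measurable]: "f \<in> borel_measurable borel"
  shows "t * emeasure lborel {x. t < maximal_function R f x} \<le> 5 ^ DIM('a) * (\<integral>\<^sup>+x. f x \<partial>lborel)"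
proof -
  define K where "K = {(a, r). 0 < r \<and> r < R \<and>
        t < (\<integral>\<^sup>+y\<in>ball a r. f y \<partial>lborel) / emeasure lborel (ball a r)}"
  have K: "0 < snd i \<and> snd i \<le> R" if "i \<in> K" for i
    using that by (auto simp: K_def)
  obtain C where C: "countable C" "C \<subseteq> K"
     "pairwise (\<lambda>i j. disjnt (ball (fst i) (snd i)) (ball (fst j) (snd j))) C"
     "{x. t < maximal_function R f x} \<subseteq> (\<Union>i\<in>C. ball (fst i) (5 * snd i))"
    by (rule Vitali_covering_lemma_balls[of "{x. t < maximal_function R f x}" fst snd K R])
       (use K in \<open>fastforce simp: less_maximal_function_iff K_def\<close>)+
  have fam: "disjoint_family_on (\<lambda>i. ball (fst i) (snd i)) C"
    using C(3) by (auto simp: disjoint_family_on_def pairwise_def disjnt_def)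
  \<comment> \<open>Countable subadditivity, with the sum over \<open>C\<close> written as an
    integral over \<open>count_space\<close> so that the index set is not enumerated.\<close>
  have cover: "emeasure lborel {x. t < maximal_function R f x} \<le>
      (\<integral>\<^sup>+i. emeasure lborel (ball (fst i) (5 * snd i)) \<partial>count_space C)"
  proof -
    have "emeasure lborel {x. t < maximal_function R f x} \<le>
        emeasure lborel (\<Union>i\<in>C. ball (fst i) (5 * snd i))"
      by (intro emeasure_mono C(4)) (simp add: borel_open open_UN)
    also have "\<dots> = (\<integral>\<^sup>+x. indicator (\<Union>i\<in>C. ball (fst i) (5 * snd i)) x \<partial>lborel)"
      by (simp add: borel_open open_UN)
    also have "\<dots> \<le> (\<integral>\<^sup>+x. (\<integral>\<^sup>+i. indicator (ball (fst i) (5 * snd i)) x \<partial>count_space C) \<partial>lborel)"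
    proof (intro nn_integral_mono)
      fix x :: 'a
      show "indicator (\<Union>i\<in>C. ball (fst i) (5 * snd i)) x
          \<le> (\<integral>\<^sup>+i. indicator (ball (fst i) (5 * snd i)) x \<partial>count_space C :: ennreal)"
      proof (cases "x \<in> (\<Union>i\<in>C. ball (fst i) (5 * snd i))")
        case True
        then obtain i where i: "i \<in> C" "x \<in> ball (fst i) (5 * snd i)" by auto
        have "(1::ennreal) = indicator (ball (fst i) (5 * snd i)) x"
          using i by (simp del: mem_ball)
        also have "\<dots> \<le> (\<integral>\<^sup>+i. indicator (ball (fst i) (5 * snd i)) x \<partial>count_space C)"
          by (rule nn_integral_ge_point) (use i in simp)
        finally show ?thesis by (simp add: indicator_def)
      next
        case False
        then show ?thesis by (simp only: indicator_simps if_False zero_le not_False_eq_True)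
      qed
    qed
    also have "\<dots> = (\<integral>\<^sup>+i. (\<integral>\<^sup>+x. indicator (ball (fst i) (5 * snd i)) x \<partial>lborel) \<partial>count_space C)"
      by (rule nn_integral_count_space_nn_integral[OF C(1)]) (auto intro!: borel_measurable_indicator)
    finally show ?thesis by simp
  qed
  have "t * emeasure lborel {x. t < maximal_function R f x} \<le>
      t * (\<integral>\<^sup>+i. emeasure lborel (ball (fst i) (5 * snd i)) \<partial>count_space C)"
    by (intro mult_left_mono cover) simp
  also have "\<dots> = (\<integral>\<^sup>+i. t * emeasure lborel (ball (fst i) (5 * snd i)) \<partial>count_space C)"
    by (simp add: nn_integral_cmult)
  also have "\<dots> \<le> (\<integral>\<^sup>+i. 5 ^ DIM('a) * (\<integral>\<^sup>+y\<in>ball (fst i) (snd i). f y \<partial>lborel) \<partial>count_space C)"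
  proof (intro nn_integral_mono)
    fix i assume "i \<in> space (count_space C)"
    then have i: "i \<in> K" using C by auto
    then have r: "0 < snd i" using K by auto
    have "emeasure lborel (ball (fst i) (5 * snd i)) = 5 ^ DIM('a) * emeasure lborel (ball (fst i) (snd i))"
      using r by (simp add: emeasure_ball power_mult_distrib ennreal_mult ennreal_power[symmetric] mult_ac)
    then have "t * emeasure lborel (ball (fst i) (5 * snd i))
        = 5 ^ DIM('a) * (t * emeasure lborel (ball (fst i) (snd i)))"
      by (simp add: mult_ac)
    also have "\<dots> \<le> 5 ^ DIM('a) * (\<integral>\<^sup>+y\<in>ball (fst i) (snd i). f y \<partial>lborel)"
      using i emeasure_ball_pos_finite[OF r, of "fst i"]
      by (intro mult_left_mono ennreal_less_divide_imp) (auto simp: K_def)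
    finally show "t * emeasure lborel (ball (fst i) (5 * snd i)) \<le> \<dots>" .
  qed
  \<comment> \<open>Integrals over disjoint balls add up as values of the single measure with
    density \<open>f\<close>.\<close>
  also have "\<dots> = 5 ^ DIM('a) * (\<integral>\<^sup>+i. emeasure (density lborel f) (ball (fst i) (snd i)) \<partial>count_space C)"
    by (subst nn_integral_cmult) (auto simp: emeasure_density)
  also have "(\<integral>\<^sup>+i. emeasure (density lborel f) (ball (fst i) (snd i)) \<partial>count_space C) =
      emeasure (density lborel f) (\<Union>i\<in>C. ball (fst i) (snd i))"
    by (rule emeasure_UN_countable[symmetric]) (use C(1) fam in auto)
  also have "\<dots> \<le> emeasure (density lborel f) (space (density lborel f))"
    by (rule emeasure_space)
  also have "\<dots> = (\<integral>\<^sup>+x. f x \<partial>lborel)"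
    by (simp add: emeasure_density)
  finally show ?thesis by (simp add: mult_left_mono)
qed

text \<open>Since \<open>f\<close> is at most its part above \<open>t\<close> plus \<open>t\<close>,
  an average of \<open>f\<close> above 2t forces an average of that part above \<open>t\<close> on
  the same ball. This is the splitting behind Marcinkiewicz interpolation.\<close>

lemma maximal_function_truncate:
  fixes f :: "'a::euclidean_space \<Rightarrow> ennreal"
  assumes [measurable]: "f \<in> borel_measurable borel" and "0 \<le> t"
    and "ennreal (2 * t) < maximal_function R f x"
  shows "ennreal t < maximal_function R (\<lambda>y. f y * indicator {y. ennreal t < f y} y) x"
proof -
  obtain a r where ar: "0 < r" "r < R" "x \<in> ball a r"
    "ennreal (2 * t) < (\<integral>\<^sup>+y\<in>ball a r. f y \<partial>lborel) / emeasure lborel (ball a r)"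
    using assms(3) by (auto simp: less_maximal_function_iff)
  let ?B = "ball a r" let ?g = "\<lambda>y. f y * indicator {y. ennreal t < f y} y"
  let ?m = "emeasure lborel ?B"
  note m = emeasure_ball_pos_finite[OF ar(1), of a]
  have [measurable]: "?B \<in> sets borel" by (simp add: borel_open)
  have "(\<integral>\<^sup>+y\<in>?B. f y \<partial>lborel) \<le> (\<integral>\<^sup>+y. ?g y * indicator ?B y + ennreal t * indicator ?B y \<partial>lborel)"
    by (intro nn_integral_mono) (auto simp: indicator_def)
  also have "\<dots> = (\<integral>\<^sup>+y\<in>?B. ?g y \<partial>lborel) + ennreal t * ?m"
    by (subst nn_integral_add, measurable) (simp add: nn_integral_cmult_indicator)
  finally have "(\<integral>\<^sup>+y\<in>?B. f y \<partial>lborel) / ?m \<le> ((\<integral>\<^sup>+y\<in>?B. ?g y \<partial>lborel) + ennreal t * ?m) / ?m"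
    by (rule divide_right_mono_ennreal)
  also have "\<dots> = (\<integral>\<^sup>+y\<in>?B. ?g y \<partial>lborel) / ?m + ennreal t"
    using m by (simp add: add_divide_distrib_ennreal mult_divide_eq_ennreal)
  finally have "ennreal (2 * t) < (\<integral>\<^sup>+y\<in>?B. ?g y \<partial>lborel) / ?m + ennreal t"
    using ar(4) by (rule order.strict_trans2[rotated])
  then have "ennreal t + ennreal t < (\<integral>\<^sup>+y\<in>?B. ?g y \<partial>lborel) / ?m + ennreal t"
    using \<open>0 \<le> t\<close> by (simp flip: ennreal_plus)
  then have "ennreal t < (\<integral>\<^sup>+y\<in>?B. ?g y \<partial>lborel) / ?m"
    by (meson add_right_mono linorder_not_le)
  then show ?thesis
    unfolding less_maximal_function_iff using ar by blast
qed

lemma nn_integral_powr_from_0: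
  assumes "a > -1" "0 \<le> c"
  shows "(\<integral>\<^sup>+t. ennreal (t powr a) * indicator {t. 0 < t \<and> t < c} t \<partial>lborel) = ennreal (c powr (a + 1) / (a + 1))"
proof -
  have "(\<integral>\<^sup>+t. ennreal (t powr a) * indicator {t. 0 < t \<and> t < c} t \<partial>lborel) =
      (\<integral>\<^sup>+t. ennreal (indicator {0..c} t * t powr a) \<partial>lborel)"
    using AE_lborel_singleton[of 0] AE_lborel_singleton[of c]
    by (intro nn_integral_cong_AE, eventually_elim) (auto simp: indicator_def)
  also have "\<dots> = ennreal (c powr (a + 1) / (a + 1))"
  proof (rule nn_integral_has_integral_lborel)
    have "((\<lambda>t. if t \<in> {0..c} then t powr a else 0) has_integral c powr (a + 1) / (a + 1)) UNIV"
      using has_integral_powr_from_0[OF assms] by (simp only: has_integral_restrict_UNIV)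
    then show "((\<lambda>t. indicator {0..c} t * t powr a) has_integral c powr (a + 1) / (a + 1)) UNIV"
      by (rule has_integral_eq[rotated]) (auto simp: indicator_def)
  qed auto
  finally show ?thesis .
qed

text \<open>The majorant \<open>J\<close> is the layer-cake form of the \<open>p\<close>-th power of the maximal function; it avoids
  real powers of extended reals.\<close>

lemma maximal_function_strong_type:
  fixes f :: "'a::euclidean_space \<Rightarrow> real"
  assumes [measurable]: "f \<in> borel_measurable borel" and f0: "\<And>x. 0 \<le> f x" and p: "1 < p"
  obtains J where "J \<in> borel_measurable borel"
    "\<And>x w. 0 \<le> w \<Longrightarrow> ennreal w \<le> maximal_function R f x \<Longrightarrow> ennreal (w powr p) \<le> J x"
    "(\<integral>\<^sup>+x. J x \<partial>lborel) \<le>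
       ennreal (5 ^ DIM('a) * 2 powr p * p / (p - 1)) * (\<integral>\<^sup>+x. ennreal (f x powr p) \<partial>lborel)"
proof -
  let ?M = "maximal_function R (\<lambda>x. ennreal (f x))"
  define J where "J = (\<lambda>x. \<integral>\<^sup>+t. ennreal (p * t powr (p - 1)) *
    indicator {(t, x). 0 < t \<and> ennreal t < ?M x} (t, x) \<partial>lborel)"
  have [measurable]: "{(t, x). 0 < t \<and> ennreal t < ?M x} \<in> sets (borel \<Otimes>\<^sub>M borel)"
  proof -
    have "{z \<in> space (borel \<Otimes>\<^sub>M borel). 0 < fst z \<and> ennreal (fst z) < ?M (snd z)} \<in> sets (borel \<Otimes>\<^sub>M borel)"
      by measurable
    then show ?thesis by (simp add: case_prod_beta' space_pair_measure)
  qed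
  have J1: "J \<in> borel_measurable borel"
    unfolding J_def by measurable
  have J2: "ennreal (w powr p) \<le> J x" if w: "0 \<le> w" "ennreal w \<le> ?M x" for x w
  proof -
    have "ennreal (w powr p) = ennreal p * ennreal (w powr (p - 1 + 1) / (p - 1 + 1))"
      using p by (simp add: ennreal_mult[symmetric])
    also have "\<dots> = ennreal p * (\<integral>\<^sup>+t. ennreal (t powr (p - 1)) * indicator {t. 0 < t \<and> t < w} t \<partial>lborel)"
      using p w(1) by (subst nn_integral_powr_from_0) auto
    also have "\<dots> = (\<integral>\<^sup>+t. ennreal p * (ennreal (t powr (p - 1)) * indicator {t. 0 < t \<and> t < w} t) \<partial>lborel)"
      by (simp add: nn_integral_cmult)
    also have "\<dots> \<le> J x"
      unfolding J_def
    proof (intro nn_integral_mono)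
      fix t :: real
      have "ennreal t < ?M x" if "0 < t" "t < w"
        using w that ennreal_lessI[of w t] by (simp add: order.strict_trans2)
      then show "ennreal p * (ennreal (t powr (p - 1)) * indicator {t. 0 < t \<and> t < w} t)
          \<le> ennreal (p * t powr (p - 1)) * indicator {(t, x). 0 < t \<and> ennreal t < ?M x} (t, x)"
        using p by (auto simp: indicator_def ennreal_mult)
    qed
    finally show ?thesis .
  qed
  let ?c = "5 ^ DIM('a) * 2 :: real"
  \<comment> \<open>The weak-type bound for the part of \<open>f\<close> above t/2. Writing p
    t^(p-1) as 2 p t^(p-2) times t/2 exposes the quantity that it controls.\<close>
  have slice: "ennreal (p * t powr (p - 1)) * emeasure lborel {x. ennreal t < ?M x} \<le>
      (\<integral>\<^sup>+x. ennreal (?c * p * t powr (p - 2) * f x) * indicator {x. t < 2 * f x} x \<partial>lborel)" if t: "0 < t" for t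
  proof -
    let ?g = "\<lambda>x. ennreal (f x) * indicator {x. ennreal (t / 2) < ennreal (f x)} x"
    have "ennreal (t / 2) * emeasure lborel {x. ennreal t < ?M x} \<le>
        ennreal (t / 2) * emeasure lborel {x. ennreal (t / 2) < maximal_function R ?g x}"
      by (intro mult_left_mono emeasure_mono)
         (use t maximal_function_truncate[of "\<lambda>x. ennreal (f x)" "t / 2"] in auto)
    also have "\<dots> \<le> 5 ^ DIM('a) * (\<integral>\<^sup>+x. ?g x \<partial>lborel)"
      by (rule maximal_function_weak_type) measurable
    finally have *: "ennreal (t / 2) * emeasure lborel {x. ennreal t < ?M x} \<le> 5 ^ DIM('a) * (\<integral>\<^sup>+x. ?g x \<partial>lborel)" .
    have "p * t powr (p - 1) = 2 * p * t powr (p - 2) * (t / 2)"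
      using t powr_add[of t "p - 2" 1] by simp
    then have "ennreal (p * t powr (p - 1)) * emeasure lborel {x. ennreal t < ?M x} =
        ennreal (2 * p * t powr (p - 2)) * (ennreal (t / 2) * emeasure lborel {x. ennreal t < ?M x})"
      using t p by (simp add: ennreal_mult[symmetric] mult.assoc[symmetric])
    also have "\<dots> \<le> ennreal (2 * p * t powr (p - 2)) * (5 ^ DIM('a) * (\<integral>\<^sup>+x. ?g x \<partial>lborel))"
      by (intro mult_left_mono *) simp
    also have "\<dots> = ennreal (?c * p * t powr (p - 2)) * (\<integral>\<^sup>+x. ?g x \<partial>lborel)"
      using p by (simp add: ennreal_mult ennreal_power[symmetric] mult_ac)
    also have "\<dots> = (\<integral>\<^sup>+x. ennreal (?c * p * t powr (p - 2)) * ?g x \<partial>lborel)"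
      by (subst nn_integral_cmult) auto
    also have "\<dots> = (\<integral>\<^sup>+x. ennreal (?c * p * t powr (p - 2) * f x) * indicator {x. t < 2 * f x} x \<partial>lborel)"
      using p t f0 by (intro nn_integral_cong) (auto simp: indicator_def ennreal_mult ennreal_less_iff)
    finally show ?thesis .
  qed
  have "(\<integral>\<^sup>+x. J x \<partial>lborel) = (\<integral>\<^sup>+t. (\<integral>\<^sup>+x. ennreal (p * t powr (p - 1)) *
    indicator {(t, x). 0 < t \<and> ennreal t < ?M x} (t, x) \<partial>lborel) \<partial>lborel)"
    unfolding J_def
    by (rule lborel_pair.Fubini'[of "\<lambda>t x. ennreal (p * t powr (p - 1)) *
      indicator {(t, x). 0 < t \<and> ennreal t < ?M x} (t, x)"]) measurable
  also have "\<dots> \<le> (\<integral>\<^sup>+t. (\<integral>\<^sup>+x. ennreal (?c * p * t powr (p - 2) * f x) * indicator {t. 0 < t \<and> t < 2 * f x} t \<partial>lborel) \<partial>lborel)"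
  proof (rule nn_integral_mono)
    fix t :: real
    show "(\<integral>\<^sup>+x. ennreal (p * t powr (p - 1)) * indicator {(t, x). 0 < t \<and> ennreal t < ?M x} (t, x) \<partial>lborel) \<le>
       (\<integral>\<^sup>+x. ennreal (?c * p * t powr (p - 2) * f x) * indicator {t. 0 < t \<and> t < 2 * f x} t \<partial>lborel)"
    proof (cases "0 < t")
      case True
      have "(\<integral>\<^sup>+x. ennreal (p * t powr (p - 1)) * indicator {(t, x). 0 < t \<and> ennreal t < ?M x} (t, x) \<partial>lborel)
         = (\<integral>\<^sup>+x. ennreal (p * t powr (p - 1)) * indicator {x. ennreal t < ?M x} x \<partial>lborel)"
        using True by (intro nn_integral_cong) (auto simp: indicator_def)
      also have "\<dots> = ennreal (p * t powr (p - 1)) * emeasure lborel {x. ennreal t < ?M x}"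
        by (subst nn_integral_cmult_indicator) auto
      also note slice[OF True]
      also have "(\<integral>\<^sup>+x. ennreal (?c * p * t powr (p - 2) * f x) * indicator {x. t < 2 * f x} x \<partial>lborel)
        = (\<integral>\<^sup>+x. ennreal (?c * p * t powr (p - 2) * f x) * indicator {t. 0 < t \<and> t < 2 * f x} t \<partial>lborel)"
        using True by (intro nn_integral_cong) (auto simp: indicator_def)
      finally show ?thesis .
    next
      case False
      then show ?thesis by simp
    qed
  qed
  also have "\<dots> = (\<integral>\<^sup>+x. (\<integral>\<^sup>+t. ennreal (?c * p * t powr (p - 2) * f x) * indicator {t. 0 < t \<and> t < 2 * f x} t \<partial>lborel) \<partial>lborel)"
    (is "(\<integral>\<^sup>+t. (\<integral>\<^sup>+x. ?F t x \<partial>lborel) \<partial>lborel) = _")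
  proof -
    have "(\<lambda>z::real \<times> 'a. ennreal (?c * p * fst z powr (p - 2) * f (snd z)) * indicator {z. 0 < fst z \<and> fst z < 2 * f (snd z)} z)
       \<in> borel_measurable (lborel \<Otimes>\<^sub>M lborel)" by measurable
    also have "(\<lambda>z::real \<times> 'a. ennreal (?c * p * fst z powr (p - 2) * f (snd z)) * indicator {z. 0 < fst z \<and> fst z < 2 * f (snd z)} z)
       = (\<lambda>(t, x). ?F t x)"
      by (simp add: fun_eq_iff indicator_def)
    finally show ?thesis
      by (rule lborel_pair.Fubini'[of "\<lambda>t x. ?F t x", symmetric])
  qed
  also have "\<dots> = (\<integral>\<^sup>+x. ennreal (5 ^ DIM('a) * 2 powr p * p / (p - 1)) * ennreal (f x powr p) \<partial>lborel)"
  proof (intro nn_integral_cong)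
    fix x :: 'a
    have "(\<integral>\<^sup>+t. ennreal (?c * p * t powr (p - 2) * f x) * indicator {t. 0 < t \<and> t < 2 * f x} t \<partial>lborel) =
      (\<integral>\<^sup>+t. ennreal (?c * p * f x) * (ennreal (t powr (p - 2)) * indicator {t. 0 < t \<and> t < 2 * f x} t) \<partial>lborel)"
      using p f0 by (intro nn_integral_cong) (auto simp: indicator_def ennreal_mult[symmetric] mult_ac)
    \<comment> \<open>Here 1 < p enters: the exponent p - 2 exceeds -1, so the integral converges at
      0.\<close>
    also have "\<dots> = ennreal (?c * p * f x) * ennreal ((2 * f x) powr (p - 2 + 1) / (p - 2 + 1))"
      using p f0 by (subst nn_integral_cmult, measurable) (subst nn_integral_powr_from_0, auto)
    also have "\<dots> = ennreal (?c * p * f x * ((2 * f x) powr (p - 1) / (p - 1)))"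
      using p f0[of x] by (subst ennreal_mult) auto
    also have "?c * p * f x * ((2 * f x) powr (p - 1) / (p - 1)) = 5 ^ DIM('a) * 2 powr p * p / (p - 1) * f x powr p"
    proof -
      have "2 * (f x * (2 * f x) powr (p - 1)) = 2 powr p * f x powr p"
        using f0[of x] powr_mult_base[of "2 * f x" "p - 1"] p by (simp add: powr_mult)
      moreover have "?c * p * f x * ((2 * f x) powr (p - 1) / (p - 1)) =
          5 ^ DIM('a) * p / (p - 1) * (2 * (f x * (2 * f x) powr (p - 1)))"
        by simp
      ultimately show ?thesis by (simp only:) simp
    qed
    also have "ennreal \<dots> = ennreal (5 ^ DIM('a) * 2 powr p * p / (p - 1)) * ennreal (f x powr p)"
      using p by (subst ennreal_mult) auto
    finally show "(\<integral>\<^sup>+t. ennreal (?c * p * t powr (p - 2) * f x) * indicator {t. 0 < t \<and> t < 2 * f x} t \<partial>lborel)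
        = ennreal (5 ^ DIM('a) * 2 powr p * p / (p - 1)) * ennreal (f x powr p)" .
  qed
  also have "\<dots> = ennreal (5 ^ DIM('a) * 2 powr p * p / (p - 1)) * (\<integral>\<^sup>+x. ennreal (f x powr p) \<partial>lborel)"
    by (subst nn_integral_cmult) auto
  finally have J3: "(\<integral>\<^sup>+x. J x \<partial>lborel) \<le>
       ennreal (5 ^ DIM('a) * 2 powr p * p / (p - 1)) * (\<integral>\<^sup>+x. ennreal (f x powr p) \<partial>lborel)" .
  show thesis by (rule that[OF J1 J2 J3])
qed


section \<open>Smooth bumps and product test functions\<close>

text \<open>The derivative is quantified anew at each order, so closure under sums, products and
  affine substitutions is a plain induction that mentions no explicit higher derivatives.\<close>

fun times_differentiable :: "nat \<Rightarrow> (real \<Rightarrow> real) \<Rightarrow> bool" where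
  "times_differentiable 0 f \<longleftrightarrow> True"
| "times_differentiable (Suc n) f \<longleftrightarrow>
     (\<exists>f'. (\<forall>t. (f has_real_derivative f' t) (at t)) \<and> times_differentiable n f')"

definition smooth :: "(real \<Rightarrow> real) \<Rightarrow> bool" where
  "smooth f \<longleftrightarrow> (\<forall>n. times_differentiable n f)"

lemma times_differentiable_SucD: "times_differentiable (Suc n) f \<Longrightarrow> times_differentiable n f"
  by (induction n arbitrary: f) auto

lemma times_differentiable_const: "times_differentiable n (\<lambda>t. c)"
proof (induction n arbitrary: c)
  case (Suc n)
  have "((\<lambda>t. c) has_real_derivative 0) (at t)" for t by simp
  with Suc[of 0] show ?case by (auto intro!: exI[of _ "\<lambda>t. 0"])
qed simp

lemma times_differentiable_add:
  "times_differentiable n f \<Longrightarrow> times_differentiable n g \<Longrightarrow> times_differentiable n (\<lambda>t. f t + g t)"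
proof (induction n arbitrary: f g)
  case (Suc n)
  then obtain f' g' where
    "\<And>t. (f has_real_derivative f' t) (at t)" "times_differentiable n f'"
    "\<And>t. (g has_real_derivative g' t) (at t)" "times_differentiable n g'" by auto
  then show ?case using Suc.IH[of f' g'] by (auto intro!: exI[of _ "\<lambda>t. f' t + g' t"] DERIV_add)
qed simp

lemma times_differentiable_mult:
  "times_differentiable n f \<Longrightarrow> times_differentiable n g \<Longrightarrow> times_differentiable n (\<lambda>t. f t * g t)"
proof (induction n arbitrary: f g)
  case (Suc n)
  then obtain f' g' where *:
    "\<And>t. (f has_real_derivative f' t) (at t)" "times_differentiable n f'"
    "\<And>t. (g has_real_derivative g' t) (at t)" "times_differentiable n g'" by auto
  have "times_differentiable n f" "times_differentiable n g"
    using Suc.prems times_differentiable_SucD by auto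
  then have "times_differentiable n (\<lambda>t. f' t * g t + g' t * f t)"
    by (intro times_differentiable_add Suc.IH *)
  moreover have "((\<lambda>t. f t * g t) has_real_derivative f' t * g t + g' t * f t) (at t)" for t
    by (intro DERIV_mult *)
  ultimately show ?case unfolding times_differentiable.simps by (intro exI[of _ "\<lambda>t. f' t * g t + g' t * f t"] conjI allI)
qed simp

lemma times_differentiable_affine:
  "times_differentiable n f \<Longrightarrow> times_differentiable n (\<lambda>t. f (a * t + b))"
proof (induction n arbitrary: f)
  case (Suc n)
  then obtain f' where f':
    "\<And>t. (f has_real_derivative f' t) (at t)" "times_differentiable n f'" by auto
  have "((\<lambda>t. f (a * t + b)) has_real_derivative f' (a * t + b) * a) (at t)" for t
  proof -
    have "((\<lambda>t. a * t + b) has_real_derivative a) (at t)"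
      by (auto intro!: derivative_eq_intros)
    from DERIV_chain2[OF f'(1) this] show ?thesis .
  qed
  moreover have "times_differentiable n (\<lambda>t. f' (a * t + b) * a)"
    by (rule times_differentiable_mult[OF Suc.IH[OF f'(2)] times_differentiable_const])
  ultimately show ?case unfolding times_differentiable.simps by (intro exI[of _ "\<lambda>t. f' (a * t + b) * a"] conjI allI)
qed simp

lemma smooth_const: "smooth (\<lambda>t. c)"
  by (simp add: smooth_def times_differentiable_const)

lemma smooth_ident: "smooth (\<lambda>t. t)"
  unfolding smooth_def
proof
  fix n show "times_differentiable n (\<lambda>t. t)"
    by (cases n) (auto intro!: exI[of _ "\<lambda>t. 1"] times_differentiable_const)
qed

lemma smooth_mult: "smooth f \<Longrightarrow> smooth g \<Longrightarrow> smooth (\<lambda>t. f t * g t)"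
  by (simp add: smooth_def times_differentiable_mult)

lemma smooth_power: "smooth (\<lambda>t. t ^ n)"
  by (induction n) (auto intro: smooth_const smooth_mult smooth_ident)

lemma smooth_affine: "smooth f \<Longrightarrow> smooth (\<lambda>t. f (a * t + b))"
  by (simp add: smooth_def times_differentiable_affine)

text \<open>The derivative witnesses for different orders agree by uniqueness of derivatives; hence
  the one function \<open>deriv f\<close> is differentiable to every order.\<close>

lemma
  assumes "smooth f"
  shows smooth_has_deriv: "(f has_real_derivative deriv f t) (at t)"
    and smooth_deriv: "smooth (deriv f)"
proof -
  have *: "\<exists>f'. (\<forall>t. (f has_real_derivative f' t) (at t)) \<and> times_differentiable n f'" for n
    using assms unfolding smooth_def by (metis times_differentiable.simps(2))
  show **: "(f has_real_derivative deriv f t) (at t)" for t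
    using *[of 0] DERIV_imp_deriv by metis
  show "smooth (deriv f)"
    unfolding smooth_def
  proof
    fix n
    obtain f' where f': "\<And>t. (f has_real_derivative f' t) (at t)" "times_differentiable n f'"
      using * by blast
    then have "deriv f = f'" by (auto simp: DERIV_imp_deriv)
    with f' show "times_differentiable n (deriv f)" by simp
  qed
qed

lemma smooth_continuous_on: "smooth f \<Longrightarrow> continuous_on A f"
  by (meson DERIV_continuous_on has_field_derivative_at_within smooth_has_deriv)

definition bump :: "real \<Rightarrow> real \<Rightarrow> (real \<Rightarrow> real) \<Rightarrow> bool" where
  "bump a b g \<longleftrightarrow> smooth g \<and> (\<forall>t. t \<notin> {a..b} \<longrightarrow> g t = 0)"

lemma bumpD: assumes "bump a b g" shows "smooth g" "t \<notin> {a..b} \<Longrightarrow> g t = 0"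
  using assms unfolding bump_def by blast+

lemma bump_deriv: assumes "bump a b g" shows "bump a b (deriv g)"
  unfolding bump_def
proof (intro conjI allI impI)
  show "smooth (deriv g)" using assms smooth_deriv bumpD by blast
  fix t :: real assume t: "t \<notin> {a..b}"
  have "((\<lambda>t. 0) has_real_derivative 0) (at t)" by simp
  then have "(g has_real_derivative 0) (at t)"
    by (rule has_field_derivative_transform_within_open[of _ _ _ "- {a..b}"])
       (use assms t in \<open>auto simp: bump_def open_Compl\<close>)
  then show "deriv g t = 0" by (rule DERIV_imp_deriv)
qed

lemma bump_higher_deriv: "bump a b g \<Longrightarrow> bump a b ((deriv ^^ n) g)"
  by (induction n) (auto intro: bump_deriv)

lemma bump_mult_smooth: "smooth f \<Longrightarrow> bump a b g \<Longrightarrow> bump a b (\<lambda>t. f t * g t)"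
  by (simp add: bump_def smooth_mult)

lemma bump_rescale:
  assumes "bump 0 1 g" "0 < s" shows "bump x (x + s) (\<lambda>t. g ((t - x) / s) / s)"
proof -
  have "smooth (\<lambda>t. g ((1 / s) * t + (- x / s)) * (1 / s))"
    by (rule smooth_mult[OF smooth_affine smooth_const]) (use assms bumpD in auto)
  moreover have "(\<lambda>t. g ((1 / s) * t + (- x / s)) * (1 / s)) = (\<lambda>t. g ((t - x) / s) / s)"
    by (simp add: diff_divide_distrib)
  ultimately show ?thesis
    using assms by (auto simp: bump_def field_simps)
qed

lemma bump_bounded:
  assumes "bump a b g" obtains B where "\<And>t. \<bar>g t\<bar> \<le> B" "0 < B"
proof -
  have "compact (g ` {a..b})"
    by (intro compact_continuous_image smooth_continuous_on) (use assms bumpD in auto)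
  then obtain B where B: "\<And>t. t \<in> {a..b} \<Longrightarrow> \<bar>g t\<bar> \<le> B" "0 < B"
    by (metis (no_types, lifting) bounded_pos compact_imp_bounded image_eqI real_norm_def)
  then have "\<bar>g t\<bar> \<le> B" for t
    using assms bumpD(2)[of a b g t] by (cases "t \<in> {a..b}") auto
  with B that show ?thesis by blast
qed

text \<open>The classical flat function \<open>exp (- 1 / t)\<close>; its derivatives are polynomials in \<open>1 / t\<close>
  times itself.\<close>

definition flat :: "real poly \<Rightarrow> real \<Rightarrow> real" where
  "flat p t = (if t > 0 then poly p (1 / t) * exp (- (1 / t)) else 0)"

lemma poly_times_exp_minus_tendsto_0: "((\<lambda>x. poly p x * exp (- x)) \<longlongrightarrow> 0) at_top" for p :: "real poly"
proof -
  have "((\<lambda>x. \<Sum>i\<le>degree p. coeff p i * (x ^ i / exp x)) \<longlongrightarrow> (\<Sum>i\<le>degree p. coeff p i * 0)) at_top"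
    by (intro tendsto_intros tendsto_power_div_exp_0)
  moreover have "(\<lambda>x. \<Sum>i\<le>degree p. coeff p i * (x ^ i / exp x)) = (\<lambda>x. poly p x * exp (- x))"
    by (auto simp: poly_altdef sum_distrib_right exp_minus divide_inverse mult.assoc)
  ultimately show ?thesis by simp
qed

lemma flat_tendsto_0: "(flat p \<longlongrightarrow> 0) (at 0)"
proof -
  have "((\<lambda>t. poly p (inverse t) * exp (- inverse t)) \<longlongrightarrow> 0) (at_right (0::real))"
    by (rule filterlim_compose[OF poly_times_exp_minus_tendsto_0 filterlim_inverse_at_top_right])
  then have "(flat p \<longlongrightarrow> 0) (at_right 0)"
    by (rule Lim_transform_eventually) (auto simp: eventually_at_filter flat_def inverse_eq_divide)
  moreover have "(flat p \<longlongrightarrow> 0) (at_left 0)"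
    by (rule tendsto_eventually) (auto simp: eventually_at_filter flat_def)
  ultimately show ?thesis by (simp add: filterlim_at_split)
qed

text \<open>In the variable x = 1/t, d/dt is -x^2 d/dx, which turns p(x) exp(-x) into x^2 (p -
  p')(x) exp(-x). The class of flat functions is thus closed under differentiation.\<close>

lemma flat_has_derivative: "(flat p has_real_derivative flat ([:0, 0, 1:] * (p - pderiv p)) t) (at t)"
proof (cases "0::real" t rule: linorder_cases)
  case less
  have "((\<lambda>t. poly p (1 / t) * exp (- (1 / t))) has_real_derivative
      flat ([:0, 0, 1:] * (p - pderiv p)) t) (at t)"
    using less by (auto intro!: derivative_eq_intros DERIV_chain2[OF poly_DERIV]
      simp: flat_def field_simps power2_eq_square)
  then show ?thesis
    by (rule has_field_derivative_transform_within_open[of _ _ _ "{0<..}"])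
       (use less in \<open>auto simp: flat_def\<close>)
next
  case equal
  \<comment> \<open>Dividing by t multiplies the polynomial by its variable 1/t, that is, replaces
    \<open>p\<close> by \<open>pCons 0 p\<close>; the difference quotient at 0 is again
    flat.\<close>
  have "((\<lambda>h. flat (pCons 0 p) h) \<longlongrightarrow> 0) (at 0)"
    by (rule flat_tendsto_0)
  then have "((\<lambda>h. (flat p (0 + h) - flat p 0) / h) \<longlongrightarrow> 0) (at 0)"
    by (rule Lim_transform_eventually) (auto simp: eventually_at_filter flat_def)
  with equal show ?thesis by (simp add: DERIV_def flat_def)
next
  case greater
  have "((\<lambda>t. 0) has_real_derivative 0) (at t)" by simp
  then have "(flat p has_real_derivative 0) (at t)"
    by (rule has_field_derivative_transform_within_open[of _ _ _ "{..<0}"])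
       (use greater in \<open>auto simp: flat_def\<close>)
  with greater show ?thesis by (simp add: flat_def)
qed

lemma smooth_flat: "smooth (flat p)"
proof -
  have "times_differentiable n (flat p)" for n
    by (induction n arbitrary: p) (use flat_has_derivative in auto)
  then show ?thesis by (simp add: smooth_def)
qed

definition std_bump :: "real \<Rightarrow> real" where
  "std_bump t = flat 1 t * flat 1 (1 - t)"

lemma std_bump: "bump 0 1 std_bump" "0 \<le> std_bump t" "0 < std_bump (1 / 2)"
proof -
  have "smooth (\<lambda>t. flat 1 t * flat 1 ((- 1) * t + 1))"
    by (intro smooth_mult smooth_affine smooth_flat)
  then show "bump 0 1 std_bump"
    by (auto simp: bump_def std_bump_def[abs_def] flat_def)
qed (auto simp: std_bump_def flat_def)

text \<open>At Lebesgue points convolutions tend to v(x) times a product of such integrals, and this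
  factor is divided out later. Continuity and positivity at 1/2 exclude the value 0.\<close>

lemma integral_std_bump_pos: "0 < integral\<^sup>L lborel std_bump"
proof -
  have [measurable]: "std_bump \<in> borel_measurable borel"
    by (intro borel_measurable_continuous_onI smooth_continuous_on bumpD[OF std_bump(1)])
  have cont: "continuous_on A std_bump" for A
    by (intro smooth_continuous_on bumpD[OF std_bump(1)])
  have eq: "integral\<^sup>L lborel std_bump = integral {0..1} std_bump"
  proof -
    have "integral\<^sup>L lborel std_bump = (LINT t:{0..1}|lborel. std_bump t)"
      unfolding set_lebesgue_integral_def
      by (intro Bochner_Integration.integral_cong) (use bumpD(2)[OF std_bump(1)] in \<open>auto simp: indicator_def\<close>)
    also have "\<dots> = integral {0..1} std_bump"
      by (intro set_borel_integral_eq_integral borel_integrable_atLeastAtMost' cont)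
    finally show ?thesis .
  qed
  have "integral {0..1} std_bump \<noteq> 0"
  proof
    assume 0: "integral {0..1} std_bump = 0"
    have "(std_bump has_integral 0) (cbox 0 1)"
      using 0 integrable_integral[OF integrable_continuous_interval[OF cont[of "{0..1}"]]] by simp
    from has_integral_0_cbox_imp_0[OF cont _ this, of "1 / 2"] have "std_bump (1 / 2) = 0"
      using std_bump(2) by (simp add: box_real)
    with std_bump show False by simp
  qed
  moreover have "0 \<le> integral {0..1} std_bump"
    by (intro Henstock_Kurzweil_Integration.integral_nonneg integrable_continuous_interval cont) (use std_bump in auto)
  ultimately show ?thesis using eq by simp
qed

section \<open>Products of one-variable functions\<close>

definition prodfun :: "('n::finite \<Rightarrow> real \<Rightarrow> real) \<Rightarrow> real ^ 'n \<Rightarrow> real" where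
  "prodfun g x = (\<Prod>i\<in>UNIV. g i (x $ i))"

lemma prodfun_has_derivative:
  assumes "\<And>i. smooth (g i)"
  shows "(prodfun g has_derivative
     (\<lambda>h. \<Sum>i\<in>UNIV. deriv (g i) (x $ i) * (h $ i) * (\<Prod>j\<in>UNIV - {i}. g j (x $ j)))) (at x)"
proof -
  have "((\<lambda>x. g i (x $ i)) has_derivative (\<lambda>h. deriv (g i) (x $ i) * (h $ i))) (at x)" for i
  proof -
    have "(g i has_derivative (\<lambda>h. deriv (g i) (x $ i) * h)) (at (x $ i))"
      using smooth_has_deriv[OF assms, of i "x $ i"] by (simp add: has_field_derivative_def)
    moreover have "((\<lambda>x. x $ i) has_derivative (\<lambda>h. h $ i)) (at x)"
      by (rule bounded_linear_imp_has_derivative) (rule bounded_linear_vec_nth)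
    ultimately show ?thesis by (rule has_derivative_compose[rotated])
  qed
  then have "((\<lambda>x. \<Prod>i\<in>UNIV. g i (x $ i)) has_derivative
     (\<lambda>h. \<Sum>i\<in>UNIV. deriv (g i) (x $ i) * (h $ i) * (\<Prod>j\<in>UNIV - {i}. g j (x $ j)))) (at x)"
    by (rule has_derivative_prod)
  then show ?thesis by (simp add: prodfun_def[abs_def])
qed

lemma prodfun_fun_upd:
  "prodfun (g(i := f)) x = f (x $ i) * (\<Prod>j\<in>UNIV - {i}. g j (x $ j))"
proof -
  have "prodfun (g(i := f)) x = (g(i := f)) i (x $ i) * (\<Prod>j\<in>UNIV - {i}. (g(i := f)) j (x $ j))"
    unfolding prodfun_def by (rule prod.remove) auto
  also have "(\<Prod>j\<in>UNIV - {i}. (g(i := f)) j (x $ j)) = (\<Prod>j\<in>UNIV - {i}. g j (x $ j))"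
    by (intro prod.cong) auto
  finally show ?thesis by (simp only: fun_upd_same)
qed

lemma frechet_derivative_prodfun:
  assumes "\<And>i. smooth (g i)"
  shows "frechet_derivative (prodfun g) (at x) (axis i 1) = prodfun (g(i := deriv (g i))) x"
proof -
  have "frechet_derivative (prodfun g) (at x) (axis i 1) =
      (\<Sum>j\<in>UNIV. deriv (g j) (x $ j) * (axis i 1 $ j) * (\<Prod>k\<in>UNIV - {j}. g k (x $ k)))"
    by (subst frechet_derivative_at[OF prodfun_has_derivative[OF assms], symmetric]) simp
  also have "\<dots> = (\<Sum>j\<in>UNIV. if j = i then deriv (g i) (x $ i) * (\<Prod>k\<in>UNIV - {i}. g k (x $ k)) else 0)"
    by (intro sum.cong) (auto simp: axis_def)
  also have "\<dots> = prodfun (g(i := deriv (g i))) x"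
    by (simp add: prodfun_fun_upd)
  finally show ?thesis .
qed

lemma smooth_higher_deriv: "smooth g \<Longrightarrow> smooth ((deriv ^^ n) g)"
  by (induction n) (auto intro: smooth_deriv)

text \<open>Each partial derivative acts on a single factor, so a list of coordinates enters only
  through its multiplicities. This reduces derivatives, and later moments and integrals, to one
  variable.\<close>

lemma iterated_partial_prodfun:
  assumes "\<And>i. smooth (g i)"
  shows "iterated_partial is (prodfun g) = prodfun (\<lambda>i. (deriv ^^ count_list is i) (g i))"
proof (induction "is")
  case (Cons i "is")
  let ?h = "\<lambda>i. (deriv ^^ count_list is i) (g i)"
  have "?h(i := deriv (?h i)) = (\<lambda>j. (deriv ^^ count_list (i # is) j) (g j))"
    by (auto simp: fun_eq_iff)
  then show ?case
    using frechet_derivative_prodfun[of ?h _ i] assms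
    by (intro ext) (simp del: fun_upd_apply count_list.simps add: Cons smooth_higher_deriv)
qed (simp add: fun_eq_iff)

lemma prodfun_eq_0:
  assumes "\<And>i. bump (a $ i) (b $ i) (g i)" "x \<notin> cbox a b"
  shows "prodfun g x = 0"
proof -
  obtain i where "x $ i \<notin> {a $ i..b $ i}" using assms(2) by (auto simp: mem_box_cart)
  with bumpD(2)[OF assms(1)] have "g i (x $ i) = 0" by blast
  then show ?thesis unfolding prodfun_def by (auto intro: prod_zero)
qed

lemma test_function_prodfun:
  assumes "\<And>i. bump (a $ i) (b $ i) (g i)"
  shows "test_function (prodfun g)"
  unfolding test_function_def
proof (intro conjI allI)
  fix "is"
  have sm: "smooth (g i)" for i using assms bumpD by blast
  show "iterated_partial is (prodfun g) differentiable_on UNIV"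
    unfolding iterated_partial_prodfun[OF sm] differentiable_on_def
    using prodfun_has_derivative[of "\<lambda>i. (deriv ^^ count_list is i) (g i)"] sm
    by (auto simp: differentiable_def smooth_higher_deriv)
  have "support_on UNIV (prodfun g) \<subseteq> cbox a b"
    using prodfun_eq_0[OF assms] by (auto simp: support_on_def)
  then show "compact (closure (support_on UNIV (prodfun g)))"
    by (meson bounded_cbox bounded_subset compact_closure)
qed

lemma continuous_on_prodfun: "(\<And>i. smooth (g i)) \<Longrightarrow> continuous_on A (prodfun g)"
  by (meson continuous_at_imp_continuous_on has_derivative_continuous prodfun_has_derivative)

lemma prodfun_bounded:
  assumes "\<And>i. \<exists>a b. bump a b (g i)" obtains B where "\<And>x. \<bar>prodfun g x\<bar> \<le> B" "0 < B"
proof -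
  have "\<exists>B. (\<forall>t. \<bar>g i t\<bar> \<le> B) \<and> 0 < B" for i
    using assms[of i] bump_bounded by metis
  then obtain B where B: "\<And>i t. \<bar>g i t\<bar> \<le> B i" "\<And>i. 0 < B i" by metis
  show ?thesis
    by (rule that[of "\<Prod>i\<in>UNIV. B i"]) (auto simp: prodfun_def abs_prod B prod_pos intro!: prod_mono)
qed


section \<open>Convolutions and their scale derivatives\<close>

text \<open>The mean value inequality dominates the difference quotients by \<open>B\<close>;
  dominated convergence then applies along every sequence tending to \<open>s0\<close>.\<close>

lemma has_derivative_integral_param:
  fixes f f' :: "real \<Rightarrow> 'a \<Rightarrow> real"
  assumes s0: "s0 \<in> {a<..<b}"
    and int: "\<And>s. s \<in> {a<..<b} \<Longrightarrow> integrable M (f s)"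
    and der: "\<And>s y. s \<in> {a<..<b} \<Longrightarrow> ((\<lambda>s. f s y) has_real_derivative f' s y) (at s)"
    and bound: "\<And>s y. s \<in> {a<..<b} \<Longrightarrow> \<bar>f' s y\<bar> \<le> B y"
    and B: "integrable M B"
  shows "((\<lambda>s. integral\<^sup>L M (f s)) has_real_derivative integral\<^sup>L M (f' s0)) (at s0)"
proof -
  let ?q = "\<lambda>s y. (f s y - f s0 y) / (s - s0)"
  have "((\<lambda>s. (integral\<^sup>L M (f s) - integral\<^sup>L M (f s0)) / (s - s0)) \<longlongrightarrow> integral\<^sup>L M (f' s0)) (at s0 within {a<..<b})"
    unfolding tendsto_at_iff_sequentially
  proof (intro allI impI)
    fix X :: "nat \<Rightarrow> real" assume X: "\<forall>i. X i \<in> {a<..<b} - {s0}" "X \<longlonglongrightarrow> s0"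
    have lim: "(\<lambda>i. ?q (X i) y) \<longlonglongrightarrow> f' s0 y" for y
    proof -
      have "((\<lambda>s. ?q s y) \<longlongrightarrow> f' s0 y) (at s0)"
        using der[OF s0] by (simp add: has_field_derivative_iff)
      moreover have "filterlim X (at s0) sequentially"
        using X by (auto simp: filterlim_at)
      ultimately show ?thesis by (rule filterlim_compose)
    qed
    have int_q: "integrable M (?q (X i))" for i
      using X int s0 by (intro integrable_divide Bochner_Integration.integrable_diff) auto
    have "(\<lambda>i. integral\<^sup>L M (?q (X i))) \<longlonglongrightarrow> integral\<^sup>L M (f' s0)"
    proof (rule integral_dominated_convergence[OF _ _ B])
      show *: "?q (X i) \<in> borel_measurable M" for i using int_q by blast
      show "f' s0 \<in> borel_measurable M"
        by (rule borel_measurable_LIMSEQ_real[OF lim *])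
      show "AE y in M. (\<lambda>i. ?q (X i) y) \<longlonglongrightarrow> f' s0 y" using lim by simp
      fix i
      have "norm (?q (X i) y) \<le> B y" for y
      proof -
        have "norm (f (X i) y - f s0 y) \<le> B y * norm (X i - s0)"
          by (rule field_differentiable_bound[of "{a<..<b}" _ "\<lambda>s. f' s y"])
             (use X s0 der bound in \<open>auto intro: has_field_derivative_at_within\<close>)
        then show ?thesis using X by (simp add: divide_simps)
      qed
      then show "AE y in M. norm (?q (X i) y) \<le> B y" by simp
    qed
    moreover have "integral\<^sup>L M (?q (X i)) = (integral\<^sup>L M (f (X i)) - integral\<^sup>L M (f s0)) / (X i - s0)" for i
    proof -
      have "integral\<^sup>L M (?q (X i)) = (LINT y|M. f (X i) y - f s0 y) / (X i - s0)" by simp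
      also have "(LINT y|M. f (X i) y - f s0 y) = integral\<^sup>L M (f (X i)) - integral\<^sup>L M (f s0)"
        using X int s0 by (intro Bochner_Integration.integral_diff) auto
      finally show ?thesis .
    qed
    ultimately have "(\<lambda>i. (integral\<^sup>L M (f (X i)) - integral\<^sup>L M (f s0)) / (X i - s0)) \<longlonglongrightarrow> integral\<^sup>L M (f' s0)"
      by (simp only:)
    then show "((\<lambda>s. (integral\<^sup>L M (f s) - integral\<^sup>L M (f s0)) / (s - s0)) \<circ> X) \<longlonglongrightarrow> integral\<^sup>L M (f' s0)"
      by (simp add: o_def)
  qed
  moreover have "at s0 within {a<..<b} = at s0"
    using s0 by (intro at_within_open) auto
  ultimately show ?thesis
    by (simp only: has_field_derivative_iff)
qed

lemma integrable_locally_integrable_mult: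
  assumes v: "locally_integrable v" and [measurable]: "K \<in> borel_measurable borel"
    and bound: "\<And>y. \<bar>K y\<bar> \<le> B" and supp: "\<And>y. y \<notin> cbox a b \<Longrightarrow> K y = 0"
  shows "integrable lebesgue (\<lambda>y. v y * K y)"
proof -
  have vi: "integrable lebesgue (\<lambda>y. indicator (cbox a b) y *\<^sub>R v y)"
    using v by (auto simp: locally_integrable_def set_integrable_def)
  then have B: "integrable lebesgue (\<lambda>y. B * norm (indicator (cbox a b) y *\<^sub>R v y))"
    by (intro integrable_mult_right integrable_norm)
  have eq: "v y * K y = (indicator (cbox a b) y *\<^sub>R v y) * K y" for y
    using supp[of y] by (cases "y \<in> cbox a b") simp_all
  have K: "K \<in> borel_measurable lebesgue"
    by (rule measurable_completion) simp
  have "(\<lambda>y. (indicator (cbox a b) y *\<^sub>R v y) * K y) \<in> borel_measurable lebesgue"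
    by (intro borel_measurable_times borel_measurable_integrable[OF vi] K)
  then have meas: "(\<lambda>y. v y * K y) \<in> borel_measurable lebesgue"
    by (simp only: eq[symmetric])
  have "norm (v y * K y) \<le> norm (B * norm (indicator (cbox a b) y *\<^sub>R v y))" for y
  proof (cases "y \<in> cbox a b")
    case True
    have "\<bar>v y\<bar> * \<bar>K y\<bar> \<le> \<bar>v y\<bar> * \<bar>B\<bar>"
      using bound[of y] by (intro mult_left_mono) auto
    with True show ?thesis by (simp add: abs_mult mult.commute)
  next
    case False
    with supp[of y] show ?thesis by simp
  qed
  then show ?thesis
    by (intro Bochner_Integration.integrable_bound[OF B meas] always_eventually allI)
qed

text \<open>The kernel \<open>s\<^sup>-\<^sup>N g((y - x) / s)\<close> of a product function \<open>g\<close>.\<close>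

definition kern :: "('n::finite \<Rightarrow> real \<Rightarrow> real) \<Rightarrow> real \<Rightarrow> real ^ 'n \<Rightarrow> real ^ 'n \<Rightarrow> real" where
  "kern g s x = prodfun (\<lambda>i t. g i ((t - x $ i) / s) / s)"

definition conv :: "('n::finite \<Rightarrow> real \<Rightarrow> real) \<Rightarrow> (real ^ 'n \<Rightarrow> real) \<Rightarrow> real ^ 'n \<Rightarrow> real \<Rightarrow> real" where
  "conv g v x s = (LINT y|lebesgue. v y * kern g s x y)"

abbreviation diag :: "real \<Rightarrow> real ^ 'n" where "diag s \<equiv> (\<chi> i. s)"

lemma
  fixes g :: "'n::finite \<Rightarrow> real \<Rightarrow> real"
  assumes g: "\<And>i. bump 0 1 (g i)" and s: "0 < s"
  shows test_function_kern: "test_function (kern g s x)"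
    and continuous_on_kern: "continuous_on A (kern g s x)"
    and kern_eq_0: "y \<notin> cbox x (x + diag s) \<Longrightarrow> kern g s x y = 0"
proof -
  have *: "bump (x $ i) ((x + diag s) $ i) (\<lambda>t. g i ((t - x $ i) / s) / s)" for i
    using bump_rescale[OF g s] by simp
  show "test_function (kern g s x)"
    unfolding kern_def by (rule test_function_prodfun[OF *])
  show "continuous_on A (kern g s x)"
    unfolding kern_def by (rule continuous_on_prodfun) (use * bumpD in blast)
  show "kern g s x y = 0" if "y \<notin> cbox x (x + diag s)"
    unfolding kern_def using prodfun_eq_0[OF * that] .
qed

lemma borel_measurable_kern:
  "(\<And>i. bump 0 1 (g i)) \<Longrightarrow> 0 < s \<Longrightarrow> kern g s x \<in> borel_measurable borel"
  by (intro borel_measurable_continuous_onI continuous_on_kern)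

lemma kern_altdef: "kern g s x y = prodfun g ((y - x) /\<^sub>R s) / s ^ CARD('n)"
  for g :: "'n::finite \<Rightarrow> real \<Rightarrow> real"
  unfolding kern_def prodfun_def prod_dividef by (simp add: divide_inverse_commute)

lemma kern_bounded:
  fixes g :: "'n::finite \<Rightarrow> real \<Rightarrow> real"
  assumes "\<And>i. bump 0 1 (g i)"
  obtains B where "0 < B" "\<And>s x y. 0 < s \<Longrightarrow> \<bar>kern g s x y\<bar> \<le> B / s ^ CARD('n)"
proof -
  obtain B where B: "\<And>x. \<bar>prodfun g x\<bar> \<le> B" "0 < B"
    using assms by (metis prodfun_bounded)
  show ?thesis
    by (rule that[OF B(2)]) (auto simp: kern_altdef abs_divide intro!: divide_right_mono B)
qed

lemma integrable_kern:
  assumes v: "locally_integrable v" and g: "\<And>i. bump 0 1 (g i)" and s: "0 < s"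
  shows "integrable lebesgue (\<lambda>y. v y * kern g s x y)"
proof -
  obtain B where B: "0 < B" "\<And>s x y. 0 < s \<Longrightarrow> \<bar>kern g s x y\<bar> \<le> B / s ^ CARD('a)"
    using kern_bounded[of g] g by metis
  show ?thesis
    by (rule integrable_locally_integrable_mult[OF v borel_measurable_kern[OF g s] B(2)[OF s] kern_eq_0[OF g s]])
qed

text \<open>\<open>d/ds (s\<^sup>-\<^sup>1 f(z/s)) = - s\<^sup>-\<^sup>2 (t f(t))'(z/s)\<close>: this divergence structure lets the scale derivative
  be traded for weak derivatives.\<close>

lemma kern_has_derivative_scale:
  fixes g :: "'n::finite \<Rightarrow> real \<Rightarrow> real"
  assumes g: "\<And>i. smooth (g i)" and s: "0 < s"
  shows "((\<lambda>s. kern g s x y) has_real_derivative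
     - (1 / s) * (\<Sum>i\<in>UNIV. kern (g(i := deriv (\<lambda>t. t * g i t))) s x y)) (at s)"
proof -
  let ?z = "\<lambda>i. y $ i - x $ i"
  have d: "((\<lambda>s. g i (?z i / s) / s) has_real_derivative
      - (1 / s) * (deriv (\<lambda>t. t * g i t) (?z i / s) / s)) (at s)" for i
  proof -
    have dg: "(g i has_real_derivative deriv (g i) (?z i / s)) (at (?z i / s))"
      by (rule smooth_has_deriv[OF g])
    have "((\<lambda>t. t * g i t) has_real_derivative g i (?z i / s) + (?z i / s) * deriv (g i) (?z i / s)) (at (?z i / s))"
      by (auto intro!: derivative_eq_intros dg)
    then have e: "deriv (\<lambda>t. t * g i t) (?z i / s) = g i (?z i / s) + (?z i / s) * deriv (g i) (?z i / s)"
      by (rule DERIV_imp_deriv)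
    have "((\<lambda>s. ?z i / s) has_real_derivative - ?z i / s\<^sup>2) (at s)"
      using s by (auto intro!: derivative_eq_intros simp: power2_eq_square)
    from DERIV_chain2[OF dg this]
    have "((\<lambda>s. g i (?z i / s) / s) has_real_derivative
      (deriv (g i) (?z i / s) * (- ?z i / s\<^sup>2) * s - g i (?z i / s) * 1) / (s * s)) (at s)"
      by (rule DERIV_divide) (use s in auto)
    then show ?thesis
      unfolding e using s by (auto simp: field_simps power2_eq_square elim!: back_subst[of "\<lambda>d. (_ has_real_derivative d) _"])
  qed
  have "((\<lambda>s. \<Prod>i\<in>UNIV. g i (?z i / s) / s) has_real_derivative
      (\<Sum>i\<in>UNIV. - (1 / s) * (deriv (\<lambda>t. t * g i t) (?z i / s) / s) * (\<Prod>j\<in>UNIV - {i}. g j (?z j / s) / s))) (at s)"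
    by (rule has_field_derivative_prod) (rule d)
  also have "(\<lambda>s. \<Prod>i\<in>UNIV. g i (?z i / s) / s) = (\<lambda>s. kern g s x y)"
    by (simp add: kern_def prodfun_def)
  also have "(\<Sum>i\<in>UNIV. - (1 / s) * (deriv (\<lambda>t. t * g i t) (?z i / s) / s) * (\<Prod>j\<in>UNIV - {i}. g j (?z j / s) / s))
     = - (1 / s) * (\<Sum>i\<in>UNIV. kern (g(i := deriv (\<lambda>t. t * g i t))) s x y)"
    unfolding sum_distrib_left
  proof (intro sum.cong refl)
    fix i
    let ?d = "deriv (\<lambda>t. t * g i t)"
    have "kern (g(i := ?d)) s x y =
       prodfun ((\<lambda>i t. g i ((t - x $ i) / s) / s)(i := \<lambda>t. ?d ((t - x $ i) / s) / s)) y"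
      unfolding kern_def by (rule arg_cong[of _ _ "\<lambda>f. prodfun f y"]) auto
    also have "\<dots> = (?d (?z i / s) / s) * (\<Prod>j\<in>UNIV - {i}. g j (?z j / s) / s)"
      by (rule prodfun_fun_upd)
    finally show "- (1 / s) * (?d (?z i / s) / s) * (\<Prod>j\<in>UNIV - {i}. g j (?z j / s) / s) =
        - (1 / s) * kern (g(i := ?d)) s x y" by simp
  qed
  finally show ?thesis .
qed

text \<open>The function \<open>v\<close> need not be differentiable, so the derivative falls on the
  kernel. For scales between s/2 and 2s all kernels live in one cube and their scale derivatives
  have a common bound, which gives an integrable majorant.\<close>

lemma conv_has_derivative_smooth:
  fixes g :: "'n::finite \<Rightarrow> real \<Rightarrow> real"
  assumes v: "locally_integrable v" and g: "\<And>i. bump 0 1 (g i)" and s: "0 < s"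
  shows "(conv g v x has_real_derivative
     - (1 / s) * (\<Sum>i\<in>UNIV. conv (g(i := deriv (\<lambda>t. t * g i t))) v x s)) (at s)"
proof -
  let ?g = "\<lambda>i. g(i := deriv (\<lambda>t. t * g i t))"
  have bg: "bump 0 1 (?g i j)" for i j
    using g bump_deriv[OF bump_mult_smooth[OF smooth_ident g[of i]]] by simp
  have "\<exists>B. 0 < B \<and> (\<forall>s x y. 0 < s \<longrightarrow> \<bar>kern (?g i) s x y\<bar> \<le> B / s ^ CARD('n))" for i
    using kern_bounded[of "?g i", OF bg] by metis
  then obtain B where B: "\<And>i. 0 < B i" "\<And>i s x y. 0 < s \<Longrightarrow> \<bar>kern (?g i) s x y\<bar> \<le> B i / s ^ CARD('n)"
    by metis
  \<comment> \<open>For t > s/2, the factor 2/s bounds 1/t and the power of s/2 bounds the t^-N of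
    the kernels.\<close>
  let ?C = "(2 / s) * (\<Sum>i\<in>UNIV. B i / (s / 2) ^ CARD('n))"
  let ?Q = "cbox x (x + diag (2 * s))"
  have C0: "0 \<le> ?C" using s B(1) by (intro mult_nonneg_nonneg sum_nonneg) (auto intro: less_imp_le)
  have "((\<lambda>s. LINT y|lebesgue. v y * kern g s x y) has_real_derivative
      (LINT y|lebesgue. v y * (- (1 / s) * (\<Sum>i\<in>UNIV. kern (?g i) s x y)))) (at s)"
  proof (rule has_derivative_integral_param[where a = "s / 2" and b = "2 * s" and
        f' = "\<lambda>s y. v y * (- (1 / s) * (\<Sum>i\<in>UNIV. kern (?g i) s x y))" and
        B = "\<lambda>y. norm (indicator ?Q y *\<^sub>R v y) * ?C"])
    show "s \<in> {s / 2<..<2 * s}" using s by auto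
    fix t assume "t \<in> {s / 2<..<2 * s}"
    then have t: "s / 2 < t" "t < 2 * s" "0 < t" using s by auto
    show "integrable lebesgue (\<lambda>y. v y * kern g t x y)" by (rule integrable_kern[OF v g t(3)])
    fix y
    show "((\<lambda>t. v y * kern g t x y) has_real_derivative v y * (- (1 / t) * (\<Sum>i\<in>UNIV. kern (?g i) t x y))) (at t)"
      by (intro DERIV_cmult kern_has_derivative_scale t) (use g bumpD in blast)
    show "\<bar>v y * (- (1 / t) * (\<Sum>i\<in>UNIV. kern (?g i) t x y))\<bar> \<le> norm (indicator ?Q y *\<^sub>R v y) * ?C"
    proof (cases "y \<in> ?Q")
      case True
      have "\<bar>\<Sum>i\<in>UNIV. kern (?g i) t x y\<bar> \<le> (\<Sum>i\<in>UNIV. B i / (s / 2) ^ CARD('n))"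
      proof (rule order.trans[OF sum_abs sum_mono])
        fix i
        have "\<bar>kern (?g i) t x y\<bar> \<le> B i / t ^ CARD('n)" by (rule B(2)[OF t(3)])
        also have "\<dots> \<le> B i / (s / 2) ^ CARD('n)"
          using t s B(1)[of i] by (intro divide_left_mono power_mono mult_pos_pos zero_less_power) (auto intro: less_imp_le)
        finally show "\<bar>kern (?g i) t x y\<bar> \<le> B i / (s / 2) ^ CARD('n)" .
      qed
      moreover have "1 / t \<le> 2 / s" using t s by (simp add: field_simps)
      ultimately have "(1 / t) * \<bar>\<Sum>i\<in>UNIV. kern (?g i) t x y\<bar> \<le> ?C"
        using t s by (intro mult_mono) auto
      then have "\<bar>v y\<bar> * ((1 / t) * \<bar>\<Sum>i\<in>UNIV. kern (?g i) t x y\<bar>) \<le> \<bar>v y\<bar> * ?C"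
        by (rule mult_left_mono) simp
      then show ?thesis
        using True t by (simp only: abs_mult abs_minus_cancel) simp
    next
      case False
      have "y \<notin> cbox x (x + diag t)"
        using False t by (auto simp: mem_box_cart) (meson add_left_mono less_imp_le order.trans)
      then have "kern (?g i) t x y = 0" for i
        using kern_eq_0[where g = "?g i", OF bg t(3)] by blast
      moreover have "0 \<le> norm (indicator ?Q y *\<^sub>R v y) * ?C"
        by (rule mult_nonneg_nonneg[OF norm_ge_zero C0])
      ultimately show ?thesis
        by (simp only: sum.neutral_const mult_zero_right abs_zero)
    qed
  next
    have "integrable lebesgue (\<lambda>y. indicator ?Q y *\<^sub>R v y)"
      using v by (auto simp: locally_integrable_def set_integrable_def)
    then show "integrable lebesgue (\<lambda>y. norm (indicator ?Q y *\<^sub>R v y) * ?C)"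
      by (intro integrable_mult_left integrable_norm)
  qed
  moreover have "(LINT y|lebesgue. v y * (- (1 / s) * (\<Sum>i\<in>UNIV. kern (?g i) s x y))) =
      - (1 / s) * (\<Sum>i\<in>UNIV. conv (?g i) v x s)"
  proof -
    have "(LINT y|lebesgue. v y * (- (1 / s) * (\<Sum>i\<in>UNIV. kern (?g i) s x y))) =
        (LINT y|lebesgue. - (1 / s) * (\<Sum>i\<in>UNIV. v y * kern (?g i) s x y))"
      by (simp add: sum_distrib_left mult_ac)
    also have "\<dots> = - (1 / s) * (\<Sum>i\<in>UNIV. conv (?g i) v x s)"
      unfolding conv_def
      by (subst integral_mult_right_zero, subst Bochner_Integration.integral_sum)
         (use integrable_kern[OF v _ s] bg in auto)
    finally show ?thesis .
  qed
  ultimately have "((\<lambda>s. LINT y|lebesgue. v y * kern g s x y) has_real_derivative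
      - (1 / s) * (\<Sum>i\<in>UNIV. conv (?g i) v x s)) (at s)"
    by (simp only:)
  also have "(\<lambda>s. LINT y|lebesgue. v y * kern g s x y) = conv g v x"
    by (simp add: conv_def fun_eq_iff)
  finally show ?thesis .
qed

section \<open>Moving derivatives between kernel and function\<close>

lemma higher_deriv_rescale:
  assumes "smooth g"
  shows "(deriv ^^ n) (\<lambda>t. g ((t - a) / s) / s) = (\<lambda>t. (deriv ^^ n) g ((t - a) / s) / s / s ^ n)"
proof (induction n)
  case (Suc n)
  have "((\<lambda>t. (deriv ^^ n) g ((t - a) / s) / s / s ^ n) has_real_derivative
      deriv ((deriv ^^ n) g) ((t - a) / s) * (1 / s) / s / s ^ n) (at t)" for t
  proof (intro DERIV_cdivide)
    have "((\<lambda>t. (t - a) / s) has_real_derivative 1 / s) (at t)"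
      by (rule DERIV_cdivide) (auto intro!: derivative_eq_intros)
    from DERIV_chain2[OF smooth_has_deriv[OF smooth_higher_deriv[OF assms]] this]
    show "((\<lambda>t. (deriv ^^ n) g ((t - a) / s)) has_real_derivative
        deriv ((deriv ^^ n) g) ((t - a) / s) * (1 / s)) (at t)" .
  qed
  then have "deriv (\<lambda>t. (deriv ^^ n) g ((t - a) / s) / s / s ^ n) t =
      deriv ((deriv ^^ n) g) ((t - a) / s) * (1 / s) / s / s ^ n" for t
    by (rule DERIV_imp_deriv)
  then have "deriv (\<lambda>t. (deriv ^^ n) g ((t - a) / s) / s / s ^ n) =
      (\<lambda>t. deriv ((deriv ^^ n) g) ((t - a) / s) * (1 / s) / s / s ^ n)"
    by (rule ext)
  then show ?case
    by (simp only: Suc funpow.simps o_apply) (simp add: mult_ac)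
qed simp

text \<open>The profile of the differentiated kernel: by \<open>iterated_partial_kern\<close>,
  differentiating along \<open>is\<close> replaces \<open>g\<close> by \<open>partials is g\<close>
  and divides by s^(length is).\<close>

definition partials :: "'n list \<Rightarrow> ('n \<Rightarrow> real \<Rightarrow> real) \<Rightarrow> 'n \<Rightarrow> real \<Rightarrow> real" where
  "partials is g i = (deriv ^^ count_list is i) (g i)"

lemma iterated_partial_kern:
  fixes g :: "'n::finite \<Rightarrow> real \<Rightarrow> real"
  assumes g: "\<And>i. bump 0 1 (g i)" and s: "0 < s"
  shows "iterated_partial is (kern g s x) y = kern (partials is g) s x y / s ^ length is"
proof -
  have "smooth (\<lambda>t. g i ((t - x $ i) / s) / s)" for i
    using bump_rescale[OF g s] bumpD by blast
  then have "iterated_partial is (kern g s x) y =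
      prodfun (\<lambda>i. (deriv ^^ count_list is i) (\<lambda>t. g i ((t - x $ i) / s) / s)) y"
    unfolding kern_def by (subst iterated_partial_prodfun) auto
  also have "\<dots> = prodfun (\<lambda>i t. partials is g i ((t - x $ i) / s) / s / s ^ count_list is i) y"
    unfolding partials_def by (subst higher_deriv_rescale) (use g bumpD in auto)
  also have "\<dots> = kern (partials is g) s x y / (\<Prod>i\<in>UNIV. s ^ count_list is i)"
    by (simp only: kern_def prodfun_def prod_dividef)
  also have "(\<Prod>i\<in>UNIV. s ^ count_list is i) = s ^ length is"
    by (simp add: power_sum[symmetric] sum_count_set)
  finally show ?thesis .
qed

lemma bump_partials:
  assumes "\<And>i. bump 0 1 (g i)" shows "bump 0 1 (partials is g i)"
  unfolding partials_def using bump_higher_deriv[OF assms[of i]] .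

text \<open>The kernel itself serves as test function. The weak derivative contributes the power of
  -1, the chain rule the power of s.\<close>

lemma conv_weak_partial:
  fixes g :: "'n::finite \<Rightarrow> real \<Rightarrow> real"
  assumes "has_weak_partial u is v" and g: "\<And>i. bump 0 1 (g i)" and s: "0 < s"
  shows "conv (partials is g) u x s = (- s) ^ length is * conv g v x s"
proof -
  have "(LINT y|lebesgue. u y * iterated_partial is (kern g s x) y) =
      (- 1) ^ length is * conv g v x s"
    using assms(1) test_function_kern[where g = g and x = x, OF g s]
    unfolding has_weak_partial_def conv_def by simp
  moreover have "(LINT y|lebesgue. u y * iterated_partial is (kern g s x) y) = conv (partials is g) u x s / s ^ length is"
    by (simp add: iterated_partial_kern[where g = g, OF g s] conv_def)
  ultimately have "conv (partials is g) u x s / s ^ length is = (- 1) ^ length is * conv g v x s"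
    by (simp only:)
  then have "conv (partials is g) u x s = ((- 1) ^ length is * conv g v x s) * s ^ length is"
    using s by (simp add: nonzero_divide_eq_eq)
  also have "\<dots> = (- s) ^ length is * conv g v x s"
    by (simp only: power_minus[of s] mult_ac)
  finally show ?thesis .
qed

text \<open>The hypotheses relate \<open>v\<close> and \<open>w\<close> to \<open>u\<close>, not to
  each other. Both convolutions are therefore traced back to \<open>u\<close> with the same kernel
  profile \<open>partials (i # is) g\<close>, and the nonzero power of -s is cancelled.\<close>

lemma conv_deriv_coordinate:
  fixes g :: "'n::finite \<Rightarrow> real \<Rightarrow> real"
  assumes v: "has_weak_partial u is v" and w: "has_weak_partial u (i # is) w"
    and g: "\<And>i. bump 0 1 (g i)" and s: "0 < s"
  shows "conv (g(i := deriv (g i))) v x s = - s * conv g w x s"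
proof -
  have "bump 0 1 ((g(i := deriv (g i))) j)" for j
    using g bump_deriv by simp
  from conv_weak_partial[where g = "g(i := deriv (g i))", OF v this s]
  have "conv (partials is (g(i := deriv (g i)))) u x s = (- s) ^ length is * conv (g(i := deriv (g i))) v x s" .
  moreover have "partials is (g(i := deriv (g i))) = partials (i # is) g"
    by (auto simp: fun_eq_iff partials_def funpow_swap1)
  ultimately have "(- s) ^ length is * conv (g(i := deriv (g i))) v x s = (- s) ^ length is * (- s * conv g w x s)"
    using conv_weak_partial[where g = g and x = x, OF w g s] by (simp add: mult_ac)
  moreover have "(- s) ^ length is \<noteq> 0" using s by simp
  ultimately show ?thesis using mult_left_cancel by blast
qed

text \<open>The factor -1/s of the scale derivative cancels against the -s gained by moving a
  coordinate derivative onto \<open>v\<close>. No negative power of s survives, and the new profiles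
  are bumps on the same interval, so the step can be iterated.\<close>

lemma conv_has_derivative:
  fixes g :: "'n::finite \<Rightarrow> real \<Rightarrow> real"
  assumes v: "has_weak_partial u is v" and w: "\<And>i. has_weak_partial u (i # is) (w i)"
    and g: "\<And>i. bump 0 1 (g i)" and s: "0 < s"
  shows "(conv g v x has_real_derivative
     (\<Sum>i\<in>UNIV. conv (g(i := \<lambda>t. t * g i t)) (w i) x s)) (at s)"
proof -
  have "locally_integrable v" using v by (simp add: has_weak_partial_def)
  from conv_has_derivative_smooth[OF this g s]
  have "(conv g v x has_real_derivative
     - (1 / s) * (\<Sum>i\<in>UNIV. conv (g(i := deriv (\<lambda>t. t * g i t))) v x s)) (at s)" .
  moreover have "conv (g(i := deriv (\<lambda>t. t * g i t))) v x s = - s * conv (g(i := \<lambda>t. t * g i t)) (w i) x s" for i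
  proof -
    have "bump 0 1 ((g(i := \<lambda>t. t * g i t)) j)" for j
      using g bump_mult_smooth[OF smooth_ident g[of i]] by simp
    from conv_deriv_coordinate[where g = "g(i := \<lambda>t. t * g i t)", OF v w[of i] this s]
    show ?thesis by simp
  qed
  ultimately show ?thesis using s by (simp add: sum_distrib_left sum_negf)
qed

section \<open>Higher scale derivatives and finite differences\<close>

definition monomial_times :: "'n list \<Rightarrow> ('n \<Rightarrow> real \<Rightarrow> real) \<Rightarrow> 'n \<Rightarrow> real \<Rightarrow> real" where
  "monomial_times is g i t = t ^ count_list is i * g i t"

lemma monomial_times_Nil [simp]: "monomial_times [] g = g"
  by (simp add: monomial_times_def fun_eq_iff)

lemma monomial_times_Cons:
  "monomial_times (i # is) g = (monomial_times is g)(i := \<lambda>t. t * monomial_times is g i t)"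
  by (auto simp: monomial_times_def fun_eq_iff)

lemma bump_monomial_times:
  assumes "\<And>i. bump 0 1 (g i)" shows "bump 0 1 (monomial_times is g i)"
  unfolding monomial_times_def[abs_def]
  using bump_mult_smooth[OF smooth_power assms[of i]] .

lemma sum_lists_Suc:
  fixes f :: "'n::finite list \<Rightarrow> 'b::comm_monoid_add"
  shows "(\<Sum>is | length is = Suc j. f is) = (\<Sum>is | length is = j. \<Sum>i\<in>UNIV. f (i # is))"
proof -
  have "(\<Sum>is | length is = j. \<Sum>i\<in>UNIV. f (i # is)) = (\<Sum>(is, i)\<in>{is. length is = j} \<times> UNIV. f (i # is))"
    by (rule sum.cartesian_product)
  also have "\<dots> = (\<Sum>is | length is = Suc j. f is)"
    by (rule sum.reindex_bij_witness[of _ "\<lambda>is. (tl is, hd is)" "\<lambda>(is, i). i # is"])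
       (auto simp: length_Suc_conv)
  finally show ?thesis ..
qed

text \<open>The j-th derivative in s of \<open>conv g (D L) x\<close>. Each derivative produces a
  sum over coordinates i, multiplying the profile by the i-th coordinate and prepending i to the
  list of weak derivatives; hence the sum over all lists of length \<open>j\<close>.\<close>

definition scale_deriv ::
  "('n::finite \<Rightarrow> real \<Rightarrow> real) \<Rightarrow> ('n list \<Rightarrow> real ^ 'n \<Rightarrow> real) \<Rightarrow> 'n list \<Rightarrow> real ^ 'n \<Rightarrow> nat \<Rightarrow> real \<Rightarrow> real" where
  "scale_deriv g D L x j s = (\<Sum>is | length is = j. conv (monomial_times is g) (D (is @ L)) x s)"

lemma scale_deriv_0: "scale_deriv g D L x 0 s = conv g (D L) x s"
  by (simp add: scale_deriv_def)

lemma scale_deriv_has_derivative: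
  fixes g :: "'n::finite \<Rightarrow> real \<Rightarrow> real"
  assumes D: "\<And>is. length is \<le> k \<Longrightarrow> has_weak_partial u is (D is)"
    and g: "\<And>i. bump 0 1 (g i)" and s: "0 < s" and j: "Suc j + length L \<le> k"
  shows "(scale_deriv g D L x j has_real_derivative scale_deriv g D L x (Suc j) s) (at s)"
proof -
  have "(conv (monomial_times is g) (D (is @ L)) x has_real_derivative
     (\<Sum>i\<in>UNIV. conv (monomial_times (i # is) g) (D ((i # is) @ L)) x s)) (at s)" if "length is = j" for "is"
    unfolding monomial_times_Cons append_Cons
    by (rule conv_has_derivative[OF D D bump_monomial_times[OF g] s]) (use j that in auto)
  then have "((\<lambda>s. \<Sum>is | length is = j. conv (monomial_times is g) (D (is @ L)) x s) has_real_derivative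
     (\<Sum>is | length is = j. \<Sum>i\<in>UNIV. conv (monomial_times (i # is) g) (D ((i # is) @ L)) x s)) (at s)"
    by (intro DERIV_sum) auto
  then show ?thesis unfolding scale_deriv_def[abs_def] sum_lists_Suc .
qed

text \<open>Induction through the first difference g(t) = h(t + \<delta>) - h(t): its samples are
  bounded by 2S, and the mean value theorem bounds its m-th derivative by \<delta> B. The samples
  start at j = 1, since the value at \<open>a\<close> is the unknown one.\<close>

lemma finite_difference_bound:
  fixes h :: "nat \<Rightarrow> real \<Rightarrow> real"
  assumes "\<And>j t. j < m \<Longrightarrow> a \<le> t \<Longrightarrow> t \<le> b \<Longrightarrow> (h j has_real_derivative h (Suc j) t) (at t)"
    and "\<And>t. a \<le> t \<Longrightarrow> t \<le> b \<Longrightarrow> \<bar>h m t\<bar> \<le> B"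
    and "\<And>j. 1 \<le> j \<Longrightarrow> j \<le> m \<Longrightarrow> \<bar>h 0 (a + real j * \<delta>)\<bar> \<le> S"
    and "0 < \<delta>" "a + real m * \<delta> \<le> b"
  shows "\<bar>h 0 a\<bar> \<le> (2 ^ m - 1) * S + \<delta> ^ m * B"
  using assms
proof (induction m arbitrary: h b B S)
  case 0
  then show ?case by auto
next
  case (Suc m)
  define g where "g = (\<lambda>j t. h j (t + \<delta>) - h j t)"
  have ab: "a + real m * \<delta> + \<delta> \<le> b" using Suc.prems(5) by (simp add: algebra_simps)
  have "\<bar>g 0 a\<bar> \<le> (2 ^ m - 1) * (2 * S) + \<delta> ^ m * (\<delta> * B)"
  proof (rule Suc.IH[where b = "b - \<delta>"])
    show "a + real m * \<delta> \<le> b - \<delta>" using ab by simp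
    show "0 < \<delta>" by fact
  next
    fix j t assume "j < m" "a \<le> t" "t \<le> b - \<delta>"
    then show "(g j has_real_derivative g (Suc j) t) (at t)"
      unfolding g_def using Suc.prems(4)
      by (intro DERIV_diff Suc.prems(1) DERIV_shift[THEN iffD1]) auto
  next
    fix t assume t: "a \<le> t" "t \<le> b - \<delta>"
    obtain z where "t < z" "z < t + \<delta>" "h m (t + \<delta>) - h m t = (t + \<delta> - t) * h (Suc m) z"
      using MVT2[of t "t + \<delta>" "h m" "h (Suc m)"] Suc.prems(1,4) t by auto
    then show "\<bar>g m t\<bar> \<le> \<delta> * B"
      using Suc.prems(2)[of z] Suc.prems(4) t by (auto simp: g_def abs_mult)
  next
    fix j assume j: "1 \<le> j" "j \<le> m"
    have "g 0 (a + real j * \<delta>) = h 0 (a + real (Suc j) * \<delta>) - h 0 (a + real j * \<delta>)"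
      by (simp add: g_def algebra_simps)
    then show "\<bar>g 0 (a + real j * \<delta>)\<bar> \<le> 2 * S"
      using Suc.prems(3)[of j] Suc.prems(3)[of "Suc j"] j by linarith
  qed
  \<comment> \<open>Returning from g to h costs one more S, and 2 (2^m - 1) + 1 = 2^(m+1) -
    1.\<close>
  moreover have "\<bar>h 0 (a + \<delta>)\<bar> \<le> S" using Suc.prems(3)[of 1] by simp
  ultimately have "\<bar>h 0 a\<bar> \<le> (2 ^ m - 1) * (2 * S) + \<delta> ^ m * (\<delta> * B) + S"
    unfolding g_def by linarith
  then show ?case by (simp add: algebra_simps)
qed


section \<open>Lebesgue points and uniqueness of weak derivatives\<close>

lemma axis_Basis_bij: "bij_betw (\<lambda>i. axis i (1::real)) UNIV (Basis :: (real ^ 'n::finite) set)"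
  by (auto simp: bij_betw_def inj_on_def axis_eq_axis Basis_vec_def)

lemma One_eq_diag: "s *\<^sub>R (One :: real ^ 'n::finite) = diag s"
proof -
  have "(One :: real ^ 'n) $ i = 1" for i by (simp add: cart_eq_inner_axis)
  then show ?thesis by (simp add: vec_eq_iff)
qed

lemma content_cbox_diag:
  fixes x :: "real ^ 'n::finite"
  assumes "0 \<le> s" shows "measure lborel (cbox x (x + diag s)) = s ^ CARD('n)"
proof -
  have "x \<in> cbox x (x + diag s)" using assms by (simp add: mem_box_cart)
  then show ?thesis by (subst content_cbox_cart) auto
qed

lemma bump_integrable: assumes "bump a b g" shows "integrable lborel g"
proof -
  have "set_integrable lborel {a..b} g"
    by (intro borel_integrable_atLeastAtMost' smooth_continuous_on bumpD[OF assms])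
  moreover have "(\<lambda>t. indicator {a..b} t *\<^sub>R g t) = g"
  proof
    show "indicator {a..b} t *\<^sub>R g t = g t" for t
      using bumpD(2)[OF assms, of t] by (cases "t \<in> {a..b}") auto
  qed
  ultimately show ?thesis by (simp add: set_integrable_def)
qed

text \<open>Fubini for tensor products. As \<open>lborel\<close> is the image of a product measure
  indexed by \<open>Basis\<close>, coordinates are reindexed by their basis vectors, and
  \<open>idx\<close> recovers the coordinate from the vector.\<close>

lemma integral_prodfun:
  fixes g :: "'n::finite \<Rightarrow> real \<Rightarrow> real"
  assumes int: "\<And>i. integrable lborel (g i)"
  shows "integral\<^sup>L lebesgue (prodfun g) = (\<Prod>i\<in>UNIV. integral\<^sup>L lborel (g i))"
proof -
  interpret product_sigma_finite "\<lambda>_ :: real ^ 'n. lborel :: real measure" ..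
  have [measurable]: "g i \<in> borel_measurable borel" for i
    using borel_measurable_integrable[OF int[of i]] by simp
  define idx where "idx = inv (\<lambda>i::'n. axis i (1::real))"
  have idx: "idx (axis i 1) = i" for i
    unfolding idx_def by (rule inv_f_f) (auto simp: inj_on_def axis_eq_axis)
  have reindex: "(\<Prod>i\<in>UNIV. F (axis i 1)) = (\<Prod>b\<in>Basis. F b)" for F :: "real ^ 'n \<Rightarrow> real"
    using prod.reindex_bij_betw[OF axis_Basis_bij, of F] by simp
  have eq: "prodfun g x = (\<Prod>b\<in>Basis. g (idx b) (x \<bullet> b))" for x
    using reindex[of "\<lambda>b. g (idx b) (x \<bullet> b)"] by (simp add: prodfun_def idx cart_eq_inner_axis)
  have "integral\<^sup>L lebesgue (prodfun g) = integral\<^sup>L lborel (\<lambda>x. \<Prod>b\<in>Basis. g (idx b) (x \<bullet> b))"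
    unfolding eq[abs_def] by (rule integral_completion) measurable
  also have "\<dots> = integral\<^sup>L (Pi\<^sub>M Basis (\<lambda>_. lborel)) (\<lambda>f. \<Prod>b\<in>Basis. g (idx b) ((\<Sum>c\<in>(Basis :: (real ^ 'n) set). f c *\<^sub>R c) \<bullet> b))"
    by (subst lborel_eq) (rule integral_distr; measurable)
  also have "\<dots> = integral\<^sup>L (Pi\<^sub>M (Basis :: (real ^ 'n) set) (\<lambda>_. lborel)) (\<lambda>f. \<Prod>b\<in>Basis. g (idx b) (f b))"
    by (intro Bochner_Integration.integral_cong prod.cong) (auto simp: inner_sum_left_Basis)
  also have "\<dots> = (\<Prod>b\<in>(Basis :: (real ^ 'n) set). integral\<^sup>L lborel (g (idx b)))"
    by (rule product_integral_prod) (auto intro: int)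
  also have "\<dots> = (\<Prod>i\<in>UNIV. integral\<^sup>L lborel (g i))"
    using reindex[of "\<lambda>b. integral\<^sup>L lborel (g (idx b))"] by (simp add: idx)
  finally show ?thesis .
qed

lemma integral_kern:
  fixes g :: "'n::finite \<Rightarrow> real \<Rightarrow> real"
  assumes g: "\<And>i. bump 0 1 (g i)" and s: "0 < s"
  shows "integral\<^sup>L lebesgue (kern g s x) = (\<Prod>i\<in>UNIV. integral\<^sup>L lborel (g i))"
proof -
  have "integral\<^sup>L lborel (\<lambda>t. g i ((t - x $ i) / s) / s) = integral\<^sup>L lborel (g i)" for i
    using lborel_integral_real_affine[of s "\<lambda>t. g i ((t - x $ i) / s) / s" "x $ i"] s by simp
  moreover have "integrable lborel (\<lambda>t. g i ((t - x $ i) / s) / s)" for i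
    using bump_integrable[OF bump_rescale[OF g s]] .
  ultimately show ?thesis
    unfolding kern_def by (subst integral_prodfun) auto
qed

lemma locally_integrable_integrable_on:
  assumes "locally_integrable v" shows "v integrable_on cbox a b"
  using assms unfolding locally_integrable_def
  by (auto intro: set_lebesgue_integral_eq_integral(1))

lemma locally_integrable_const: "locally_integrable (\<lambda>x. c)"
  unfolding locally_integrable_def
proof (intro allI impI)
  fix K :: "(real ^ 'a) set" assume "compact K"
  then have "emeasure lebesgue K < \<infinity>" "K \<in> sets lebesgue"
    using lmeasurable_compact fmeasurable_def by auto
  then show "set_integrable lebesgue K (\<lambda>x. c)"
    unfolding set_integrable_def by (intro integrable_scaleR_left) (simp add: integrable_indicator_iff)
qed

lemma locally_integrable_abs_diff:
  "locally_integrable v \<Longrightarrow> locally_integrable (\<lambda>y. \<bar>v y - c\<bar>)"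
  using locally_integrable_const[of c] unfolding locally_integrable_def
  by (auto intro!: set_integrable_abs set_integral_diff(1))

lemma borel_measurable_locally_integrable:
  assumes "locally_integrable v" shows "v \<in> borel_measurable lebesgue"
proof (rule borel_measurable_LIMSEQ_real)
  fix i :: nat
  show "(\<lambda>y. indicator (cball 0 (real i)) y *\<^sub>R v y) \<in> borel_measurable lebesgue"
    using assms compact_cball[of "0 :: real ^ 'a" "real i"]
    unfolding locally_integrable_def set_integrable_def by (blast intro: borel_measurable_integrable)
next
  fix y :: "real ^ 'a"
  obtain n :: nat where n: "norm y \<le> real n" using real_arch_simple by blast
  have "\<forall>\<^sub>F i in sequentially. indicator (cball 0 (real i)) y *\<^sub>R v y = v y"
    using eventually_ge_at_top[of n] by eventually_elim (use n in auto)
  then show "(\<lambda>i. indicator (cball 0 (real i)) y *\<^sub>R v y) \<longlonglongrightarrow> v y"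
    by (rule tendsto_eventually)
qed

text \<open>One-sided Lebesgue points, obtained from the differentiation theorem applied to \<open>\<bar>v - q\<bar>\<close> for
  all rational \<open>q\<close>; this is why all bumps are supported in the positive orthant.\<close>

lemma lebesgue_points:
  fixes v :: "real ^ 'n::finite \<Rightarrow> real"
  assumes v: "locally_integrable v"
  obtains N where "negligible N"
    "\<And>x e. x \<notin> N \<Longrightarrow> 0 < e \<Longrightarrow> \<exists>d>0. \<forall>s. 0 < s \<and> s < d \<longrightarrow>
       integral (cbox x (x + diag s)) (\<lambda>y. \<bar>v y - v x\<bar>) < e * s ^ CARD('n)"
proof -
  have "\<exists>N. negligible N \<and> (\<forall>x e. x \<notin> N \<and> 0 < e \<longrightarrow> (\<exists>d>0. \<forall>h. 0 < h \<and> h < d \<longrightarrow>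
        norm (integral (cbox x (x + h *\<^sub>R One)) (\<lambda>y. \<bar>v y - q\<bar>) /\<^sub>R h ^ DIM(real ^ 'n) - \<bar>v x - q\<bar>) < e))" for q
    by (rule integrable_ccontinuous_explicit[OF locally_integrable_integrable_on[OF locally_integrable_abs_diff[OF v, of q]]])
       blast
  then obtain N where N: "\<And>q. negligible (N q)"
    "\<And>q x e. x \<notin> N q \<Longrightarrow> 0 < e \<Longrightarrow> \<exists>d>0. \<forall>h. 0 < h \<and> h < d \<longrightarrow>
        norm (integral (cbox x (x + h *\<^sub>R One)) (\<lambda>y. \<bar>v y - q\<bar>) /\<^sub>R h ^ DIM(real ^ 'n) - \<bar>v x - q\<bar>) < e"
    by metis
  show ?thesis
  proof (rule that[of "\<Union>q\<in>\<rat>. N q"])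
    show "negligible (\<Union>q\<in>\<rat>. N q)"
      by (rule negligible_countable_Union) (auto simp: N countable_rat)
    fix x e assume x: "x \<notin> (\<Union>q\<in>\<rat>. N q)" and e: "(0::real) < e"
    \<comment> \<open>Three portions of e/3: the differentiation theorem for q, the distance from q
      to v(x), and the change from q back to v(x) under the integral.\<close>
    obtain q where q: "q \<in> \<rat>" "v x - e / 3 < q" "q < v x + e / 3"
      using Rats_dense_in_real[of "v x - e / 3" "v x + e / 3"] e by auto
    obtain d where d: "d > 0" "\<And>h. 0 < h \<Longrightarrow> h < d \<Longrightarrow>
        norm (integral (cbox x (x + h *\<^sub>R One)) (\<lambda>y. \<bar>v y - q\<bar>) /\<^sub>R h ^ DIM(real ^ 'n) - \<bar>v x - q\<bar>) < e / 3"
      using N(2)[of x q "e / 3"] x q e by auto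
    have "integral (cbox x (x + diag s)) (\<lambda>y. \<bar>v y - v x\<bar>) < e * s ^ CARD('n)" if s: "0 < s" "s < d" for s
    proof -
      let ?Q = "cbox x (x + diag s)"
      have iq: "(\<lambda>y. \<bar>v y - c\<bar>) integrable_on ?Q" for c
        by (rule locally_integrable_integrable_on[OF locally_integrable_abs_diff[OF v]])
      have "integral ?Q (\<lambda>y. \<bar>v y - q\<bar>) / s ^ CARD('n) < e / 3 + \<bar>v x - q\<bar>"
      proof -
        have "integral ?Q (\<lambda>y. \<bar>v y - q\<bar>) /\<^sub>R s ^ DIM(real ^ 'n) = integral ?Q (\<lambda>y. \<bar>v y - q\<bar>) / s ^ CARD('n)"
          by (simp add: field_simps)
        then show ?thesis
          using d(2)[OF s] unfolding One_eq_diag real_norm_def by linarith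
      qed
      also have "\<dots> < 2 * e / 3" using q by linarith
      finally have 1: "integral ?Q (\<lambda>y. \<bar>v y - q\<bar>) < 2 * e / 3 * s ^ CARD('n)"
        using s by (simp add: pos_divide_less_eq)
      have "integral ?Q (\<lambda>y. \<bar>v y - v x\<bar>) \<le> integral ?Q (\<lambda>y. \<bar>v y - q\<bar> + e / 3)"
        using q by (intro integral_le iq integrable_add integrable_const) linarith
      also have "\<dots> = integral ?Q (\<lambda>y. \<bar>v y - q\<bar>) + e / 3 * s ^ CARD('n)"
        using s by (subst Henstock_Kurzweil_Integration.integral_add) (simp_all add: iq content_cbox_diag integrable_const)
      finally show ?thesis using 1 by (simp add: algebra_simps)
    qed
    with d(1) show "\<exists>d>0. \<forall>s. 0 < s \<and> s < d \<longrightarrow>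
       integral (cbox x (x + diag s)) (\<lambda>y. \<bar>v y - v x\<bar>) < e * s ^ CARD('n)" by blast
  qed
qed

text \<open>The kernel has a mass independent of s, so the error is the integral of v - v(x) against
  it, at most a multiple of the average of |v - v(x)| over the cube. The exceptional set depends on
  \<open>v\<close> alone and serves all bumps.\<close>

lemma conv_tendsto:
  fixes v :: "real ^ 'n::finite \<Rightarrow> real"
  assumes v: "locally_integrable v"
  obtains N where "negligible N"
    "\<And>x g. x \<notin> N \<Longrightarrow> (\<And>i. bump 0 1 (g i)) \<Longrightarrow>
       (conv g v x \<longlongrightarrow> v x * (\<Prod>i\<in>UNIV. integral\<^sup>L lborel (g i))) (at_right 0)"
proof -
  obtain N where N: "negligible N"
    "\<And>x e. x \<notin> N \<Longrightarrow> 0 < e \<Longrightarrow> \<exists>d>0. \<forall>s. 0 < s \<and> s < d \<longrightarrow>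
       integral (cbox x (x + diag s)) (\<lambda>y. \<bar>v y - v x\<bar>) < e * s ^ CARD('n)"
    using lebesgue_points[OF v] by blast
  have "(conv g v x \<longlongrightarrow> v x * (\<Prod>i\<in>UNIV. integral\<^sup>L lborel (g i))) (at_right 0)"
    if x: "x \<notin> N" and g: "\<And>i. bump 0 1 (g i)" for x g
  proof (rule tendstoI)
    fix e :: real assume e: "0 < e"
    obtain B where B: "0 < B" "\<And>s x y. 0 < s \<Longrightarrow> \<bar>kern g s x y\<bar> \<le> B / s ^ CARD('n)"
      using kern_bounded[of g] g by metis
    \<comment> \<open>The tolerance e / B absorbs the bound of the kernel.\<close>
    obtain d where d: "d > 0" "\<And>s. 0 < s \<Longrightarrow> s < d \<Longrightarrow>
       integral (cbox x (x + diag s)) (\<lambda>y. \<bar>v y - v x\<bar>) < e / B * s ^ CARD('n)"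
      using N(2)[OF x, of "e / B"] e B(1) by auto
    have "dist (conv g v x s) (v x * (\<Prod>i\<in>UNIV. integral\<^sup>L lborel (g i))) < e" if s: "0 < s" "s < d" for s
    proof -
      let ?Q = "cbox x (x + diag s)"
      have si: "set_integrable lebesgue ?Q (\<lambda>y. \<bar>v y - v x\<bar>)"
        using locally_integrable_abs_diff[OF v] by (simp add: locally_integrable_def)
      have "conv g v x s - v x * (\<Prod>i\<in>UNIV. integral\<^sup>L lborel (g i)) =
          (LINT y|lebesgue. v y * kern g s x y) - (LINT y|lebesgue. v x * kern g s x y)"
        by (simp add: conv_def integral_kern[where g = g, OF g s(1)])
      also have "\<dots> = (LINT y|lebesgue. v y * kern g s x y - v x * kern g s x y)"
        by (intro Bochner_Integration.integral_diff[symmetric] integrable_kern[OF v g s(1)]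
            integrable_kern[OF locally_integrable_const g s(1)])
      finally have "\<bar>conv g v x s - v x * (\<Prod>i\<in>UNIV. integral\<^sup>L lborel (g i))\<bar>
          \<le> (LINT y|lebesgue. \<bar>v y * kern g s x y - v x * kern g s x y\<bar>)"
        by simp
      also have "\<dots> \<le> (LINT y|lebesgue. B / s ^ CARD('n) * (indicator ?Q y *\<^sub>R \<bar>v y - v x\<bar>))"
      proof (rule integral_mono')
        show "integrable lebesgue (\<lambda>y. B / s ^ CARD('n) * (indicator ?Q y *\<^sub>R \<bar>v y - v x\<bar>))"
          using si unfolding set_integrable_def by (rule integrable_mult_right)
        fix y
        show "0 \<le> B / s ^ CARD('n) * (indicator ?Q y *\<^sub>R \<bar>v y - v x\<bar>)"
          using B(1) s(1) by simp
        show "\<bar>v y * kern g s x y - v x * kern g s x y\<bar> \<le> B / s ^ CARD('n) * (indicator ?Q y *\<^sub>R \<bar>v y - v x\<bar>)"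
        proof (cases "y \<in> ?Q")
          case True
          have "\<bar>v y * kern g s x y - v x * kern g s x y\<bar> = \<bar>kern g s x y\<bar> * \<bar>v y - v x\<bar>"
            by (simp add: abs_mult[symmetric] algebra_simps)
          also have "\<dots> \<le> B / s ^ CARD('n) * \<bar>v y - v x\<bar>"
            by (intro mult_right_mono B(2) s) simp
          finally show ?thesis using True by simp
        next
          case False
          then show ?thesis using kern_eq_0[where g = g, OF g s(1) False] by simp
        qed
      qed
      also have "\<dots> = B / s ^ CARD('n) * (LINT y:?Q|lebesgue. \<bar>v y - v x\<bar>)"
        by (simp add: set_lebesgue_integral_def)
      also have "(LINT y:?Q|lebesgue. \<bar>v y - v x\<bar>) = integral ?Q (\<lambda>y. \<bar>v y - v x\<bar>)"
        by (rule set_lebesgue_integral_eq_integral(2)[OF si])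
      also have "B / s ^ CARD('n) * integral ?Q (\<lambda>y. \<bar>v y - v x\<bar>) < B / s ^ CARD('n) * (e / B * s ^ CARD('n))"
        using B(1) s by (intro mult_strict_left_mono d(2)) auto
      also have "\<dots> = e" using B(1) s(1) by simp
      finally show ?thesis by (simp add: dist_real_def)
    qed
    then show "\<forall>\<^sub>F s in at_right 0. dist (conv g v x s) (v x * (\<Prod>i\<in>UNIV. integral\<^sup>L lborel (g i))) < e"
      unfolding eventually_at_right_field using d(1) by blast
  qed
  with N(1) that show ?thesis by blast
qed

section \<open>Uniqueness of weak derivatives and the chosen representative\<close>

definition std_bumps :: "'n \<Rightarrow> real \<Rightarrow> real" where "std_bumps i = std_bump"

lemma bump_std_bumps: "bump 0 1 (std_bumps i)"
  by (simp add: std_bumps_def std_bump)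

lemma prod_integral_std_bumps_pos: "0 < (\<Prod>i\<in>UNIV. integral\<^sup>L lborel (std_bumps (i::'n::finite)))"
  by (simp add: std_bumps_def integral_std_bump_pos prod_pos)

lemma negligible_AE: "negligible N \<Longrightarrow> (\<And>x. x \<notin> N \<Longrightarrow> P x) \<Longrightarrow> AE x in lebesgue. P x"
  by (rule AE_I'[of N]) (auto simp: negligible_iff_null_sets)

text \<open>By \<open>conv_weak_partial\<close> the convolutions of \<open>v\<close> and
  \<open>w\<close> with the standard kernel are the same multiple of one convolution of
  \<open>u\<close>. Their limits as s -> 0 recover both functions at common Lebesgue points.\<close>

lemma weak_partial_unique:
  fixes u v w :: "real ^ 'n::finite \<Rightarrow> real"
  assumes v: "has_weak_partial u is v" and w: "has_weak_partial u is w"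
  shows "AE x in lebesgue. v x = w x"
proof -
  obtain N where N: "negligible N" "\<And>x g. x \<notin> N \<Longrightarrow> (\<And>i. bump 0 1 (g i)) \<Longrightarrow>
       (conv g v x \<longlongrightarrow> v x * (\<Prod>i\<in>UNIV. integral\<^sup>L lborel (g i))) (at_right 0)"
    using conv_tendsto[of v] v by (auto simp: has_weak_partial_def)
  obtain N' where N': "negligible N'" "\<And>x g. x \<notin> N' \<Longrightarrow> (\<And>i. bump 0 1 (g i)) \<Longrightarrow>
       (conv g w x \<longlongrightarrow> w x * (\<Prod>i\<in>UNIV. integral\<^sup>L lborel (g i))) (at_right 0)"
    using conv_tendsto[of w] w by (auto simp: has_weak_partial_def)
  show ?thesis
  proof (rule negligible_AE[of "N \<union> N'"])
    show "negligible (N \<union> N')" using N(1) N'(1) by (rule negligible_Un)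
    fix x assume x: "x \<notin> N \<union> N'"
    have "conv std_bumps v x s = conv std_bumps w x s" if "0 < s" for s
      using conv_weak_partial[where g = std_bumps and x = x, OF v bump_std_bumps that] conv_weak_partial[where g = std_bumps and x = x, OF w bump_std_bumps that] that
      by simp
    then have "\<forall>\<^sub>F s in at_right 0. conv std_bumps v x s = conv std_bumps w x s"
      by (auto simp: eventually_at_filter)
    moreover have "(conv std_bumps v x \<longlongrightarrow> v x * (\<Prod>i\<in>UNIV. integral\<^sup>L lborel (std_bumps (i::'n)))) (at_right 0)"
      by (rule N(2)) (use x bump_std_bumps in auto)
    ultimately have "(conv std_bumps w x \<longlongrightarrow> v x * (\<Prod>i\<in>UNIV. integral\<^sup>L lborel (std_bumps (i::'n)))) (at_right 0)"
      by (rule Lim_transform_eventually[rotated])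
    moreover have "(conv std_bumps w x \<longlongrightarrow> w x * (\<Prod>i\<in>UNIV. integral\<^sup>L lborel (std_bumps (i::'n)))) (at_right 0)"
      by (rule N'(2)) (use x bump_std_bumps in auto)
    ultimately have "v x * (\<Prod>i\<in>UNIV. integral\<^sup>L lborel (std_bumps (i::'n))) = w x * (\<Prod>i\<in>UNIV. integral\<^sup>L lborel (std_bumps (i::'n)))"
      by (rule tendsto_unique[rotated]) simp
    then show "v x = w x"
      using prod_integral_std_bumps_pos[where 'n = 'n] mult_right_cancel by (metis less_irrefl)
  qed
qed

text \<open>Membership in the Sobolev space supplies some weak derivative in L^p; uniqueness almost
  everywhere passes its integrability on to the representative picked by
  \<open>SOME\<close>.\<close>

lemma
  assumes u: "u \<in> sobolev_space k p" and len: "length is \<le> k"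
  shows has_weak_partial_weak_partial: "has_weak_partial u is (weak_partial is u)"
    and weak_partial_Lp: "weak_partial is u \<in> Lp_space p"
proof -
  obtain v where v: "v \<in> Lp_space p" "has_weak_partial u is v"
    using u len by (auto simp: sobolev_space_def)
  show *: "has_weak_partial u is (weak_partial is u)"
  proof (cases "is = []")
    case True
    \<comment> \<open>For the empty list the representative is \<open>u\<close> by definition, and
      \<open>v\<close> is used only to know that \<open>u\<close> is locally integrable.\<close>
    then show ?thesis using v(2) by (auto simp: weak_partial_def has_weak_partial_def)
  next
    case False
    then show ?thesis using someI[of "has_weak_partial u is", OF v(2)] by (simp add: weak_partial_def)
  qed
  have meas: "weak_partial is u \<in> borel_measurable lebesgue"
    using * by (auto simp: has_weak_partial_def intro: borel_measurable_locally_integrable)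
  have "AE x in lebesgue. v x = weak_partial is u x"
    by (rule weak_partial_unique[OF v(2) *])
  then have "AE x in lebesgue. \<bar>v x\<bar> powr p = \<bar>weak_partial is u x\<bar> powr p"
    by eventually_elim simp
  moreover have "integrable lebesgue (\<lambda>x. \<bar>v x\<bar> powr p)" using v(1) by (simp add: Lp_space_def)
  ultimately have "integrable lebesgue (\<lambda>x. \<bar>weak_partial is u x\<bar> powr p)"
    by (subst integrable_cong_AE[symmetric]) (use meas v(1) in \<open>auto simp: Lp_space_def\<close>)
  with meas show "weak_partial is u \<in> Lp_space p" by (simp add: Lp_space_def)
qed


section \<open>Bounds for convolutions\<close>

lemma integral_deriv_bump:
  assumes "bump a b f" shows "integral\<^sup>L lborel (deriv f) = 0"
proof -
  \<comment> \<open>The margins of 1 put both endpoints outside the support, and the maximum keeps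
    the interval proper even if b < a.\<close>
  let ?A = "a - 1" let ?B = "max a b + 1"
  have "(LINT t|lborel. deriv f t * indicator {?A..?B} t) = f ?B - f ?A"
    by (rule integral_FTC_Icc_real)
       (use assms smooth_has_deriv smooth_deriv smooth_continuous_on[of "deriv f" UNIV] bumpD(1)
        in \<open>auto simp: continuous_on_eq_continuous_at\<close>)
  also have "\<dots> = 0"
  proof -
    have "?B \<notin> {a..b}" using max.cobounded2[of b a] by auto
    then show ?thesis using bumpD(2)[OF assms, of ?A] bumpD(2)[OF assms, of ?B] by simp
  qed
  also have "(\<lambda>t. deriv f t * indicator {?A..?B} t) = deriv f"
  proof
    fix t show "deriv f t * indicator {?A..?B} t = deriv f t"
    proof (cases "t \<in> {?A..?B}")
      case False
      then have "t \<notin> {a..b}" using max.cobounded2[of b a] by auto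
      then show ?thesis using bumpD(2)[OF bump_deriv[OF assms], of t] by simp
    qed simp
  qed
  finally show ?thesis .
qed

text \<open>Integration by parts lowers both the power and the order of the derivative by one. Since
  a < b, the power reaches 0 while a derivative is still left, and that derivative integrates to
  0.\<close>

lemma integral_power_mult_higher_deriv:
  assumes h: "bump \<alpha> \<beta> h" and "a < b"
  shows "integral\<^sup>L lborel (\<lambda>t. t ^ a * (deriv ^^ b) h t) = 0"
  using \<open>a < b\<close>
proof (induction a arbitrary: b)
  case 0
  then obtain c where b: "b = Suc c" by (cases b) auto
  show ?case using integral_deriv_bump[OF bump_higher_deriv[OF h], of c] by (simp add: b)
next
  case (Suc a)
  then obtain c where b: "b = Suc c" "a < c" by (cases b) auto
  let ?H = "(deriv ^^ c) h"
  have H: "bump \<alpha> \<beta> ?H" by (rule bump_higher_deriv[OF h])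
  have bF: "bump \<alpha> \<beta> (\<lambda>t. t ^ Suc a * ?H t)"
    by (rule bump_mult_smooth[OF smooth_power H])
  have i1: "integrable lborel (\<lambda>t. t ^ a * ?H t)"
    by (rule bump_integrable[OF bump_mult_smooth[OF smooth_power H]])
  have i2: "integrable lborel (\<lambda>t. t ^ Suc a * deriv ?H t)"
    by (rule bump_integrable[OF bump_mult_smooth[OF smooth_power bump_deriv[OF H]]])
  have "((\<lambda>t. t ^ Suc a * ?H t) has_real_derivative
      real (Suc a) * (t ^ a * ?H t) + t ^ Suc a * deriv ?H t) (at t)" for t
  proof -
    have "((\<lambda>t. t ^ Suc a) has_real_derivative real (Suc a) * t ^ a) (at t)"
      using DERIV_pow[of "Suc a" t] by simp
    from DERIV_mult[OF this smooth_has_deriv[OF bumpD(1)[OF H]]]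
    show ?thesis by (simp only: mult_ac)
  qed
  then have d: "deriv (\<lambda>t. t ^ Suc a * ?H t) = (\<lambda>t. real (Suc a) * (t ^ a * ?H t) + t ^ Suc a * deriv ?H t)"
    by (intro ext DERIV_imp_deriv)
  have "0 = integral\<^sup>L lborel (\<lambda>t. real (Suc a) * (t ^ a * ?H t) + t ^ Suc a * deriv ?H t)"
    using integral_deriv_bump[OF bF] unfolding d by simp
  also have "\<dots> = integral\<^sup>L lborel (\<lambda>t. real (Suc a) * (t ^ a * ?H t)) + integral\<^sup>L lborel (\<lambda>t. t ^ Suc a * deriv ?H t)"
    by (intro Bochner_Integration.integral_add integrable_mult_right i1 i2)
  also have "integral\<^sup>L lborel (\<lambda>t. real (Suc a) * (t ^ a * ?H t)) = real (Suc a) * integral\<^sup>L lborel (\<lambda>t. t ^ a * ?H t)"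
    by (rule integral_mult_right_zero)
  also have "integral\<^sup>L lborel (\<lambda>t. t ^ a * ?H t) = 0"
    by (rule Suc.IH[OF b(2)])
  finally show ?case by (simp add: b)
qed

text \<open>By pigeonhole some coordinate is differentiated more often than its power in the
  monomial; the one-variable integral of that factor vanishes, and with it the product.\<close>

lemma conv_partials_monomial:
  fixes g :: "'n::finite \<Rightarrow> real \<Rightarrow> real"
  assumes g: "\<And>i. bump 0 1 (g i)" and s: "0 < s" and deg: "(\<Sum>i\<in>UNIV. a i) < length is"
  shows "conv (partials is g) (\<lambda>y. \<Prod>i\<in>UNIV. (y $ i) ^ a i) x s = 0"
proof -
  let ?f = "\<lambda>i t. t ^ a i * (partials is g i ((t - x $ i) / s) / s)"
  have b: "bump (x $ i) (x $ i + s) (?f i)" for i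
    using bump_mult_smooth[OF smooth_power bump_rescale[OF bump_partials[of g, OF g] s]] .
  have "conv (partials is g) (\<lambda>y. \<Prod>i\<in>UNIV. (y $ i) ^ a i) x s = integral\<^sup>L lebesgue (prodfun ?f)"
    unfolding conv_def kern_def prodfun_def prod.distrib ..
  also have "\<dots> = (\<Prod>i\<in>UNIV. integral\<^sup>L lborel (?f i))"
    by (rule integral_prodfun) (rule bump_integrable[OF b])
  also have "\<dots> = 0"
  proof -
    have "\<exists>i. a i < count_list is i"
    proof (rule ccontr)
      assume "\<not> ?thesis"
      then have "(\<Sum>i\<in>UNIV. count_list is i) \<le> (\<Sum>i\<in>UNIV. a i)"
        by (intro sum_mono) (simp add: not_less)
      with deg show False by (simp add: sum_count_set)
    qed
    then obtain i where i: "a i < count_list is i" by blast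
    let ?c = "count_list is i"
    \<comment> \<open>\<open>partials\<close> differentiates the unscaled profile; the power of s
      converts this to the derivative of the rescaled bump.\<close>
    have "?f i = (\<lambda>t. s ^ ?c * (t ^ a i * (deriv ^^ ?c) (\<lambda>t. g i ((t - x $ i) / s) / s) t))"
      unfolding higher_deriv_rescale[OF bumpD(1)[OF g]] partials_def using s by (simp add: fun_eq_iff)
    then have "integral\<^sup>L lborel (?f i) = s ^ ?c * integral\<^sup>L lborel (\<lambda>t. t ^ a i * (deriv ^^ ?c) (\<lambda>t. g i ((t - x $ i) / s) / s) t)"
      by simp
    also have "\<dots> = 0"
      using integral_power_mult_higher_deriv[OF bump_rescale[OF g s] i] by simp
    finally show ?thesis by (intro prod_zero) auto
  qed
  finally show ?thesis .
qed

lemma continuous_locally_integrable: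
  assumes "continuous_on UNIV f" shows "locally_integrable f"
  unfolding locally_integrable_def set_integrable_def
proof (intro allI impI)
  fix K :: "(real ^ 'a) set" assume "compact K"
  then have "integrable lborel (\<lambda>x. indicator K x *\<^sub>R f x)"
    by (rule borel_integrable_compact) (use assms continuous_on_subset in blast)
  then show "integrable lebesgue (\<lambda>x. indicator K x *\<^sub>R f x)"
    by (subst integrable_completion) auto
qed

text \<open>Linearity over the monomials. Local integrability is recorded because u - P is later
  split under the integral.\<close>

lemma conv_partials_poly:
  fixes g :: "'n::finite \<Rightarrow> real \<Rightarrow> real"
  assumes P: "P \<in> poly_space (int (length is) - 1)" and g: "\<And>i. bump 0 1 (g i)" and s: "0 < s"
  shows "conv (partials is g) P x s = 0" and "locally_integrable P"
proof -
  let ?m = "\<lambda>\<alpha> (y :: real ^ 'n). \<Prod>i\<in>UNIV. (y $ i) ^ \<alpha> i"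
  let ?I = "{\<alpha> :: 'n \<Rightarrow> nat. int (\<Sum>i\<in>UNIV. \<alpha> i) \<le> int (length is) - 1}"
  obtain c where P_eq: "P = (\<lambda>y. \<Sum>\<alpha>\<in>?I. c \<alpha> * ?m \<alpha> y)"
    using P by (auto simp: poly_space_def)
  have m: "continuous_on UNIV (?m \<alpha>)" for \<alpha> by (intro continuous_intros)
  have bp: "bump 0 1 (partials is g i)" for i by (rule bump_partials[OF g])
  show "locally_integrable P"
    unfolding P_eq by (intro continuous_locally_integrable continuous_intros m)
  have "conv (partials is g) P x s = (LINT y|lebesgue. (\<Sum>\<alpha>\<in>?I. c \<alpha> * (?m \<alpha> y * kern (partials is g) s x y)))"
    by (simp add: conv_def P_eq sum_distrib_right mult.assoc)
  also have "\<dots> = (\<Sum>\<alpha>\<in>?I. (LINT y|lebesgue. c \<alpha> * (?m \<alpha> y * kern (partials is g) s x y)))"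
    by (intro Bochner_Integration.integral_sum integrable_mult_right integrable_kern
        continuous_locally_integrable m bp s)
  also have "\<dots> = (\<Sum>\<alpha>\<in>?I. c \<alpha> * conv (partials is g) (?m \<alpha>) x s)"
    by (simp add: conv_def)
  also have "\<dots> = 0"
  proof (intro sum.neutral ballI)
    fix \<alpha> assume "\<alpha> \<in> ?I"
    then have "int (\<Sum>i\<in>UNIV. \<alpha> i) < int (length is)"
      by (simp del: of_nat_sum)
    then have "(\<Sum>i\<in>UNIV. \<alpha> i) < length is"
      by (simp only: of_nat_less_iff)
    from conv_partials_monomial[where g = g and x = x, OF g s this]
    show "c \<alpha> * conv (partials is g) (?m \<alpha>) x s = 0" by simp
  qed
  finally show "conv (partials is g) P x s = 0" .
qed

text \<open>A point of the cube of side s at x is at distance at most N s, hence inside the open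
  ball of radius (N + 1) s. Cube and ball have comparable volume, so the bound s^-N of the kernel
  becomes an average over the ball.\<close>

lemma conv_ball_bound:
  fixes g :: "'n::finite \<Rightarrow> real \<Rightarrow> real"
  assumes g: "\<And>i. bump 0 1 (g i)"
  obtains C where "0 < C" "\<And>v x s. 0 < s \<Longrightarrow> v \<in> borel_measurable lebesgue \<Longrightarrow> ennreal \<bar>conv g v x s\<bar> \<le> ennreal C *
     ((\<integral>\<^sup>+y\<in>ball x (real (CARD('n) + 1) * s). ennreal \<bar>v y\<bar> \<partial>lebesgue) /
       emeasure lebesgue (ball x (real (CARD('n) + 1) * s)))"
proof -
  obtain B where B: "0 < B" "\<And>s x y. 0 < s \<Longrightarrow> \<bar>kern g s x y\<bar> \<le> B / s ^ CARD('n)"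
    using kern_bounded[of g] g by metis
  let ?d = "real (CARD('n) + 1)"
  \<comment> \<open>The bound \<open>B\<close> times the volume of the ball of radius N + 1, which
    is the volume of the ball used divided by s^N.\<close>
  let ?C = "B * unit_ball_vol (CARD('n)) * ?d ^ CARD('n)"
  have C: "0 < ?C" using B(1) by (simp add: zero_less_mult_iff)
  have "ennreal \<bar>conv g v x s\<bar> \<le> ennreal ?C *
     ((\<integral>\<^sup>+y\<in>ball x (?d * s). ennreal \<bar>v y\<bar> \<partial>lebesgue) / emeasure lebesgue (ball x (?d * s)))"
    if s: "0 < s" and v: "v \<in> borel_measurable lebesgue" for v x s
  proof -
    let ?b = "ball x (?d * s)"
    have sub: "cbox x (x + diag s) \<subseteq> ?b"
    proof
      fix y assume "y \<in> cbox x (x + diag s)"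
      then have "\<bar>(y - x) $ i\<bar> \<le> s" for i by (simp add: mem_box_cart) (smt (verit))
      then have "norm (y - x) \<le> (\<Sum>i\<in>(UNIV :: 'n set). s)"
        by (intro order.trans[OF norm_le_l1_cart sum_mono])
      also have "\<dots> < ?d * s" using s by (simp add: algebra_simps)
      finally show "y \<in> ?b" by (simp add: dist_norm norm_minus_commute)
    qed
    have "ennreal \<bar>conv g v x s\<bar> \<le> (\<integral>\<^sup>+y. ennreal \<bar>v y * kern g s x y\<bar> \<partial>lebesgue)"
    proof (cases "integrable lebesgue (\<lambda>y. v y * kern g s x y)")
      case True
      from integral_norm_bound_ennreal[OF this] show ?thesis by (simp add: conv_def)
    next
      case False
      \<comment> \<open>The Bochner integral of a nonintegrable function is 0 by default.\<close>
      then show ?thesis by (simp add: conv_def not_integrable_integral_eq)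
    qed
    also have "\<dots> \<le> (\<integral>\<^sup>+y. ennreal (B / s ^ CARD('n)) * (ennreal \<bar>v y\<bar> * indicator ?b y) \<partial>lebesgue)"
    proof (intro nn_integral_mono)
      fix y
      show "ennreal \<bar>v y * kern g s x y\<bar> \<le> ennreal (B / s ^ CARD('n)) * (ennreal \<bar>v y\<bar> * indicator ?b y)"
      proof (cases "y \<in> ?b")
        case True
        have "\<bar>v y * kern g s x y\<bar> \<le> B / s ^ CARD('n) * \<bar>v y\<bar>"
          using mult_left_mono[OF B(2)[OF s, of x y] abs_ge_zero[of "v y"]] by (simp add: abs_mult mult.commute)
        then have "ennreal \<bar>v y * kern g s x y\<bar> \<le> ennreal (B / s ^ CARD('n) * \<bar>v y\<bar>)"
          by (rule ennreal_leI)
        also have "\<dots> = ennreal (B / s ^ CARD('n)) * ennreal \<bar>v y\<bar>"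
          using B(1) s by (intro ennreal_mult) auto
        finally show ?thesis using True by simp
      next
        case False
        then have "kern g s x y = 0" using kern_eq_0[where g = g, OF g s] sub by blast
        then show ?thesis by simp
      qed
    qed
    also have "\<dots> = ennreal (B / s ^ CARD('n)) * (\<integral>\<^sup>+y\<in>?b. ennreal \<bar>v y\<bar> \<partial>lebesgue)"
      by (rule nn_integral_cmult) (use v in \<open>auto intro!: borel_measurable_times_ennreal borel_measurable_indicator\<close>)
    also have "\<dots> = ennreal ?C * ((\<integral>\<^sup>+y\<in>?b. ennreal \<bar>v y\<bar> \<partial>lebesgue) / emeasure lebesgue ?b)"
    proof -
      have m: "emeasure lebesgue ?b = ennreal (unit_ball_vol (CARD('n)) * (?d * s) ^ CARD('n))"
        using s by (simp add: emeasure_ball)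
      have pos: "0 < unit_ball_vol (CARD('n)) * (?d * s) ^ CARD('n)" using s by simp
      have "?C = (B / s ^ CARD('n)) * (unit_ball_vol (CARD('n)) * (?d * s) ^ CARD('n))"
        using s by (simp add: power_mult_distrib)
      then have "ennreal ?C = ennreal (B / s ^ CARD('n)) * emeasure lebesgue ?b"
        unfolding m using B(1) s pos by (simp only: ennreal_mult less_imp_le divide_nonneg_pos zero_less_power)
      moreover have "emeasure lebesgue ?b * (I / emeasure lebesgue ?b) = I" for I
      proof -
        have "emeasure lebesgue ?b \<noteq> 0" "emeasure lebesgue ?b \<noteq> top"
          unfolding m using pos by (metis ennreal_eq_0_iff not_le, metis ennreal_neq_top)
        then show ?thesis
          by (simp add: ennreal_times_divide mult.commute mult_divide_eq_ennreal)
      qed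
      ultimately show ?thesis by (simp only: mult.assoc)
    qed
    finally show ?thesis .
  qed
  with C that show ?thesis by blast
qed

text \<open>Moving the derivatives of \<open>L\<close> onto the kernel costs s^(-length L) and makes
  it annihilate the competing polynomials, so \<open>u\<close> may be replaced by u - P. The
  seminorm at radius (N + 1) s then contributes s^(-lam) and the constant (N + 1)^(-lam).\<close>

lemma campanato_conv_bound:
  fixes g :: "'n::finite \<Rightarrow> real \<Rightarrow> real"
  assumes g: "\<And>i. bump 0 1 (g i)"
  obtains C where "0 < C" "\<And>\<rho> u v x s. has_weak_partial u L v \<Longrightarrow>
     campanato_seminorm lam (length L) \<rho> u < \<infinity> \<Longrightarrow> 0 < s \<Longrightarrow> real (CARD('n) + 1) * s < \<rho> \<Longrightarrow>
     \<bar>conv g v x s\<bar> \<le> C * s powr (- (lam + length L)) * enn2real (campanato_seminorm lam (length L) \<rho> u)"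
proof -
  have bp: "bump 0 1 (partials L g i)" for i by (rule bump_partials[OF g])
  let ?d = "real (CARD('n) + 1)"
  obtain C where C: "0 < C" "\<And>v x s. 0 < s \<Longrightarrow> v \<in> borel_measurable lebesgue \<Longrightarrow> ennreal \<bar>conv (partials L g) v x s\<bar> \<le> ennreal C *
     ((\<integral>\<^sup>+y\<in>ball x (?d * s). ennreal \<bar>v y\<bar> \<partial>lebesgue) / emeasure lebesgue (ball x (?d * s)))"
    using conv_ball_bound[where g = "partials L g", OF bp] by blast
  have "\<bar>conv g v x s\<bar> \<le> C * ?d powr (- lam) * s powr (- (lam + length L)) * enn2real (campanato_seminorm lam (length L) \<rho> u)"
    if wp: "has_weak_partial u L v" and fin: "campanato_seminorm lam (length L) \<rho> u < \<infinity>"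
      and s: "0 < s" "?d * s < \<rho>" for \<rho> u v x s
  proof -
    let ?r = "?d * s" let ?A = "campanato_seminorm lam (length L) \<rho> u"
    let ?I = "INF P \<in> poly_space (int (length L) - 1). mean_deviation u P x ?r"
    have r: "0 < ?r" using s by simp
    have u: "locally_integrable u" using wp by (simp add: has_weak_partial_def)
    have eq: "\<bar>conv (partials L g) u x s\<bar> = s ^ length L * \<bar>conv g v x s\<bar>"
      using conv_weak_partial[where g = g and x = x, OF wp g s(1)] s(1) by (simp add: abs_mult power_abs)
    \<comment> \<open>The infimum need not be attained: the estimate is proved for every
      \<open>P\<close>, with \<open>C\<close> moved to the left so that only the deviation stays
      under the infimum.\<close>
    have "ennreal (\<bar>conv (partials L g) u x s\<bar> / C) \<le> ?I"
    proof (rule INF_greatest)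
      fix P :: "real ^ 'n \<Rightarrow> real" assume P: "P \<in> poly_space (int (length L) - 1)"
      have P0: "conv (partials L g) P x s = 0" and PL: "locally_integrable P"
        using conv_partials_poly[where g = g, OF P g s(1)] by auto
      have "conv (partials L g) (\<lambda>y. u y - P y) x s = conv (partials L g) u x s - conv (partials L g) P x s"
        unfolding conv_def left_diff_distrib
        by (intro Bochner_Integration.integral_diff integrable_kern u PL bp s)
      then have "ennreal \<bar>conv (partials L g) u x s\<bar> = ennreal \<bar>conv (partials L g) (\<lambda>y. u y - P y) x s\<bar>"
        by (simp add: P0)
      also have "\<dots> \<le> ennreal C * mean_deviation u P x ?r"
        unfolding mean_deviation_def
        by (intro C(2) s borel_measurable_diff borel_measurable_locally_integrable u PL)
      finally have "ennreal (1 / C) * ennreal \<bar>conv (partials L g) u x s\<bar> \<le> ennreal (1 / C) * (ennreal C * mean_deviation u P x ?r)"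
        by (rule mult_left_mono) simp
      also have "\<dots> = mean_deviation u P x ?r"
        using C(1) by (simp add: mult.assoc[symmetric] ennreal_mult[symmetric])
      finally show "ennreal (\<bar>conv (partials L g) u x s\<bar> / C) \<le> mean_deviation u P x ?r"
        using C(1) by (simp add: ennreal_mult[symmetric])
    qed
    then have "ennreal (?r powr lam) * ennreal (\<bar>conv (partials L g) u x s\<bar> / C) \<le> ennreal (?r powr lam) * ?I"
      by (rule mult_left_mono) simp
    also have "\<dots> \<le> ?A"
      unfolding campanato_seminorm_def
      by (rule SUP_upper2[of "(x, ?r)"]) (use r s in auto)
    also have "?A = ennreal (enn2real ?A)" using fin by simp
    finally have "?r powr lam * (\<bar>conv (partials L g) u x s\<bar> / C) \<le> enn2real ?A"
      using C(1) by (simp add: ennreal_mult[symmetric])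
    then have "?d powr lam * s powr lam * (s ^ length L * \<bar>conv g v x s\<bar> / C) \<le> enn2real ?A"
      using s(1) unfolding eq by (simp add: powr_mult)
    then have "C * ?d powr (- lam) * s powr (- (lam + length L)) *
        (?d powr lam * s powr lam * (s ^ length L * \<bar>conv g v x s\<bar> / C)) \<le>
        C * ?d powr (- lam) * s powr (- (lam + length L)) * enn2real ?A"
      using C(1) by (intro mult_left_mono) auto
    also have "C * ?d powr (- lam) * s powr (- (lam + length L)) *
        (?d powr lam * s powr lam * (s ^ length L * \<bar>conv g v x s\<bar> / C)) =
        (?d powr (- lam) * ?d powr lam) * (s powr (- (lam + length L)) * (s powr lam * s powr (length L))) * \<bar>conv g v x s\<bar>"
      using C(1) s(1) by (simp add: powr_realpow)
    also have "\<dots> = \<bar>conv g v x s\<bar>"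
      using s(1) by (simp add: powr_add[symmetric])
    finally show ?thesis .
  qed
  then show ?thesis
    using C(1) by (intro that[of "C * ?d powr (- lam)"]) (auto simp: add.commute)
qed

text \<open>Weak derivatives are only Lebesgue measurable, whereas the maximal function is built on
  Borel functions. A Borel majorant \<open>F\<close> bridges the two, and a single \<open>F\<close>
  can serve all components of D^k u.\<close>

lemma conv_maximal_bound:
  fixes g :: "'n::finite \<Rightarrow> real \<Rightarrow> real"
  assumes g: "\<And>i. bump 0 1 (g i)"
  obtains C where "0 < C" "\<And>v F R x s. v \<in> borel_measurable lebesgue \<Longrightarrow> F \<in> borel_measurable borel \<Longrightarrow>
     (AE y in lebesgue. \<bar>v y\<bar> \<le> F y) \<Longrightarrow> 0 < s \<Longrightarrow> real (CARD('n) + 1) * s < R \<Longrightarrow>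
     ennreal \<bar>conv g v x s\<bar> \<le> ennreal C * maximal_function R (\<lambda>y. ennreal (F y)) x"
proof -
  let ?d = "real (CARD('n) + 1)"
  obtain C where C: "0 < C" "\<And>v x s. 0 < s \<Longrightarrow> v \<in> borel_measurable lebesgue \<Longrightarrow> ennreal \<bar>conv g v x s\<bar> \<le> ennreal C *
     ((\<integral>\<^sup>+y\<in>ball x (?d * s). ennreal \<bar>v y\<bar> \<partial>lebesgue) / emeasure lebesgue (ball x (?d * s)))"
    using conv_ball_bound[where g = g, OF g] by blast
  have "ennreal \<bar>conv g v x s\<bar> \<le> ennreal C * maximal_function R (\<lambda>y. ennreal (F y)) x"
    if v: "v \<in> borel_measurable lebesgue" and F [measurable]: "F \<in> borel_measurable borel"
      and le: "AE y in lebesgue. \<bar>v y\<bar> \<le> F y" and s: "0 < s" "?d * s < R" for v F R x s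
  proof -
    let ?b = "ball x (?d * s)"
    have [measurable]: "?b \<in> sets borel" by (simp add: borel_open)
    have "(\<integral>\<^sup>+y\<in>?b. ennreal \<bar>v y\<bar> \<partial>lebesgue) \<le> (\<integral>\<^sup>+y\<in>?b. ennreal (F y) \<partial>lebesgue)"
      by (rule nn_integral_mono_AE) (use le in eventually_elim, auto intro!: mult_right_mono ennreal_leI)
    also have "\<dots> = (\<integral>\<^sup>+y\<in>?b. ennreal (F y) \<partial>lborel)"
      by (rule nn_integral_completion)
    finally have "(\<integral>\<^sup>+y\<in>?b. ennreal \<bar>v y\<bar> \<partial>lebesgue) / emeasure lebesgue ?b
        \<le> (\<integral>\<^sup>+y\<in>?b. ennreal (F y) \<partial>lborel) / emeasure lborel ?b"
      by (simp add: divide_right_mono_ennreal)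
    also have "\<dots> \<le> maximal_function R (\<lambda>y. ennreal (F y)) x"
      unfolding maximal_function_def
      by (rule SUP_upper2[of "(x, ?d * s)"]) (use s in auto)
    finally show ?thesis
      using C(2)[OF s(1) v, of x] by (meson mult_left_mono order.trans zero_le)
  qed
  with C(1) that show ?thesis by auto
qed


section \<open>Pointwise bounds for weak derivatives\<close>

lemma finite_lists_length: "finite {is :: 'n::finite list. length is = j}"
  using finite_lists_length_eq[of "UNIV :: 'n set" j] by simp

lemma abs_le_tensor_norm:
  assumes "length L = j" shows "\<bar>T L\<bar> \<le> tensor_norm j T"
proof -
  have "(T L)\<^sup>2 \<le> (\<Sum>is | length is = j. (T is)\<^sup>2)"
    using assms finite_lists_length by (intro member_le_sum) auto
  then have "sqrt ((T L)\<^sup>2) \<le> tensor_norm j T"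
    unfolding tensor_norm_def L2_set_def by (rule real_sqrt_le_mono)
  then show ?thesis by simp
qed

lemma tensor_norm_le_sum: "tensor_norm j T \<le> (\<Sum>is | length is = j. \<bar>T is\<bar>)"
  unfolding tensor_norm_def by (rule L2_set_le_sum_abs)

lemma tensor_norm_nonneg: "0 \<le> tensor_norm j T"
  unfolding tensor_norm_def by (rule L2_set_nonneg)

text \<open>The sum is at most \<open>card S\<close> times its largest term, and the p-th power of
  that term is one of the summands on the right.\<close>

lemma powr_sum_le:
  fixes a :: "'a \<Rightarrow> real"
  assumes S: "finite S" and a: "\<And>i. i \<in> S \<Longrightarrow> 0 \<le> a i" and p: "0 \<le> p"
  shows "(\<Sum>i\<in>S. a i) powr p \<le> card S powr p * (\<Sum>i\<in>S. a i powr p)"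
proof (cases "S = {}")
  case False
  define M where "M = Max (a ` S)"
  have "M \<in> a ` S" unfolding M_def using S False by (intro Max_in) auto
  then obtain i where i: "i \<in> S" "M = a i" by auto
  have "a j \<le> M" if "j \<in> S" for j
    unfolding M_def using S that by (intro Max_ge) auto
  then have "(\<Sum>i\<in>S. a i) \<le> card S * M"
    by (rule sum_bounded_above)
  then have "(\<Sum>i\<in>S. a i) powr p \<le> (card S * M) powr p"
    using p a by (intro powr_mono2 sum_nonneg)
  also have "\<dots> = card S powr p * a i powr p"
    using a i by (simp add: powr_mult)
  also have "\<dots> \<le> card S powr p * (\<Sum>i\<in>S. a i powr p)"
    using S i by (intro mult_left_mono member_le_sum) auto
  finally show ?thesis .
qed simp

text \<open>The Euclidean norm is at most the sum of the components, so \<open>powr_sum_le\<close>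
  transfers p-integrability from the components to the tensor.\<close>

lemma
  assumes u: "u \<in> sobolev_space k p" and j: "j \<le> k"
  shows borel_measurable_weak_deriv: "(\<lambda>x. weak_deriv j u x is) \<in> borel_measurable lebesgue"
    and borel_measurable_tensor_norm_weak_deriv:
      "(\<lambda>x. tensor_norm j (weak_deriv j u x)) \<in> borel_measurable lebesgue"
    and integrable_tensor_norm_weak_deriv:
      "0 < p \<Longrightarrow> integrable lebesgue (\<lambda>x. tensor_norm j (weak_deriv j u x) powr p)"
proof -
  have Lp: "weak_partial is u \<in> Lp_space p" if "length is = j" for "is"
    using weak_partial_Lp[OF u] that j by simp
  show comp: "(\<lambda>x. weak_deriv j u x is) \<in> borel_measurable lebesgue" for "is"
    using Lp[of "is"] by (cases "length is = j") (simp_all add: weak_deriv_def Lp_space_def)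
  show tn: "(\<lambda>x. tensor_norm j (weak_deriv j u x)) \<in> borel_measurable lebesgue"
  proof -
    note [measurable] = comp
    show ?thesis unfolding tensor_norm_def L2_set_def by measurable
  qed
  assume p: "0 < p"
  let ?S = "{is :: 'a list. length is = j}"
  have "integrable lebesgue (\<lambda>x. card ?S powr p * (\<Sum>is\<in>?S. \<bar>weak_partial is u x\<bar> powr p))"
    using Lp by (intro integrable_mult_right Bochner_Integration.integrable_sum) (auto simp: Lp_space_def)
  then show "integrable lebesgue (\<lambda>x. tensor_norm j (weak_deriv j u x) powr p)"
  proof (rule Bochner_Integration.integrable_bound)
    show "(\<lambda>x. tensor_norm j (weak_deriv j u x) powr p) \<in> borel_measurable lebesgue"
      using tn by measurable
    show "AE x in lebesgue. norm (tensor_norm j (weak_deriv j u x) powr p)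
        \<le> norm (card ?S powr p * (\<Sum>is\<in>?S. \<bar>weak_partial is u x\<bar> powr p))"
    proof (intro always_eventually allI)
      fix x
      have "tensor_norm j (weak_deriv j u x) powr p \<le> (\<Sum>is\<in>?S. \<bar>weak_deriv j u x is\<bar>) powr p"
        using p by (intro powr_mono2 tensor_norm_le_sum tensor_norm_nonneg) simp
      also have "\<dots> = (\<Sum>is\<in>?S. \<bar>weak_partial is u x\<bar>) powr p"
        by (simp add: weak_deriv_def)
      also have "\<dots> \<le> card ?S powr p * (\<Sum>is\<in>?S. \<bar>weak_partial is u x\<bar> powr p)"
        using p by (intro powr_sum_le finite_lists_length) auto
      finally show "norm (tensor_norm j (weak_deriv j u x) powr p)
        \<le> norm (card ?S powr p * (\<Sum>is\<in>?S. \<bar>weak_partial is u x\<bar> powr p))" by simp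
    qed
  qed
qed

text \<open>The constant precedes \<rho>, \<open>u\<close> and \<open>F\<close>, and one null set
  serves all \<delta>. This uniformity is essential because \<delta> will later be chosen depending
  on the point.\<close>

lemma weak_partial_pointwise_bound:
  fixes L :: "'n::finite list"
  assumes L: "length L < k" and lam: "- real (length L) \<le> lam"
  obtains C where "0 < C"
    "\<And>\<rho> u F. 0 < \<rho> \<Longrightarrow> u \<in> sobolev_space k p \<Longrightarrow> campanato_seminorm lam (length L) \<rho> u < \<infinity> \<Longrightarrow>
       F \<in> borel_measurable borel \<Longrightarrow> (AE y in lebesgue. tensor_norm k (weak_deriv k u y) \<le> F y) \<Longrightarrow>
       AE x in lebesgue. \<forall>w \<delta>. 0 \<le> w \<longrightarrow> maximal_function \<rho> (\<lambda>y. ennreal (F y)) x = ennreal w \<longrightarrow>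
         0 < \<delta> \<longrightarrow> \<delta> < \<rho> / (real (CARD('n) + 1) * real (k - length L)) \<longrightarrow>
         \<bar>weak_partial L u x\<bar> \<le> C * (\<delta> powr (- (lam + length L)) *
           enn2real (campanato_seminorm lam (length L) \<rho> u) + \<delta> ^ (k - length L) * w)"
proof -
  let ?g = "std_bumps :: 'n \<Rightarrow> real \<Rightarrow> real"
  let ?d = "real (CARD('n) + 1)"
  define l where "l = length L"
  define m where "m = k - l"
  have m: "0 < m" "m + l = k" using L by (auto simp: m_def l_def)
  define c where "c = (\<Prod>i\<in>UNIV. integral\<^sup>L lborel (?g i))"
  have c: "0 < c" unfolding c_def by (rule prod_integral_std_bumps_pos)
  obtain C2 where C2: "0 < C2" "\<And>\<rho> u v x s. has_weak_partial u L v \<Longrightarrow>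
     campanato_seminorm lam (length L) \<rho> u < \<infinity> \<Longrightarrow> 0 < s \<Longrightarrow> ?d * s < \<rho> \<Longrightarrow>
     \<bar>conv ?g v x s\<bar> \<le> C2 * s powr (- (lam + length L)) * enn2real (campanato_seminorm lam (length L) \<rho> u)"
    using campanato_conv_bound[where g = ?g and L = L and lam = lam, OF bump_std_bumps] by blast
  \<comment> \<open>Naming the property lets \<open>choice\<close> select one constant per list of
    coordinates before \<open>v\<close>, \<open>F\<close> and the point are fixed.\<close>
  define Q where "Q C is \<longleftrightarrow> (\<forall>v F R x s. v \<in> borel_measurable lebesgue \<longrightarrow> F \<in> borel_measurable borel \<longrightarrow>
     (AE y in lebesgue. \<bar>v y\<bar> \<le> F y) \<longrightarrow> 0 < s \<longrightarrow> ?d * s < R \<longrightarrow>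
     ennreal \<bar>conv (monomial_times is ?g) v x s\<bar> \<le> ennreal C * maximal_function R (\<lambda>y. ennreal (F y)) x)" for C "is"
  have "\<forall>is. \<exists>C. 0 < C \<and> Q C is"
  proof
    fix "is" :: "'n list"
    have "bump 0 1 (monomial_times is ?g i)" for i
      by (rule bump_monomial_times) (rule bump_std_bumps)
    then show "\<exists>C. 0 < C \<and> Q C is"
      unfolding Q_def by (rule conv_maximal_bound[where g = "monomial_times is ?g"]) blast
  qed
  from choice[OF this] obtain C1 where C1: "\<And>is. 0 < C1 is" "\<And>is. Q (C1 is) is" by blast
  define K where "K = (\<Sum>is | length is = m. C1 is)"
  have K: "0 \<le> K" unfolding K_def using C1(1) by (intro sum_nonneg) (auto intro: less_imp_le)
  \<comment> \<open>The first summand comes from the sampled values, \<open>K\<close> from the m-th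
    scale derivative, and \<open>c\<close> is the kernel mass relating the limit to the weak
    derivative.\<close>
  define C where "C = (2 ^ m * C2 + K) / c"
  have C: "0 < C" using C2(1) K c by (simp add: C_def add_pos_nonneg)
  show ?thesis
  proof (rule that[OF C])
    fix \<rho> :: real and u :: "real ^ 'n \<Rightarrow> real" and F
    assume \<rho>: "0 < \<rho>" and u: "u \<in> sobolev_space k p" and fin: "campanato_seminorm lam (length L) \<rho> u < \<infinity>"
      and F: "F \<in> borel_measurable borel" "AE y in lebesgue. tensor_norm k (weak_deriv k u y) \<le> F y"
    let ?D = "\<lambda>is. weak_partial is u"
    let ?A = "enn2real (campanato_seminorm lam (length L) \<rho> u)"
    have wp: "has_weak_partial u is (?D is)" if "length is \<le> k" for "is"
      using has_weak_partial_weak_partial[OF u that] .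
    have wpL: "has_weak_partial u L (?D L)" using L by (intro wp) simp
    obtain N where N: "negligible N" "\<And>x g. x \<notin> N \<Longrightarrow> (\<And>i. bump 0 1 (g i)) \<Longrightarrow>
       (conv g (?D L) x \<longlongrightarrow> ?D L x * (\<Prod>i\<in>UNIV. integral\<^sup>L lborel (g i))) (at_right 0)"
      using conv_tendsto[of "?D L"] wpL by (auto simp: has_weak_partial_def)
    show "AE x in lebesgue. \<forall>w \<delta>. 0 \<le> w \<longrightarrow> maximal_function \<rho> (\<lambda>y. ennreal (F y)) x = ennreal w \<longrightarrow>
         0 < \<delta> \<longrightarrow> \<delta> < \<rho> / (?d * real (k - length L)) \<longrightarrow>
         \<bar>weak_partial L u x\<bar> \<le> C * (\<delta> powr (- (lam + length L)) * ?A + \<delta> ^ (k - length L) * w)"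
    proof (rule negligible_AE[OF N(1)], intro allI impI)
      fix x w \<delta> assume x: "x \<notin> N" and w: "0 \<le> w" "maximal_function \<rho> (\<lambda>y. ennreal (F y)) x = ennreal w"
        and \<delta>: "0 < \<delta>" "\<delta> < \<rho> / (?d * real (k - length L))"
      have m\<delta>: "real m * \<delta> < \<rho> / ?d"
      proof -
        have "0 < ?d * real m" using m(1) by simp
        then have "\<delta> * (?d * real m) < \<rho>"
          using \<delta>(2) unfolding l_def[symmetric] m_def[symmetric] by (simp only: pos_less_divide_eq)
        then have "real m * \<delta> * ?d < \<rho>" by (simp only: mult_ac)
        then show ?thesis by (simp add: pos_less_divide_eq)
      qed
      define S where "S = C2 * \<delta> powr (- (lam + length L)) * ?A"
      \<comment> \<open>The kernel degenerates at scale 0, so the difference is based at \<sigma> >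
        0; the upper bound on \<sigma> keeps the last scale \<sigma> + m \<delta> below \<rho>/(N +
        1).\<close>
      have bound: "\<bar>conv ?g (?D L) x \<sigma>\<bar> \<le> (2 ^ m - 1) * S + \<delta> ^ m * (K * w)"
        if \<sigma>: "0 < \<sigma>" "\<sigma> < \<rho> / ?d - real m * \<delta>" for \<sigma>
      proof -
        have ds: "?d * t < \<rho>" if "t \<le> \<sigma> + real m * \<delta>" for t
        proof -
          have "t < \<rho> / ?d" using that \<sigma> by linarith
          then show ?thesis by (simp add: pos_less_divide_eq mult.commute)
        qed
        have "\<bar>scale_deriv ?g ?D L x 0 \<sigma>\<bar> \<le> (2 ^ m - 1) * S + \<delta> ^ m * (K * w)"
        proof (rule finite_difference_bound[where h = "scale_deriv ?g ?D L x" and b = "\<sigma> + real m * \<delta>"])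
          fix j t assume "j < m" "\<sigma> \<le> t"
          then show "(scale_deriv ?g ?D L x j has_real_derivative scale_deriv ?g ?D L x (Suc j) t) (at t)"
            using \<sigma>(1) m(2) by (intro scale_deriv_has_derivative[where k = k and u = u] wp bump_std_bumps) (auto simp: l_def)
        next
          fix t assume t: "\<sigma> \<le> t" "t \<le> \<sigma> + real m * \<delta>"
          have "\<bar>scale_deriv ?g ?D L x m t\<bar> \<le> (\<Sum>is | length is = m. C1 is * w)"
            unfolding scale_deriv_def
          proof (rule order.trans[OF sum_abs sum_mono])
            fix "is" :: "'n list" assume "is \<in> {is. length is = m}"
            then have len: "length (is @ L) = k" using m(2) by (simp add: l_def)
            have "AE y in lebesgue. \<bar>?D (is @ L) y\<bar> \<le> F y"
              using F(2)
            proof eventually_elim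
              case (elim y)
              then show ?case
                using abs_le_tensor_norm[OF len, of "weak_deriv k u y"] len by (simp add: weak_deriv_def)
            qed
            moreover have "?D (is @ L) \<in> borel_measurable lebesgue"
              using wp[of "is @ L"] len by (auto simp: has_weak_partial_def intro: borel_measurable_locally_integrable)
            ultimately have "ennreal \<bar>conv (monomial_times is ?g) (?D (is @ L)) x t\<bar> \<le> ennreal (C1 is) * ennreal w"
              using C1(2)[of "is"] F(1) t \<sigma>(1) ds[OF t(2)] unfolding Q_def w(2)[symmetric]
              by (meson less_le_trans)
            also have "\<dots> = ennreal (C1 is * w)"
              using C1(1)[of "is"] w(1) by (simp add: ennreal_mult)
            finally show "\<bar>conv (monomial_times is ?g) (?D (is @ L)) x t\<bar> \<le> C1 is * w"
              using C1(1)[of "is"] w(1) by (simp add: mult_nonneg_nonneg)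
          qed
          then show "\<bar>scale_deriv ?g ?D L x m t\<bar> \<le> K * w"
            by (simp add: K_def sum_distrib_right)
        next
          fix j assume j: "1 \<le> j" "j \<le> m"
          let ?t = "\<sigma> + real j * \<delta>"
          have t1: "\<delta> \<le> ?t"
          proof -
            have "1 * \<delta> \<le> real j * \<delta>" using j \<delta>(1) by (intro mult_right_mono) auto
            then show ?thesis using \<sigma>(1) by linarith
          qed
          have t2: "?t \<le> \<sigma> + real m * \<delta>" using j \<delta>(1) by (simp add: mult_right_mono)
          have "\<bar>conv ?g (?D L) x ?t\<bar> \<le> C2 * ?t powr (- (lam + length L)) * ?A"
            by (rule C2(2)[OF wpL fin _ ds[OF t2]]) (use t1 \<delta>(1) in linarith)
          \<comment> \<open>All sampled scales are at least \<delta>, and the exponent is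
            nonpositive, so the bound at \<delta> covers them all.\<close>
          also have "\<dots> \<le> S"
            unfolding S_def using C2(1) t1 \<delta>(1) lam
            by (intro mult_right_mono mult_left_mono powr_mono2') auto
          finally show "\<bar>scale_deriv ?g ?D L x 0 ?t\<bar> \<le> S" by (simp add: scale_deriv_0)
        qed (use \<delta>(1) in auto)
        then show ?thesis by (simp add: scale_deriv_0)
      qed
      have lim: "((\<lambda>s. \<bar>conv ?g (?D L) x s\<bar>) \<longlongrightarrow> \<bar>?D L x * c\<bar>) (at_right 0)"
        unfolding c_def by (intro tendsto_rabs N(2) x bump_std_bumps)
      \<comment> \<open>The strict bound on \<delta> leaves an interval of admissible \<sigma> next
        to 0. The right-hand side does not depend on \<sigma>, so the limit inherits the
        estimate.\<close>
      have "0 < \<rho> / ?d - real m * \<delta>" using m\<delta> by simp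
      then have "\<forall>\<^sub>F \<sigma> in at_right 0. \<bar>conv ?g (?D L) x \<sigma>\<bar> \<le> (2 ^ m - 1) * S + \<delta> ^ m * (K * w)"
        unfolding eventually_at_right_field using bound by blast
      from tendsto_upperbound[OF lim this]
      have "\<bar>?D L x\<bar> * c \<le> (2 ^ m - 1) * S + \<delta> ^ m * (K * w)"
        using c by (simp add: abs_mult)
      also have "\<dots> \<le> 2 ^ m * S + \<delta> ^ m * (K * w)"
        using C2(1) by (simp add: S_def algebra_simps)
      also have "\<dots> \<le> (2 ^ m * C2 + K) * (\<delta> powr (- (lam + length L)) * ?A + \<delta> ^ m * w)"
      proof -
        have "0 \<le> 2 ^ m * C2 * (\<delta> ^ m * w)" "0 \<le> K * (\<delta> powr (- (lam + length L)) * ?A)"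
          using C2(1) K w(1) \<delta>(1) by simp_all
        then show ?thesis unfolding S_def by (simp add: algebra_simps)
      qed
      finally show "\<bar>weak_partial L u x\<bar> \<le> C * (\<delta> powr (- (lam + length L)) * ?A + \<delta> ^ (k - length L) * w)"
        using c by (simp add: C_def m_def l_def pos_le_divide_eq)
    qed
  qed
qed

text \<open>There are finitely many components: their null sets can be united and their constants
  added.\<close>

lemma weak_deriv_pointwise_bound:
  assumes l: "l < k" and lam: "- real l \<le> lam"
  obtains C where "0 < C"
    "\<And>\<rho> (u :: real ^ 'n::finite \<Rightarrow> real) F. 0 < \<rho> \<Longrightarrow> u \<in> sobolev_space k p \<Longrightarrow>
       campanato_seminorm lam l \<rho> u < \<infinity> \<Longrightarrow>
       F \<in> borel_measurable borel \<Longrightarrow> (AE y in lebesgue. tensor_norm k (weak_deriv k u y) \<le> F y) \<Longrightarrow>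
       AE x in lebesgue. \<forall>w \<delta>. 0 \<le> w \<longrightarrow> maximal_function \<rho> (\<lambda>y. ennreal (F y)) x = ennreal w \<longrightarrow>
         0 < \<delta> \<longrightarrow> \<delta> < \<rho> / (real (CARD('n) + 1) * real (k - l)) \<longrightarrow>
         tensor_norm l (weak_deriv l u x) \<le> C * (\<delta> powr (- (lam + l)) *
           enn2real (campanato_seminorm lam l \<rho> u) + \<delta> ^ (k - l) * w)"
proof -
  let ?S = "{L :: 'n list. length L = l}"
  let ?d = "real (CARD('n) + 1)"
  let ?A = "\<lambda>\<rho> u :: real ^ 'n \<Rightarrow> real. enn2real (campanato_seminorm lam l \<rho> u)"
  define Q where "Q C L \<longleftrightarrow> (\<forall>\<rho> (u :: real ^ 'n \<Rightarrow> real) F. 0 < \<rho> \<longrightarrow> u \<in> sobolev_space k p \<longrightarrow>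
       campanato_seminorm lam l \<rho> u < \<infinity> \<longrightarrow>
       F \<in> borel_measurable borel \<longrightarrow> (AE y in lebesgue. tensor_norm k (weak_deriv k u y) \<le> F y) \<longrightarrow>
       (AE x in lebesgue. \<forall>w \<delta>. 0 \<le> w \<longrightarrow> maximal_function \<rho> (\<lambda>y. ennreal (F y)) x = ennreal w \<longrightarrow>
         0 < \<delta> \<longrightarrow> \<delta> < \<rho> / (?d * real (k - l)) \<longrightarrow>
         \<bar>weak_partial L u x\<bar> \<le> C * (\<delta> powr (- (lam + l)) * ?A \<rho> u + \<delta> ^ (k - l) * w)))" for C L
  have "\<forall>L\<in>?S. \<exists>C. 0 < C \<and> Q C L"
  proof
    fix L :: "'n list" assume "L \<in> ?S"
    then have L: "length L = l" by simp
    show "\<exists>C. 0 < C \<and> Q C L"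
      unfolding Q_def
      by (rule weak_partial_pointwise_bound[where L = L and k = k and lam = lam and p = p, unfolded L, OF l lam])
         blast
  qed
  from bchoice[OF this] obtain C where C: "\<forall>L\<in>?S. 0 < C L \<and> Q (C L) L" by blast
  show ?thesis
  proof (rule that[of "\<Sum>L\<in>?S. C L"])
    \<comment> \<open>Any list of length \<open>l\<close> shows that the sum of positive constants
      is nonempty, hence positive.\<close>
    have "replicate l undefined \<in> ?S" by simp
    then have "?S \<noteq> {}" by blast
    then show "0 < (\<Sum>L\<in>?S. C L)"
      using C by (intro sum_pos finite_lists_length) auto
    fix \<rho> :: real and u :: "real ^ 'n \<Rightarrow> real" and F
    assume *: "0 < \<rho>" "u \<in> sobolev_space k p" "campanato_seminorm lam l \<rho> u < \<infinity>"
      "F \<in> borel_measurable borel" "AE y in lebesgue. tensor_norm k (weak_deriv k u y) \<le> F y"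
    have "AE x in lebesgue. \<forall>L\<in>?S. \<forall>w \<delta>. 0 \<le> w \<longrightarrow> maximal_function \<rho> (\<lambda>y. ennreal (F y)) x = ennreal w \<longrightarrow>
         0 < \<delta> \<longrightarrow> \<delta> < \<rho> / (?d * real (k - l)) \<longrightarrow>
         \<bar>weak_partial L u x\<bar> \<le> C L * (\<delta> powr (- (lam + l)) * ?A \<rho> u + \<delta> ^ (k - l) * w)"
    proof (intro AE_finite_allI finite_lists_length)
      fix L :: "'n list" assume "L \<in> ?S"
      then have "Q (C L) L" using C by blast
      then show "AE x in lebesgue. \<forall>w \<delta>. 0 \<le> w \<longrightarrow> maximal_function \<rho> (\<lambda>y. ennreal (F y)) x = ennreal w \<longrightarrow>
         0 < \<delta> \<longrightarrow> \<delta> < \<rho> / (?d * real (k - l)) \<longrightarrow>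
         \<bar>weak_partial L u x\<bar> \<le> C L * (\<delta> powr (- (lam + l)) * ?A \<rho> u + \<delta> ^ (k - l) * w)"
        unfolding Q_def using * by blast
    qed
    then show "AE x in lebesgue. \<forall>w \<delta>. 0 \<le> w \<longrightarrow> maximal_function \<rho> (\<lambda>y. ennreal (F y)) x = ennreal w \<longrightarrow>
         0 < \<delta> \<longrightarrow> \<delta> < \<rho> / (?d * real (k - l)) \<longrightarrow>
         tensor_norm l (weak_deriv l u x) \<le> (\<Sum>L\<in>?S. C L) * (\<delta> powr (- (lam + l)) * ?A \<rho> u + \<delta> ^ (k - l) * w)"
    proof eventually_elim
      case (elim x)
      show ?case
      proof (intro allI impI)
        fix w \<delta> assume w: "0 \<le> w" "maximal_function \<rho> (\<lambda>y. ennreal (F y)) x = ennreal w"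
          "0 < \<delta>" "\<delta> < \<rho> / (?d * real (k - l))"
        have "tensor_norm l (weak_deriv l u x) \<le> (\<Sum>L\<in>?S. \<bar>weak_deriv l u x L\<bar>)"
          by (rule tensor_norm_le_sum)
        also have "\<dots> \<le> (\<Sum>L\<in>?S. C L * (\<delta> powr (- (lam + l)) * ?A \<rho> u + \<delta> ^ (k - l) * w))"
          using elim w by (intro sum_mono) (auto simp: weak_deriv_def)
        also have "\<dots> = (\<Sum>L\<in>?S. C L) * (\<delta> powr (- (lam + l)) * ?A \<rho> u + \<delta> ^ (k - l) * w)"
          by (simp add: sum_distrib_right)
        finally show "tensor_norm l (weak_deriv l u x) \<le> \<dots>" .
      qed
    qed
  qed
qed


section \<open>The interpolation inequality\<close>

text \<open>The scale \<open>\<delta>\<close> balances the two terms; if the balance point exceeds \<open>\<kappa> \<rho>\<close>, then the scale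
  \<open>\<kappa> \<rho> / 2\<close> is used, where the first term dominates.\<close>

lemma optimize_scale:
  fixes k l :: nat and p q lam C \<kappa> :: real
  assumes l: "l < k" and p: "1 < p" "p < q" and lam: "- real l \<le> lam"
    and lam2: "lam \<le> (real k * p - real l * q) / (q - p)" and C: "0 < C" and \<kappa>: "0 < \<kappa>" "\<kappa> \<le> 1"
  obtains C' where "0 < C'"
    "\<And>\<rho> A w W. 0 < \<rho> \<Longrightarrow> 0 \<le> A \<Longrightarrow> 0 \<le> w \<Longrightarrow> 0 \<le> W \<Longrightarrow>
       (\<And>\<delta>. 0 < \<delta> \<Longrightarrow> \<delta> < \<rho> * \<kappa> \<Longrightarrow> W \<le> C * (\<delta> powr (- (lam + l)) * A + \<delta> ^ (k - l) * w)) \<Longrightarrow>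
       \<rho> powr (l * q) * W powr q \<le> C' * (\<rho> powr (- lam) * A) powr (q - p) *
         (\<rho> powr (k * p) * w powr p + \<rho> powr (l * p) * W powr p)"
proof -
  \<comment> \<open>The factor 2 counts the two terms of the hypothesis, each bounded by the first
    one at scale \<rho> \<kappa>/2.\<close>
  define C1 where "C1 = 2 * C * (\<kappa> / 2) powr (- (lam + l))"
  define C' where "C' = C1 powr (q - p) + (2 * C) powr q"
  have C1: "0 < C1" using C \<kappa> by (simp add: C1_def)
  have C': "0 < C'" using C1 C by (simp add: C'_def add_pos_pos)
  \<comment> \<open>This makes the balance equation solvable: \<delta>^(k + lam) is increasing in
    \<delta>.\<close>
  have kl: "0 < k + lam" using l lam by linarith
  \<comment> \<open>The surplus power of \<delta> after balancing; the upper bound on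
    \<open>lam\<close> is exactly its nonnegativity.\<close>
  define e where "e = k * p - lam * (q - p) - l * q"
  have e: "0 \<le> e" using lam2 p by (simp add: e_def pos_le_divide_eq algebra_simps)
  have "\<rho> powr (l * q) * W powr q \<le> C' * (\<rho> powr (- lam) * A) powr (q - p) *
         (\<rho> powr (k * p) * w powr p + \<rho> powr (l * p) * W powr p)"
    if \<rho>: "0 < \<rho>" and A: "0 \<le> A" and w: "0 \<le> w" and W: "0 \<le> W"
      and bd: "\<And>\<delta>. 0 < \<delta> \<Longrightarrow> \<delta> < \<rho> * \<kappa> \<Longrightarrow> W \<le> C * (\<delta> powr (- (lam + l)) * A + \<delta> ^ (k - l) * w)"
    for \<rho> A w W
  proof -
    let ?R = "(\<rho> powr (- lam) * A) powr (q - p)"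
    have R: "0 \<le> ?R" by simp
    have split: "\<delta> ^ (k - l) = \<delta> powr (- (lam + l)) * \<delta> powr (k + lam)" if "0 < \<delta>" for \<delta> :: real
    proof -
      have "\<delta> ^ (k - l) = \<delta> powr (real (k - l))" using that by (simp add: powr_realpow)
      also have "real (k - l) = - (lam + l) + (k + lam)" using l by simp
      finally show ?thesis by (simp only: powr_add)
    qed
    \<comment> \<open>The value A = 0 is split off because the balance point would then be \<delta>
      = 0.\<close>
    consider (far) "w * (\<rho> * \<kappa>) powr (k + lam) \<le> A" | (zero) "A < w * (\<rho> * \<kappa>) powr (k + lam)" "A = 0"
      | (near) "A < w * (\<rho> * \<kappa>) powr (k + lam)" "0 < A" using A by linarith
    then show ?thesis
    proof cases
      case far
      \<comment> \<open>Half of \<rho> \<kappa>, since the hypothesis requires strict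
        inequality.\<close>
      define \<delta> where "\<delta> = \<rho> * (\<kappa> / 2)"
      have \<delta>: "0 < \<delta>" "\<delta> < \<rho> * \<kappa>" using \<rho> \<kappa> by (auto simp: \<delta>_def)
      have "\<delta> powr (k + lam) \<le> (\<rho> * \<kappa>) powr (k + lam)"
        using \<delta> kl by (intro powr_mono2) auto
      then have "w * \<delta> powr (k + lam) \<le> A"
        using far mult_left_mono[OF _ w] by (meson order.trans)
      then have "\<delta> ^ (k - l) * w \<le> \<delta> powr (- (lam + l)) * A"
        unfolding split[OF \<delta>(1)] by (simp add: mult_left_mono mult.assoc mult.commute[of w])
      then have "W \<le> C * (\<delta> powr (- (lam + l)) * A + \<delta> powr (- (lam + l)) * A)"
        using bd[OF \<delta>] C by (meson add_left_mono mult_left_mono less_imp_le order.trans)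
      also have "\<dots> = C1 * (\<rho> powr (- real l) * (\<rho> powr (- lam) * A))"
      proof -
        have "\<delta> powr (- (lam + l)) = (\<rho> powr (- real l) * \<rho> powr (- lam)) * (\<kappa> / 2) powr (- (lam + l))"
        proof -
          have "(\<rho> * (\<kappa> / 2)) powr (- (lam + l)) = \<rho> powr (- (lam + l)) * (\<kappa> / 2) powr (- (lam + l))"
            by (rule powr_mult)
          moreover have "\<rho> powr (- (lam + l)) = \<rho> powr (- real l) * \<rho> powr (- lam)"
            by (simp add: powr_add[symmetric] add.commute)
          ultimately show ?thesis unfolding \<delta>_def by (simp only:)
        qed
        then show ?thesis by (simp add: C1_def mult_ac)
      qed
      finally have Wle: "W \<le> C1 * (\<rho> powr (- real l) * (\<rho> powr (- lam) * A))" .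
      \<comment> \<open>Only q - p of the q powers of \<open>W\<close> are estimated; the remaining
        W^p is the D^l u term on the right-hand side.\<close>
      have "W powr q = W powr (q - p) * W powr p"
        by (simp add: powr_add[symmetric])
      also have "\<dots> \<le> (C1 * (\<rho> powr (- real l) * (\<rho> powr (- lam) * A))) powr (q - p) * W powr p"
        using W Wle p by (intro mult_right_mono powr_mono2) auto
      also have "\<dots> = C1 powr (q - p) * (\<rho> powr (- real l * (q - p)) * ?R) * W powr p"
        using C1 A \<rho> by (simp add: powr_mult powr_powr)
      finally have "\<rho> powr (l * q) * W powr q \<le> \<rho> powr (l * q) * (C1 powr (q - p) * (\<rho> powr (- real l * (q - p)) * ?R) * W powr p)"
        by (rule mult_left_mono) simp
      also have "\<dots> = C1 powr (q - p) * ?R * ((\<rho> powr (l * q) * \<rho> powr (- real l * (q - p))) * W powr p)"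
        by (simp only: mult_ac)
      also have "\<rho> powr (l * q) * \<rho> powr (- real l * (q - p)) = \<rho> powr (l * p)"
        by (simp add: powr_add[symmetric] algebra_simps)
      also have "C1 powr (q - p) * ?R * (\<rho> powr (l * p) * W powr p) \<le> C' * ?R * (\<rho> powr (k * p) * w powr p + \<rho> powr (l * p) * W powr p)"
        by (intro mult_mono) (auto simp: C'_def)
      finally show ?thesis .
    next
      case zero
      then have w0: "0 < w" using w by (cases "w = 0") auto
      have "W = 0"
      proof (rule ccontr)
        assume "W \<noteq> 0"
        then have W0: "0 < W" using W by simp
        \<comment> \<open>With A = 0 only the second term is left. As k - l >= 1, the bound \<delta>
          <= 1 gives \<delta>^(k-l) <= \<delta>, and the last entry of the minimum makes the
          estimate read W <= W/2.\<close>
        define \<delta> where "\<delta> = min (\<rho> * \<kappa> / 2) (min 1 (W / (2 * C * w)))"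
        have \<delta>: "0 < \<delta>" "\<delta> < \<rho> * \<kappa>" "\<delta> \<le> 1" "\<delta> \<le> W / (2 * C * w)"
        proof -
          have "0 < \<rho> * \<kappa>" "0 < W / (2 * C * w)" using \<rho> \<kappa> W0 C w0 by simp_all
          then show "0 < \<delta>" "\<delta> < \<rho> * \<kappa>" "\<delta> \<le> 1" "\<delta> \<le> W / (2 * C * w)"
            unfolding \<delta>_def by linarith+
        qed
        have "\<delta> ^ (k - l) \<le> \<delta> ^ 1" using \<delta> l by (intro power_decreasing) auto
        then have "\<delta> ^ (k - l) \<le> W / (2 * C * w)" using \<delta>(4) by simp
        then have "C * (\<delta> ^ (k - l) * w) \<le> C * (W / (2 * C * w) * w)"
          using C w by (intro mult_left_mono mult_right_mono) auto
        also have "\<dots> = W / 2" using C w0 by simp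
        finally show False using bd[OF \<delta>(1,2)] zero W0 by simp
      qed
      with zero p show ?thesis by simp
    next
      case near
      then have w0: "0 < w" using w by (cases "w = 0") auto
      define \<delta> where "\<delta> = (A / w) powr (1 / (k + lam))"
      have \<delta>0: "0 < \<delta>" using near w0 by (simp add: \<delta>_def)
      have \<delta>A: "\<delta> powr (k + lam) = A / w"
        using kl near w0 by (simp add: \<delta>_def powr_powr)
      then have A_eq: "A = \<delta> powr (k + lam) * w" using w0 by simp
      have "\<delta> < ((\<rho> * \<kappa>) powr (k + lam)) powr (1 / (k + lam))"
        unfolding \<delta>_def using near w0 kl by (intro powr_less_mono2) (auto simp: pos_divide_less_eq mult.commute)
      also have "\<dots> = \<rho> * \<kappa>" using \<rho> \<kappa> kl by (simp add: powr_powr)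
      finally have \<delta>\<kappa>: "\<delta> < \<rho> * \<kappa>" .
      also have "\<rho> * \<kappa> \<le> \<rho>" using \<rho> \<kappa> by (simp add: mult_left_le)
      finally have \<delta>\<rho>: "\<delta> \<le> \<rho>" by simp
      have "\<delta> powr (- (lam + l)) * A = \<delta> ^ (k - l) * w"
        by (simp add: split[OF \<delta>0] A_eq mult.assoc)
      then have "W \<le> 2 * C * (\<delta> ^ (k - l) * w)"
        using bd[OF \<delta>0 \<delta>\<kappa>] by (simp add: mult_ac)
      also have "\<delta> ^ (k - l) = \<delta> powr (real k - real l)"
        using \<delta>0 l by (simp add: powr_realpow[symmetric] of_nat_diff)
      finally have Wle: "W \<le> 2 * C * (\<delta> powr (real k - real l) * w)" .
      have "W powr q \<le> (2 * C * (\<delta> powr (real k - real l) * w)) powr q"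
        using W Wle p by (intro powr_mono2) auto
      also have "\<dots> = (2 * C) powr q * (\<delta> powr ((real k - real l) * q) * w powr q)"
        using C w0 by (simp add: powr_mult powr_powr)
      \<comment> \<open>All q powers of \<open>W\<close> are estimated here, giving the D^k u term.
        The exponent is split so that the balance equation turns its first part, times w^(q-p), into
        A^(q-p).\<close>
      also have "(real k - real l) * q = (k + lam) * (q - p) + e"
        by (simp add: e_def algebra_simps)
      also have "\<delta> powr ((k + lam) * (q - p) + e) = \<delta> powr ((k + lam) * (q - p)) * \<delta> powr e"
        by (rule powr_add)
      finally have "\<rho> powr (l * q) * W powr q \<le>
          \<rho> powr (l * q) * ((2 * C) powr q * (\<delta> powr ((k + lam) * (q - p)) * \<delta> powr e * w powr q))"
        by (rule mult_left_mono) simp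
      \<comment> \<open>The surplus \<delta>^e is given away; it supplies exactly the powers of
        \<rho> that make the inequality homogeneous.\<close>
      also have "\<dots> \<le> \<rho> powr (l * q) * ((2 * C) powr q * (\<delta> powr ((k + lam) * (q - p)) * \<rho> powr e * w powr q))"
        using \<delta>0 \<delta>\<rho> e by (intro mult_left_mono mult_right_mono powr_mono2) auto
      also have "\<dots> = (2 * C) powr q * ((\<rho> powr (l * q) * \<rho> powr e) * (\<delta> powr ((k + lam) * (q - p)) * w powr q))"
        by (simp only: mult_ac)
      also have "\<rho> powr (l * q) * \<rho> powr e = \<rho> powr (- lam * (q - p)) * \<rho> powr (k * p)"
        by (simp add: powr_add[symmetric] e_def algebra_simps)
      also have "w powr q = w powr (q - p) * w powr p"
        by (simp add: powr_add[symmetric])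
      also have "(2 * C) powr q * (\<rho> powr (- lam * (q - p)) * \<rho> powr (k * p) * (\<delta> powr ((k + lam) * (q - p)) * (w powr (q - p) * w powr p)))
          = (2 * C) powr q * ?R * (\<rho> powr (k * p) * w powr p)"
        using \<rho> \<delta>0 w0 unfolding A_eq by (simp add: powr_mult powr_powr mult_ac)
      also have "\<dots> \<le> C' * ?R * (\<rho> powr (k * p) * w powr p + \<rho> powr (l * p) * W powr p)"
        by (intro mult_mono) (auto simp: C'_def)
      finally show ?thesis .
    qed
  qed
  with C' that show ?thesis by blast
qed

text \<open>The scale is optimized over real numbers, so the maximal function must be finite almost
  everywhere. This follows from its integrable majorant \<open>J\<close>, which is infinite wherever
  \<open>M\<close> is.\<close>

lemma maximal_function_real_AE:
  fixes F :: "'a::euclidean_space \<Rightarrow> real"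
  assumes p: "0 < p" and J: "J \<in> borel_measurable borel" "(\<integral>\<^sup>+x. J x \<partial>lborel) < \<infinity>"
    and bd: "\<And>x w. 0 \<le> w \<Longrightarrow> ennreal w \<le> M x \<Longrightarrow> ennreal (w powr p) \<le> J x"
  shows "AE x in lebesgue. \<exists>w\<ge>0. M x = ennreal w \<and> ennreal (w powr p) \<le> J x"
proof -
  have "AE x in lborel. J x \<noteq> \<infinity>"
    using J by (intro nn_integral_PInf_AE) auto
  then have "AE x in lebesgue. J x \<noteq> \<infinity>"
    by (rule AE_completion)
  then show ?thesis
  proof eventually_elim
    case (elim x)
    then obtain r where r: "0 \<le> r" "J x = ennreal r" by (cases "J x") auto
    have "M x \<noteq> \<infinity>"
    proof
      assume "M x = \<infinity>"
      \<comment> \<open>The test value is the p-th root of r + 1, whose p-th power exceeds J(x) =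
        r.\<close>
      then have "ennreal (((r + 1) powr (1 / p)) powr p) \<le> J x"
        by (intro bd) auto
      then show False using r p by (simp add: powr_powr)
    qed
    then obtain w where "0 \<le> w" "M x = ennreal w" by (cases "M x") auto
    then show ?case using bd[of w x] by auto
  qed
qed

lemma lebesgue_borel_version:
  fixes f :: "'a::euclidean_space \<Rightarrow> real"
  assumes "f \<in> borel_measurable lebesgue" "\<And>x. 0 \<le> f x"
  obtains F where "F \<in> borel_measurable borel" "\<And>x. 0 \<le> F x" "AE x in lebesgue. f x = F x"
proof -
  obtain g where g: "g \<in> borel_measurable lborel" "AE x in lborel. f x = g x"
    using completion_ex_borel_measurable_real[OF assms(1)] by blast
  show ?thesis
  \<comment> \<open>The absolute value restores nonnegativity on the null set where the Borel
    version may differ from \<open>f\<close>.\<close>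
  proof (rule that[of "\<lambda>x. \<bar>g x\<bar>"])
    show "(\<lambda>x. \<bar>g x\<bar>) \<in> borel_measurable borel" using g(1) by simp
    have "AE x in lebesgue. f x = g x" using g(2) by (rule AE_completion)
    then show "AE x in lebesgue. f x = \<bar>g x\<bar>"
      by eventually_elim (metis abs_of_nonneg assms(2))
  qed simp
qed

theorem theorem2p1:
  fixes k l :: nat and p q lam :: real
  assumes "1 \<le> k" and "l \<in> {0..k - 1}"
    and "1 < p" and "p < q"
    and "- real l \<le> lam" and "lam \<le> (real k * p - real l * q) / (q - p)"
  shows "\<exists>C::real. \<forall>\<rho>>0. \<forall>u :: real ^ 'n::finite \<Rightarrow> real.
           u \<in> sobolev_space k p \<inter> campanato_space lam l \<rho> \<longrightarrow>
             weak_deriv l u \<in> Lp_tensor_space l q \<and>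
             (LINT x|lebesgue. \<rho> powr (real l * q) * tensor_norm l (weak_deriv l u x) powr q)
             \<le> C * (\<rho> powr (- lam) * enn2real (campanato_seminorm lam l \<rho> u)) powr (q - p) *
               (LINT x|lebesgue. \<rho> powr (real k * p) * tensor_norm k (weak_deriv k u x) powr p
                  + \<rho> powr (real l * p) * tensor_norm l (weak_deriv l u x) powr p)"
proof -
  have l: "l < k" using assms(1,2) by auto
  let ?\<kappa> = "1 / (real (CARD('n) + 1) * real (k - l))"
  have "1 * 1 \<le> real (CARD('n) + 1) * real (k - l)"
    using l by (intro mult_mono) auto
  then have \<kappa>: "0 < ?\<kappa>" "?\<kappa> \<le> 1"
    using l by (auto simp only: divide_le_eq_1_pos zero_less_divide_1_iff)
  obtain C0 where C0: "0 < C0"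
    "\<And>\<rho> (u :: real ^ 'n \<Rightarrow> real) F. 0 < \<rho> \<Longrightarrow> u \<in> sobolev_space k p \<Longrightarrow>
       campanato_seminorm lam l \<rho> u < \<infinity> \<Longrightarrow>
       F \<in> borel_measurable borel \<Longrightarrow> (AE y in lebesgue. tensor_norm k (weak_deriv k u y) \<le> F y) \<Longrightarrow>
       AE x in lebesgue. \<forall>w \<delta>. 0 \<le> w \<longrightarrow> maximal_function \<rho> (\<lambda>y. ennreal (F y)) x = ennreal w \<longrightarrow>
         0 < \<delta> \<longrightarrow> \<delta> < \<rho> / (real (CARD('n) + 1) * real (k - l)) \<longrightarrow>
         tensor_norm l (weak_deriv l u x) \<le> C0 * (\<delta> powr (- (lam + l)) *
           enn2real (campanato_seminorm lam l \<rho> u) + \<delta> ^ (k - l) * w)"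
    by (rule weak_deriv_pointwise_bound[where 'n = 'n and p = p, OF l assms(5)]) blast
  obtain C' where C': "0 < C'"
    "\<And>\<rho> A w W. 0 < \<rho> \<Longrightarrow> 0 \<le> A \<Longrightarrow> 0 \<le> w \<Longrightarrow> 0 \<le> W \<Longrightarrow>
       (\<And>\<delta>. 0 < \<delta> \<Longrightarrow> \<delta> < \<rho> * ?\<kappa> \<Longrightarrow> W \<le> C0 * (\<delta> powr (- (lam + l)) * A + \<delta> ^ (k - l) * w)) \<Longrightarrow>
       \<rho> powr (l * q) * W powr q \<le> C' * (\<rho> powr (- lam) * A) powr (q - p) *
         (\<rho> powr (k * p) * w powr p + \<rho> powr (l * p) * W powr p)"
    using optimize_scale[OF l assms(3-6) C0(1) \<kappa>] by blast
  \<comment> \<open>The constant of the maximal inequality: 5^N from the Vitali covering, 2^p from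
    truncating at t/2, p/(p - 1) from the layer-cake integration.\<close>
  define Cp where "Cp = 5 ^ CARD('n) * 2 powr p * p / (p - 1)"
  have Cp: "0 \<le> Cp" using assms(3) by (simp add: Cp_def)
  show ?thesis
  \<comment> \<open>Cp + 1 dominates both \<open>Cp\<close>, which multiplies the D^k u term after
    the maximal inequality, and 1, which multiplies the D^l u term.\<close>
  proof (intro exI[of _ "C' * (Cp + 1)"] allI impI)
    fix \<rho> :: real and u :: "real ^ 'n \<Rightarrow> real"
    assume \<rho>: "0 < \<rho>" and u: "u \<in> sobolev_space k p \<inter> campanato_space lam l \<rho>"
    then have us: "u \<in> sobolev_space k p" and fin: "campanato_seminorm lam l \<rho> u < \<infinity>"
      by (auto simp: campanato_space_def)
    define V where "V x = tensor_norm k (weak_deriv k u x)" for x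
    define W where "W x = tensor_norm l (weak_deriv l u x)" for x
    define A where "A = enn2real (campanato_seminorm lam l \<rho> u)"
    define R where "R = (\<rho> powr (- lam) * A) powr (q - p)"
    have nonneg: "0 \<le> V x" "0 \<le> W x" "0 \<le> A" "0 \<le> R" for x
      by (auto simp: V_def W_def A_def R_def tensor_norm_nonneg)
    have V [measurable]: "V \<in> borel_measurable lebesgue" and W [measurable]: "W \<in> borel_measurable lebesgue"
      and Vp: "integrable lebesgue (\<lambda>x. V x powr p)" and Wp: "integrable lebesgue (\<lambda>x. W x powr p)"
      unfolding V_def W_def
      using borel_measurable_tensor_norm_weak_deriv[OF us] integrable_tensor_norm_weak_deriv[OF us] l assms(3)
      by simp_all
    obtain F where F: "F \<in> borel_measurable borel" "\<And>x. 0 \<le> F x" "AE x in lebesgue. V x = F x"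
      using lebesgue_borel_version[OF V nonneg(1)] by blast
    let ?M = "maximal_function \<rho> (\<lambda>y. ennreal (F y))"
    obtain J where J: "J \<in> borel_measurable borel"
      "\<And>x w. 0 \<le> w \<Longrightarrow> ennreal w \<le> ?M x \<Longrightarrow> ennreal (w powr p) \<le> J x"
      "(\<integral>\<^sup>+x. J x \<partial>lborel) \<le> ennreal Cp * (\<integral>\<^sup>+x. ennreal (F x powr p) \<partial>lborel)"
      using maximal_function_strong_type[OF F(1,2) assms(3)] by (auto simp: Cp_def)
    have "(\<integral>\<^sup>+x. ennreal (F x powr p) \<partial>lborel) = (\<integral>\<^sup>+x. ennreal (F x powr p) \<partial>lebesgue)"
      using F(1) by (subst nn_integral_completion) auto
    also have "\<dots> = (\<integral>\<^sup>+x. ennreal (V x powr p) \<partial>lebesgue)"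
      by (rule nn_integral_cong_AE) (use F(3) in eventually_elim, simp)
    also have "\<dots> = ennreal (LINT x|lebesgue. V x powr p)"
      by (rule nn_integral_eq_integral[OF Vp]) simp
    finally have Jint: "(\<integral>\<^sup>+x. J x \<partial>lborel) \<le> ennreal (Cp * (LINT x|lebesgue. V x powr p))"
      using J(3) Cp by (simp add: ennreal_mult)
    then have "(\<integral>\<^sup>+x. J x \<partial>lborel) < \<infinity>" by (simp add: order.strict_trans1)
    from maximal_function_real_AE[where M = ?M, OF _ J(1) this J(2)]
    have AE1: "AE x in lebesgue. \<exists>w\<ge>0. ?M x = ennreal w \<and> ennreal (w powr p) \<le> J x"
      using assms(3) by simp
    have "AE y in lebesgue. tensor_norm k (weak_deriv k u y) \<le> F y"
      using F(3) by eventually_elim (simp add: V_def)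
    from C0(2)[OF \<rho> us fin F(1) this]
    have AE2: "AE x in lebesgue. \<forall>w \<delta>. 0 \<le> w \<longrightarrow> ?M x = ennreal w \<longrightarrow> 0 < \<delta> \<longrightarrow> \<delta> < \<rho> * ?\<kappa> \<longrightarrow>
         W x \<le> C0 * (\<delta> powr (- (lam + l)) * A + \<delta> ^ (k - l) * w)"
      by (simp add: W_def A_def)
    \<comment> \<open>Stated in \<open>ennreal\<close>, so that it can be integrated before W^q is
      known to be integrable and with the extended-valued \<open>J\<close> in place of w^p.\<close>
    have pointwise: "AE x in lebesgue. ennreal (\<rho> powr (l * q) * W x powr q) \<le>
        ennreal (C' * R) * (ennreal (\<rho> powr (k * p)) * J x + ennreal (\<rho> powr (l * p) * W x powr p))"
      using AE1 AE2
    proof eventually_elim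
      case (elim x)
      then obtain w where w: "0 \<le> w" "?M x = ennreal w" "ennreal (w powr p) \<le> J x" by blast
      have "\<rho> powr (l * q) * W x powr q \<le> C' * R * (\<rho> powr (k * p) * w powr p + \<rho> powr (l * p) * W x powr p)"
        unfolding R_def by (rule C'(2)[OF \<rho> nonneg(3) w(1) nonneg(2)]) (use elim(2) w in blast)
      then have "ennreal (\<rho> powr (l * q) * W x powr q) \<le>
          ennreal (C' * R * (\<rho> powr (k * p) * w powr p + \<rho> powr (l * p) * W x powr p))"
        by (rule ennreal_leI)
      also have "\<dots> = ennreal (C' * R) * (ennreal (\<rho> powr (k * p)) * ennreal (w powr p) + ennreal (\<rho> powr (l * p) * W x powr p))"
        using C'(1) nonneg(4) by (simp add: ennreal_mult)
      also have "\<dots> \<le> ennreal (C' * R) * (ennreal (\<rho> powr (k * p)) * J x + ennreal (\<rho> powr (l * p) * W x powr p))"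
        using w(3) by (intro mult_left_mono add_mono) auto
      finally show ?case .
    qed
    let ?a = "LINT x|lebesgue. V x powr p" and ?b = "LINT x|lebesgue. W x powr p"
    have ab: "0 \<le> ?a" "0 \<le> ?b" by simp_all
    have Jm: "J \<in> borel_measurable lebesgue" using J(1) by (intro measurable_completion) simp
    have "(\<integral>\<^sup>+x. ennreal (\<rho> powr (l * q) * W x powr q) \<partial>lebesgue) \<le>
        (\<integral>\<^sup>+x. ennreal (C' * R) * (ennreal (\<rho> powr (k * p)) * J x + ennreal (\<rho> powr (l * p) * W x powr p)) \<partial>lebesgue)"
      by (rule nn_integral_mono_AE[OF pointwise])
    also have "\<dots> = ennreal (C' * R) * (ennreal (\<rho> powr (k * p)) * (\<integral>\<^sup>+x. J x \<partial>lebesgue) +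
        (\<integral>\<^sup>+x. ennreal (\<rho> powr (l * p) * W x powr p) \<partial>lebesgue))"
      using Jm by (simp add: nn_integral_cmult nn_integral_add)
    also have "(\<integral>\<^sup>+x. J x \<partial>lebesgue) = (\<integral>\<^sup>+x. J x \<partial>lborel)"
      by (rule nn_integral_completion)
    also have "(\<integral>\<^sup>+x. ennreal (\<rho> powr (l * p) * W x powr p) \<partial>lebesgue) = ennreal (\<rho> powr (l * p) * ?b)"
      using Wp by (subst nn_integral_eq_integral) auto
    also have "ennreal (C' * R) * (ennreal (\<rho> powr (k * p)) * (\<integral>\<^sup>+x. J x \<partial>lborel) + ennreal (\<rho> powr (l * p) * ?b))
        \<le> ennreal (C' * R) * (ennreal (\<rho> powr (k * p)) * ennreal (Cp * ?a) + ennreal (\<rho> powr (l * p) * ?b))"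
      using Jint by (intro mult_left_mono add_mono) auto
    also have "\<dots> = ennreal (C' * R * (\<rho> powr (k * p) * (Cp * ?a) + \<rho> powr (l * p) * ?b))"
      using C'(1) nonneg(4) Cp ab by (simp add: ennreal_mult)
    finally have main: "(\<integral>\<^sup>+x. ennreal (\<rho> powr (l * q) * W x powr q) \<partial>lebesgue) \<le>
        ennreal (C' * R * (\<rho> powr (k * p) * (Cp * ?a) + \<rho> powr (l * p) * ?b))" .
    \<comment> \<open>Finiteness of the right-hand side of \<open>main\<close> yields the asserted
      membership in L^q; only then does the inequality pass to Bochner integrals.\<close>
    have int: "integrable lebesgue (\<lambda>x. \<rho> powr (l * q) * W x powr q)"
    proof (rule integrableI_bounded)
      show "(\<integral>\<^sup>+x. ennreal (norm (\<rho> powr (l * q) * W x powr q)) \<partial>lebesgue) < \<infinity>"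
        using main by (simp add: order.strict_trans1)
    qed measurable
    have Wq: "integrable lebesgue (\<lambda>x. W x powr q)"
      using integrable_mult_right[OF int, of "1 / \<rho> powr (l * q)"] \<rho> by simp
    have rhs: "(LINT x|lebesgue. \<rho> powr (real k * p) * V x powr p + \<rho> powr (real l * p) * W x powr p)
        = \<rho> powr (k * p) * ?a + \<rho> powr (l * p) * ?b"
      using Vp Wp by simp
    have "(LINT x|lebesgue. \<rho> powr (l * q) * W x powr q) \<le> C' * R * (\<rho> powr (k * p) * (Cp * ?a) + \<rho> powr (l * p) * ?b)"
    proof -
      have "ennreal (LINT x|lebesgue. \<rho> powr (l * q) * W x powr q) \<le>
          ennreal (C' * R * (\<rho> powr (k * p) * (Cp * ?a) + \<rho> powr (l * p) * ?b))"
        using main by (subst nn_integral_eq_integral[OF int, symmetric]) auto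
      moreover have "0 \<le> C' * R * (\<rho> powr (k * p) * (Cp * ?a) + \<rho> powr (l * p) * ?b)"
        using C'(1) nonneg(4) Cp ab by (intro mult_nonneg_nonneg add_nonneg_nonneg) auto
      ultimately show ?thesis by simp
    qed
    also have "\<dots> \<le> C' * R * ((Cp + 1) * (\<rho> powr (k * p) * ?a + \<rho> powr (l * p) * ?b))"
    proof (rule mult_left_mono)
      have "0 \<le> \<rho> powr (k * p) * ?a" "0 \<le> Cp * (\<rho> powr (l * p) * ?b)"
        using ab Cp by (intro mult_nonneg_nonneg; simp)+
      then show "\<rho> powr (k * p) * (Cp * ?a) + \<rho> powr (l * p) * ?b \<le> (Cp + 1) * (\<rho> powr (k * p) * ?a + \<rho> powr (l * p) * ?b)"
        by (simp add: algebra_simps)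
    qed (use C'(1) nonneg(4) in simp)
    finally have "(LINT x|lebesgue. \<rho> powr (real l * q) * W x powr q) \<le>
        C' * (Cp + 1) * R * (LINT x|lebesgue. \<rho> powr (real k * p) * V x powr p + \<rho> powr (real l * p) * W x powr p)"
      unfolding rhs by (simp add: mult_ac)
    moreover have "weak_deriv l u \<in> Lp_tensor_space l q"
      using Wq borel_measurable_weak_deriv[OF us, of l] l unfolding W_def by (simp add: Lp_tensor_space_def)
    ultimately show "weak_deriv l u \<in> Lp_tensor_space l q \<and>
        (LINT x|lebesgue. \<rho> powr (real l * q) * tensor_norm l (weak_deriv l u x) powr q)
             \<le> C' * (Cp + 1) * (\<rho> powr (- lam) * enn2real (campanato_seminorm lam l \<rho> u)) powr (q - p) *
               (LINT x|lebesgue. \<rho> powr (real k * p) * tensor_norm k (weak_deriv k u x) powr p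
                  + \<rho> powr (real l * p) * tensor_norm l (weak_deriv l u x) powr p)"
      unfolding R_def A_def V_def W_def by blast
  qed
qed

end
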